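(* Let $\mathbb{C}$ be a regular category. Then the following conditions are equivalent: (i) $\mathbb{C}$ is a Goursat category; (ii) the category $\mathrm{Grpd}(\mathbb{C})$ of internal groupoids in $\mathbb{C}$ is closed under quotients in the category $\mathrm{RG}(\mathbb{C})$ of reflexive graphs in $\mathbb{C}$; (iii) the category $\mathrm{Cat}(\mathbb{C})$ of internal categories in $\mathbb{C}$ is closed under quotients in $\mathrm{RG}(\mathbb{C})$.
   Context: A category is regular if it is finitely complete, regular epimorphisms are stable under pullbacks, and kernel pairs have coequalisers. A relation from $X$ to $Y$ is a subobject $\langle r_1,r_2\rangle : R \rightarrowtail X\times Y$; in a regular category the composite $SR$ of $R\rightarrowtail X\times Y$ and $S\rightarrowtail Y\times Z$ is the image of $(r_1 p_1, s_2 p_2): R\times_Y S\to X\times Z$, where $R\times_Y S$ (with projections $p_1,p_2$) is the pullback of $r_2$ along $s_1$. An equivalence relation on $X$ is a relation from $X$ to $X$ that is (internally) reflexive, symmetric and transitive. A Goursat category is a regular category in which $RSR=SRS$ for any pair of equivalence relations $R,S$ on the same object. A reflexive graph in $\mathbb{C}$ consists of objects $X_1,X_0$ and arrows $d,c:X_1\to X_0$, $e:X_0\to X_1$ with $d e=1_{X_0}=c e$. A morphism of reflexive graphs $(X_1,X_0,d,c,e)\to(X_1',X_0',d',c',e')$ is a pair $(f,g)$ with $f:X_0\to X_0'$, $g:X_1\to X_1'$, $d'g=fd$, $c'g=fc$, $ge=e'f$. These form the category $\mathrm{RG}(\mathbb{C})$. An internal category in $\mathbb{C}$ is a reflexive graph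 $(X_1,X_0,d,c,e)$ in $\mathbb{C}$ (i.e. objects $X_1,X_0$ and arrows $d,c:X_1\to X_0$, $e:X_0\to X_1$ with $d e=1_{X_0}=c e$) with a multiplication $m:X_1\times_{X_0}X_1\to X_1$, where $X_1\times_{X_0}X_1$ is the pullback with projections $p_1,p_2$ satisfying $c p_1=d p_2$, such that $d m=d p_1$, $c m=c p_2$, $m\langle e d,1_{X_1}\rangle=1_{X_1}=m\langle 1_{X_1},e c\rangle$, and $m(1\times m)=m(m\times 1)$. An internal category is a groupoid when there is in addition an arrow $i:X_1\to X_1$ with $d i=c$, $c i=d$, $m\langle i,1_{X_1}\rangle=e c$ and $m\langle 1_{X_1},i\rangle=e d$. $\mathrm{Cat}(\mathbb{C})$ and $\mathrm{Grpd}(\mathbb{C})$ are the categories of internal categories, respectively groupoids, in $\mathbb{C}$, with internal functors as morphisms. $\mathbb{P}$ is closed under quotients in $\mathbb{Q}$ if, for any regular epimorphism $A\twoheadrightarrow B$ in $\mathbb{Q}$ with $A\in\mathbb{P}$, also $B\in\mathbb{P}$. Here a reflexive graph is said to be in $\mathrm{Grpd}(\mathbb{C})$ (respectively $\mathrm{Cat}(\mathbb{C})$) when it underlies a groupoid (respectively an internal category), i.e. when it admits such a structure. *)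

theory Defs
  imports Main
begin

section \<open>Categories\<close>

record ('o, 'a) cat =
  Obj :: "'o set"
  Arr :: "'a set"
  Dom :: "'a \<Rightarrow> 'o"
  Cod :: "'a \<Rightarrow> 'o"
  Ide :: "'o \<Rightarrow> 'a"
  Comp :: "'a \<Rightarrow> 'a \<Rightarrow> 'a"  (infixl "\<cdot>\<index>" 70)

text \<open>Composition is written in the usual applicative order: in \<open>g \<cdot>\<^bsub>C\<^esub> f\<close> the arrow \<open>f\<close> comes
  first, and the value is only meaningful when \<open>Cod C f = Dom C g\<close>.\<close>

definition hom :: "('o, 'a) cat \<Rightarrow> 'o \<Rightarrow> 'o \<Rightarrow> 'a set" where
  "hom C A B = {f \<in> Arr C. Dom C f = A \<and> Cod C f = B}"

locale category =
  fixes C :: "('o, 'a) cat" (structure)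
  assumes Dom_Obj: "f \<in> Arr C \<Longrightarrow> Dom C f \<in> Obj C"
    and Cod_Obj: "f \<in> Arr C \<Longrightarrow> Cod C f \<in> Obj C"
    and Ide_hom: "A \<in> Obj C \<Longrightarrow> Ide C A \<in> hom C A A"
    and Comp_hom: "f \<in> hom C A B \<Longrightarrow> g \<in> hom C B D \<Longrightarrow> g \<cdot> f \<in> hom C A D"
    and Comp_Ide: "f \<in> hom C A B \<Longrightarrow> f \<cdot> Ide C A = f"
    and Ide_Comp: "f \<in> hom C A B \<Longrightarrow> Ide C B \<cdot> f = f"
    and Comp_assoc: "f \<in> hom C A B \<Longrightarrow> g \<in> hom C B D \<Longrightarrow> h \<in> hom C D E \<Longrightarrow>
      h \<cdot> (g \<cdot> f) = (h \<cdot> g) \<cdot> f"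

section \<open>Limits and colimits\<close>

definition is_functor ::
  "('i, 'j) cat \<Rightarrow> ('o, 'a) cat \<Rightarrow> ('i \<Rightarrow> 'o) \<Rightarrow> ('j \<Rightarrow> 'a) \<Rightarrow> bool" where
  "is_functor J C F0 F1 \<longleftrightarrow>
     (\<forall>i \<in> Obj J. F0 i \<in> Obj C) \<and>
     (\<forall>u \<in> Arr J. F1 u \<in> hom C (F0 (Dom J u)) (F0 (Cod J u))) \<and>
     (\<forall>i \<in> Obj J. F1 (Ide J i) = Ide C (F0 i)) \<and>
     (\<forall>u \<in> Arr J. \<forall>v \<in> Arr J. Cod J u = Dom J v \<longrightarrow> F1 (v \<cdot>\<^bsub>J\<^esub> u) = F1 v \<cdot>\<^bsub>C\<^esub> F1 u)"

definition is_cone ::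
  "('i, 'j) cat \<Rightarrow> ('o, 'a) cat \<Rightarrow> ('i \<Rightarrow> 'o) \<Rightarrow> ('j \<Rightarrow> 'a) \<Rightarrow> 'o \<Rightarrow> ('i \<Rightarrow> 'a) \<Rightarrow> bool" where
  "is_cone J C F0 F1 L \<pi> \<longleftrightarrow>
     L \<in> Obj C \<and>
     (\<forall>i \<in> Obj J. \<pi> i \<in> hom C L (F0 i)) \<and>
     (\<forall>u \<in> Arr J. F1 u \<cdot>\<^bsub>C\<^esub> \<pi> (Dom J u) = \<pi> (Cod J u))"

definition is_limit ::
  "('i, 'j) cat \<Rightarrow> ('o, 'a) cat \<Rightarrow> ('i \<Rightarrow> 'o) \<Rightarrow> ('j \<Rightarrow> 'a) \<Rightarrow> 'o \<Rightarrow> ('i \<Rightarrow> 'a) \<Rightarrow> bool" where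
  "is_limit J C F0 F1 L \<pi> \<longleftrightarrow>
     is_cone J C F0 F1 L \<pi> \<and>
     (\<forall>M \<rho>. is_cone J C F0 F1 M \<rho> \<longrightarrow>
        (\<exists>!h. h \<in> hom C M L \<and> (\<forall>i \<in> Obj J. \<pi> i \<cdot>\<^bsub>C\<^esub> h = \<rho> i)))"

text \<open>Every finite category is isomorphic to one whose objects and arrows are natural numbers, so
  it is enough to let the shape \<open>J\<close> range over those.\<close>

definition finitely_complete :: "('o, 'a) cat \<Rightarrow> bool" where
  "finitely_complete C \<longleftrightarrow>
     (\<forall>(J :: (nat, nat) cat) F0 F1.
        category J \<and> finite (Obj J) \<and> finite (Arr J) \<and> is_functor J C F0 F1 \<longrightarrow>
        (\<exists>L \<pi>. is_limit J C F0 F1 L \<pi>))"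

text \<open>The vertex of the pullback is \<open>Dom C p = Dom C q\<close>, with \<open>f \<cdot> p = g \<cdot> q\<close>.\<close>

definition is_pullback :: "('o, 'a) cat \<Rightarrow> 'a \<Rightarrow> 'a \<Rightarrow> 'a \<Rightarrow> 'a \<Rightarrow> bool" where
  "is_pullback C f g p q \<longleftrightarrow>
     f \<in> Arr C \<and> g \<in> Arr C \<and> Cod C f = Cod C g \<and>
     p \<in> hom C (Dom C p) (Dom C f) \<and> q \<in> hom C (Dom C p) (Dom C g) \<and>
     f \<cdot>\<^bsub>C\<^esub> p = g \<cdot>\<^bsub>C\<^esub> q \<and>
     (\<forall>Z. \<forall>a \<in> hom C Z (Dom C f). \<forall>b \<in> hom C Z (Dom C g).
        f \<cdot>\<^bsub>C\<^esub> a = g \<cdot>\<^bsub>C\<^esub> b \<longrightarrow>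
        (\<exists>!h. h \<in> hom C Z (Dom C p) \<and> p \<cdot>\<^bsub>C\<^esub> h = a \<and> q \<cdot>\<^bsub>C\<^esub> h = b))"

definition is_product :: "('o, 'a) cat \<Rightarrow> 'o \<Rightarrow> 'o \<Rightarrow> 'a \<Rightarrow> 'a \<Rightarrow> bool" where
  "is_product C X Y p q \<longleftrightarrow>
     p \<in> hom C (Dom C p) X \<and> q \<in> hom C (Dom C p) Y \<and>
     (\<forall>Z. \<forall>a \<in> hom C Z X. \<forall>b \<in> hom C Z Y.
        (\<exists>!h. h \<in> hom C Z (Dom C p) \<and> p \<cdot>\<^bsub>C\<^esub> h = a \<and> q \<cdot>\<^bsub>C\<^esub> h = b))"

text \<open>The arrow \<open>\<langle>a, b\<rangle>\<close> into the vertex of a product or pullback with projections \<open>p\<close> and \<open>q\<close>.\<close>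

definition tuple :: "('o, 'a) cat \<Rightarrow> 'a \<Rightarrow> 'a \<Rightarrow> 'a \<Rightarrow> 'a \<Rightarrow> 'a" where
  "tuple C p q a b =
     (THE h. h \<in> hom C (Dom C a) (Dom C p) \<and> p \<cdot>\<^bsub>C\<^esub> h = a \<and> q \<cdot>\<^bsub>C\<^esub> h = b)"

definition is_coequaliser :: "('o, 'a) cat \<Rightarrow> 'a \<Rightarrow> 'a \<Rightarrow> 'a \<Rightarrow> bool" where
  "is_coequaliser C u v e \<longleftrightarrow>
     u \<in> Arr C \<and> v \<in> hom C (Dom C u) (Cod C u) \<and> e \<in> hom C (Cod C u) (Cod C e) \<and>
     e \<cdot>\<^bsub>C\<^esub> u = e \<cdot>\<^bsub>C\<^esub> v \<and>
     (\<forall>Z. \<forall>k \<in> hom C (Cod C u) Z. k \<cdot>\<^bsub>C\<^esub> u = k \<cdot>\<^bsub>C\<^esub> v \<longrightarrow>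
        (\<exists>!h. h \<in> hom C (Cod C e) Z \<and> h \<cdot>\<^bsub>C\<^esub> e = k))"

definition mono_arr :: "('o, 'a) cat \<Rightarrow> 'a \<Rightarrow> bool" where
  "mono_arr C m \<longleftrightarrow> m \<in> Arr C \<and>
     (\<forall>Z. \<forall>u \<in> hom C Z (Dom C m). \<forall>v \<in> hom C Z (Dom C m).
        m \<cdot>\<^bsub>C\<^esub> u = m \<cdot>\<^bsub>C\<^esub> v \<longrightarrow> u = v)"

definition regular_epi :: "('o, 'a) cat \<Rightarrow> 'a \<Rightarrow> bool" where
  "regular_epi C e \<longleftrightarrow> (\<exists>u v. is_coequaliser C u v e)"

section \<open>Regular categories\<close>

definition regular_category :: "('o, 'a) cat \<Rightarrow> bool" where
  "regular_category C \<longleftrightarrow>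
     category C \<and> finitely_complete C \<and>
     (\<forall>f g p q. is_pullback C f g p q \<and> regular_epi C f \<longrightarrow> regular_epi C q) \<and>
     (\<forall>f p q. is_pullback C f f p q \<longrightarrow> (\<exists>e. is_coequaliser C p q e))"

definition is_image :: "('o, 'a) cat \<Rightarrow> 'a \<Rightarrow> 'a \<Rightarrow> bool" where
  "is_image C f m \<longleftrightarrow>
     mono_arr C m \<and> (\<exists>e. regular_epi C e \<and> Cod C e = Dom C m \<and> f = m \<cdot>\<^bsub>C\<^esub> e)"

section \<open>Relations and Goursat categories\<close>

text \<open>A relation is represented by the pair \<open>(r1, r2)\<close> of the legs of a monomorphism
  \<open>\<langle>r1, r2\<rangle> : R \<rightarrow> X \<times> Y\<close>. Binary products are determined up to isomorphism only, and whether
  \<open>\<langle>r1, r2\<rangle>\<close> is a monomorphism does not depend on the product taken.\<close>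

definition is_relation :: "('o, 'a) cat \<Rightarrow> 'o \<Rightarrow> 'o \<Rightarrow> 'a \<times> 'a \<Rightarrow> bool" where
  "is_relation C X Y = (\<lambda>(r1, r2).
     r1 \<in> hom C (Dom C r1) X \<and> r2 \<in> hom C (Dom C r1) Y \<and>
     (\<exists>p q. is_product C X Y p q \<and> mono_arr C (tuple C p q r1 r2)))"

definition rel_le :: "('o, 'a) cat \<Rightarrow> 'a \<times> 'a \<Rightarrow> 'a \<times> 'a \<Rightarrow> bool" where
  "rel_le C = (\<lambda>(r1, r2) (s1, s2).
     \<exists>k \<in> hom C (Dom C r1) (Dom C s1). s1 \<cdot>\<^bsub>C\<^esub> k = r1 \<and> s2 \<cdot>\<^bsub>C\<^esub> k = r2)"

text \<open>Equality of the subobjects represented by two relations.\<close>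

definition rel_eq :: "('o, 'a) cat \<Rightarrow> 'a \<times> 'a \<Rightarrow> 'a \<times> 'a \<Rightarrow> bool" where
  "rel_eq C R S \<longleftrightarrow> rel_le C R S \<and> rel_le C S R"

text \<open>\<open>is_composite C X Y Z S R T\<close> says that \<open>T\<close> represents the composite \<open>S R\<close> of a relation \<open>R\<close>
  from \<open>X\<close> to \<open>Y\<close> and a relation \<open>S\<close> from \<open>Y\<close> to \<open>Z\<close>; note the order.\<close>

definition is_composite ::
  "('o, 'a) cat \<Rightarrow> 'o \<Rightarrow> 'o \<Rightarrow> 'o \<Rightarrow> 'a \<times> 'a \<Rightarrow> 'a \<times> 'a \<Rightarrow> 'a \<times> 'a \<Rightarrow> bool" where
  "is_composite C X Y Z = (\<lambda>(s1, s2) (r1, r2) (t1, t2).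
     is_relation C X Y (r1, r2) \<and> is_relation C Y Z (s1, s2) \<and> is_relation C X Z (t1, t2) \<and>
     (\<exists>p1 p2 q1 q2.
        is_pullback C r2 s1 p1 p2 \<and> is_product C X Z q1 q2 \<and>
        is_image C (tuple C q1 q2 (r1 \<cdot>\<^bsub>C\<^esub> p1) (s2 \<cdot>\<^bsub>C\<^esub> p2)) (tuple C q1 q2 t1 t2)))"

definition reflexive_rel :: "('o, 'a) cat \<Rightarrow> 'o \<Rightarrow> 'a \<times> 'a \<Rightarrow> bool" where
  "reflexive_rel C X = (\<lambda>(r1, r2).
     \<exists>k \<in> hom C X (Dom C r1). r1 \<cdot>\<^bsub>C\<^esub> k = Ide C X \<and> r2 \<cdot>\<^bsub>C\<^esub> k = Ide C X)"

definition symmetric_rel :: "('o, 'a) cat \<Rightarrow> 'a \<times> 'a \<Rightarrow> bool" where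
  "symmetric_rel C = (\<lambda>(r1, r2).
     \<exists>k \<in> hom C (Dom C r1) (Dom C r1). r1 \<cdot>\<^bsub>C\<^esub> k = r2 \<and> r2 \<cdot>\<^bsub>C\<^esub> k = r1)"

definition transitive_rel :: "('o, 'a) cat \<Rightarrow> 'a \<times> 'a \<Rightarrow> bool" where
  "transitive_rel C = (\<lambda>(r1, r2).
     \<exists>p1 p2. is_pullback C r2 r1 p1 p2 \<and>
       (\<exists>k \<in> hom C (Dom C p1) (Dom C r1).
          r1 \<cdot>\<^bsub>C\<^esub> k = r1 \<cdot>\<^bsub>C\<^esub> p1 \<and> r2 \<cdot>\<^bsub>C\<^esub> k = r2 \<cdot>\<^bsub>C\<^esub> p2))"

definition equivalence_rel :: "('o, 'a) cat \<Rightarrow> 'o \<Rightarrow> 'a \<times> 'a \<Rightarrow> bool" where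
  "equivalence_rel C X R \<longleftrightarrow>
     is_relation C X X R \<and> reflexive_rel C X R \<and> symmetric_rel C R \<and> transitive_rel C R"

text \<open>In a regular category composites exist and are unique up to \<open>rel_eq\<close>, so the equation
  \<open>R S R = S R S\<close> may be required of all representatives.\<close>

definition goursat_category :: "('o, 'a) cat \<Rightarrow> bool" where
  "goursat_category C \<longleftrightarrow>
     regular_category C \<and>
     (\<forall>X R S SR RSR RS SRS.
        equivalence_rel C X R \<and> equivalence_rel C X S \<and>
        is_composite C X X X S R SR \<and> is_composite C X X X R SR RSR \<and>
        is_composite C X X X R S RS \<and> is_composite C X X X S RS SRS \<longrightarrow>
        rel_eq C RSR SRS)"

section \<open>Reflexive graphs\<close>

text \<open>\<open>src\<close>, \<open>tgt\<close> and \<open>ins\<close> are the arrows \<open>d\<close>, \<open>c : X1 \<rightarrow> X0\<close> and their common section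
  \<open>e : X0 \<rightarrow> X1\<close>.\<close>

datatype ('o, 'a) rgraph =
  RGraph (X1: 'o) (X0: 'o) (src: 'a) (tgt: 'a) (ins: 'a)

definition is_reflexive_graph :: "('o, 'a) cat \<Rightarrow> ('o, 'a) rgraph \<Rightarrow> bool" where
  "is_reflexive_graph C G \<longleftrightarrow>
     X1 G \<in> Obj C \<and> X0 G \<in> Obj C \<and>
     src G \<in> hom C (X1 G) (X0 G) \<and> tgt G \<in> hom C (X1 G) (X0 G) \<and>
     ins G \<in> hom C (X0 G) (X1 G) \<and>
     src G \<cdot>\<^bsub>C\<^esub> ins G = Ide C (X0 G) \<and> tgt G \<cdot>\<^bsub>C\<^esub> ins G = Ide C (X0 G)"

datatype ('o, 'a) rgmor =
  RGMor (mdom: "('o, 'a) rgraph") (mcod: "('o, 'a) rgraph") (map0: 'a) (map1: 'a)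

definition is_rgmor :: "('o, 'a) cat \<Rightarrow> ('o, 'a) rgmor \<Rightarrow> bool" where
  "is_rgmor C \<phi> \<longleftrightarrow>
     is_reflexive_graph C (mdom \<phi>) \<and> is_reflexive_graph C (mcod \<phi>) \<and>
     map0 \<phi> \<in> hom C (X0 (mdom \<phi>)) (X0 (mcod \<phi>)) \<and>
     map1 \<phi> \<in> hom C (X1 (mdom \<phi>)) (X1 (mcod \<phi>)) \<and>
     src (mcod \<phi>) \<cdot>\<^bsub>C\<^esub> map1 \<phi> = map0 \<phi> \<cdot>\<^bsub>C\<^esub> src (mdom \<phi>) \<and>
     tgt (mcod \<phi>) \<cdot>\<^bsub>C\<^esub> map1 \<phi> = map0 \<phi> \<cdot>\<^bsub>C\<^esub> tgt (mdom \<phi>) \<and>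
     map1 \<phi> \<cdot>\<^bsub>C\<^esub> ins (mdom \<phi>) = ins (mcod \<phi>) \<cdot>\<^bsub>C\<^esub> map0 \<phi>"

definition RG :: "('o, 'a) cat \<Rightarrow> (('o, 'a) rgraph, ('o, 'a) rgmor) cat" where
  "RG C = \<lparr>
     Obj = {G. is_reflexive_graph C G},
     Arr = {\<phi>. is_rgmor C \<phi>},
     Dom = mdom,
     Cod = mcod,
     Ide = (\<lambda>G. RGMor G G (Ide C (X0 G)) (Ide C (X1 G))),
     Comp = (\<lambda>\<psi> \<phi>. RGMor (mdom \<phi>) (mcod \<psi>)
               (map0 \<psi> \<cdot>\<^bsub>C\<^esub> map0 \<phi>) (map1 \<psi> \<cdot>\<^bsub>C\<^esub> map1 \<phi>))\<rparr>"

lemma category_RG: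
  assumes "category C"
  shows "category (RG C)"
proof -
  interpret category C by fact
  have RG_simps: "Obj (RG C) = {G. is_reflexive_graph C G}" "Arr (RG C) = {\<phi>. is_rgmor C \<phi>}"
    "Dom (RG C) = mdom" "Cod (RG C) = mcod"
    "\<And>G. Ide (RG C) G = RGMor G G (Ide C (X0 G)) (Ide C (X1 G))"
    "\<And>\<psi> \<phi>. \<psi> \<cdot>\<^bsub>RG C\<^esub> \<phi> = RGMor (mdom \<phi>) (mcod \<psi>)
       (map0 \<psi> \<cdot>\<^bsub>C\<^esub> map0 \<phi>) (map1 \<psi> \<cdot>\<^bsub>C\<^esub> map1 \<phi>)"
    by (simp_all add: RG_def)
  have hom_RG: "\<phi> \<in> hom (RG C) G H \<longleftrightarrow> is_rgmor C \<phi> \<and> mdom \<phi> = G \<and> mcod \<phi> = H" for \<phi> G H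
    by (auto simp: hom_def RG_simps)
  have square: "a' \<cdot>\<^bsub>C\<^esub> (g' \<cdot>\<^bsub>C\<^esub> g) = (f' \<cdot>\<^bsub>C\<^esub> f) \<cdot>\<^bsub>C\<^esub> a"
    if "a' \<cdot>\<^bsub>C\<^esub> g' = f' \<cdot>\<^bsub>C\<^esub> b" "b \<cdot>\<^bsub>C\<^esub> g = f \<cdot>\<^bsub>C\<^esub> a"
      "g \<in> hom C A B" "g' \<in> hom C B D" "f \<in> hom C A' B'" "f' \<in> hom C B' D'"
      "a \<in> hom C A A'" "b \<in> hom C B B'" "a' \<in> hom C D D'"
    for a b a' f f' g g' A B D A' B' D'
  proof -
    have "a' \<cdot>\<^bsub>C\<^esub> (g' \<cdot>\<^bsub>C\<^esub> g) = (f' \<cdot>\<^bsub>C\<^esub> b) \<cdot>\<^bsub>C\<^esub> g"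
      using Comp_assoc[OF that(3,4,9)] that(1) by simp
    also have "\<dots> = f' \<cdot>\<^bsub>C\<^esub> (f \<cdot>\<^bsub>C\<^esub> a)"
      using Comp_assoc[OF that(3,8,6)] that(2) by simp
    also have "\<dots> = (f' \<cdot>\<^bsub>C\<^esub> f) \<cdot>\<^bsub>C\<^esub> a"
      using Comp_assoc[OF that(7,5,6)] .
    finally show ?thesis .
  qed
  have comp: "is_rgmor C (RGMor (mdom \<phi>) (mcod \<psi>)
        (map0 \<psi> \<cdot>\<^bsub>C\<^esub> map0 \<phi>) (map1 \<psi> \<cdot>\<^bsub>C\<^esub> map1 \<phi>))"
    if \<phi>: "is_rgmor C \<phi>" and \<psi>: "is_rgmor C \<psi>" and eq: "mcod \<phi> = mdom \<psi>" for \<phi> \<psi>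
  proof -
    note p = \<phi>[unfolded is_rgmor_def is_reflexive_graph_def eq]
    note q = \<psi>[unfolded is_rgmor_def is_reflexive_graph_def]
    have "ins (mcod \<psi>) \<cdot>\<^bsub>C\<^esub> (map0 \<psi> \<cdot>\<^bsub>C\<^esub> map0 \<phi>) = (map1 \<psi> \<cdot>\<^bsub>C\<^esub> map1 \<phi>) \<cdot>\<^bsub>C\<^esub> ins (mdom \<phi>)"
      by (rule square[where b = "ins (mdom \<psi>)"
            and A = "X0 (mdom \<phi>)" and B = "X0 (mdom \<psi>)" and D = "X0 (mcod \<psi>)"
            and A' = "X1 (mdom \<phi>)" and B' = "X1 (mdom \<psi>)" and D' = "X1 (mcod \<psi>)"])
        (use p q in simp_all)
    moreover have "src (mcod \<psi>) \<cdot>\<^bsub>C\<^esub> (map1 \<psi> \<cdot>\<^bsub>C\<^esub> map1 \<phi>) = (map0 \<psi> \<cdot>\<^bsub>C\<^esub> map0 \<phi>) \<cdot>\<^bsub>C\<^esub> src (mdom \<phi>)"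
      by (rule square[where b = "src (mdom \<psi>)"
            and A = "X1 (mdom \<phi>)" and B = "X1 (mdom \<psi>)" and D = "X1 (mcod \<psi>)"
            and A' = "X0 (mdom \<phi>)" and B' = "X0 (mdom \<psi>)" and D' = "X0 (mcod \<psi>)"])
        (use p q in simp_all)
    moreover have "tgt (mcod \<psi>) \<cdot>\<^bsub>C\<^esub> (map1 \<psi> \<cdot>\<^bsub>C\<^esub> map1 \<phi>) = (map0 \<psi> \<cdot>\<^bsub>C\<^esub> map0 \<phi>) \<cdot>\<^bsub>C\<^esub> tgt (mdom \<phi>)"
      by (rule square[where b = "tgt (mdom \<psi>)"
            and A = "X1 (mdom \<phi>)" and B = "X1 (mdom \<psi>)" and D = "X1 (mcod \<psi>)"
            and A' = "X0 (mdom \<phi>)" and B' = "X0 (mdom \<psi>)" and D' = "X0 (mcod \<psi>)"])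
        (use p q in simp_all)
    moreover have "map1 \<psi> \<cdot>\<^bsub>C\<^esub> map1 \<phi> \<in> hom C (X1 (mdom \<phi>)) (X1 (mcod \<psi>))"
      "map0 \<psi> \<cdot>\<^bsub>C\<^esub> map0 \<phi> \<in> hom C (X0 (mdom \<phi>)) (X0 (mcod \<psi>))"
      using p q by (blast intro: Comp_hom)+
    ultimately show ?thesis
      using \<phi> \<psi> by (simp add: is_rgmor_def)
  qed
  have ide: "is_rgmor C (RGMor G G (Ide C (X0 G)) (Ide C (X1 G)))"
    if "is_reflexive_graph C G" for G
  proof -
    note g = that[unfolded is_reflexive_graph_def]
    show ?thesis
      using that g unfolding is_rgmor_def
      by (simp add: Ide_hom Comp_Ide[of _ "X1 G" "X0 G"] Comp_Ide[of _ "X0 G" "X1 G"]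
          Ide_Comp[of _ "X1 G" "X0 G"] Ide_Comp[of _ "X0 G" "X1 G"])
  qed
  show ?thesis
  proof
    show "Dom (RG C) \<phi> \<in> Obj (RG C)" "Cod (RG C) \<phi> \<in> Obj (RG C)" if "\<phi> \<in> Arr (RG C)" for \<phi>
      using that by (simp_all add: RG_simps is_rgmor_def)
    show "Ide (RG C) G \<in> hom (RG C) G G" if "G \<in> Obj (RG C)" for G
      using that by (simp add: hom_RG RG_simps ide)
    show "\<psi> \<cdot>\<^bsub>RG C\<^esub> \<phi> \<in> hom (RG C) G K"
      if "\<phi> \<in> hom (RG C) G H" "\<psi> \<in> hom (RG C) H K" for \<phi> \<psi> G H K
      using that comp[of \<phi> \<psi>] by (auto simp: hom_RG RG_simps)
    show "\<phi> \<cdot>\<^bsub>RG C\<^esub> Ide (RG C) G = \<phi>" "Ide (RG C) H \<cdot>\<^bsub>RG C\<^esub> \<phi> = \<phi>"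
      if "\<phi> \<in> hom (RG C) G H" for \<phi> G H
      using that by (auto simp: hom_RG RG_simps is_rgmor_def Comp_Ide Ide_Comp intro!: rgmor.expand)
    show "\<chi> \<cdot>\<^bsub>RG C\<^esub> (\<psi> \<cdot>\<^bsub>RG C\<^esub> \<phi>) = \<chi> \<cdot>\<^bsub>RG C\<^esub> \<psi> \<cdot>\<^bsub>RG C\<^esub> \<phi>"
      if "\<phi> \<in> hom (RG C) G H" "\<psi> \<in> hom (RG C) H K" "\<chi> \<in> hom (RG C) K L" for \<phi> \<psi> \<chi> G H K L
      using that by (auto simp: hom_RG RG_simps is_rgmor_def intro!: Comp_assoc)
  qed
qed

section \<open>Internal categories and groupoids\<close>

text \<open>The domain of composition is the vertex of the pullback with \<open>tgt \<cdot> p1 = src \<cdot> p2\<close>.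
  The object \<open>X1 \<times> X1 \<times> X1\<close> (over \<open>X0\<close>) of composable triples is the pullback of \<open>p2\<close> along
  \<open>p1\<close>, with projections \<open>q1\<close> and \<open>q2\<close> to the first two and to the last two arrows of a triple.\<close>

definition is_internal_category ::
  "('o, 'a) cat \<Rightarrow> ('o, 'a) rgraph \<Rightarrow> 'a \<Rightarrow> 'a \<Rightarrow> 'a \<Rightarrow> bool" where
  "is_internal_category C G p1 p2 m \<longleftrightarrow>
     is_reflexive_graph C G \<and>
     is_pullback C (tgt G) (src G) p1 p2 \<and>
     m \<in> hom C (Dom C p1) (X1 G) \<and>
     src G \<cdot>\<^bsub>C\<^esub> m = src G \<cdot>\<^bsub>C\<^esub> p1 \<and>
     tgt G \<cdot>\<^bsub>C\<^esub> m = tgt G \<cdot>\<^bsub>C\<^esub> p2 \<and>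
     m \<cdot>\<^bsub>C\<^esub> tuple C p1 p2 (ins G \<cdot>\<^bsub>C\<^esub> src G) (Ide C (X1 G)) = Ide C (X1 G) \<and>
     m \<cdot>\<^bsub>C\<^esub> tuple C p1 p2 (Ide C (X1 G)) (ins G \<cdot>\<^bsub>C\<^esub> tgt G) = Ide C (X1 G) \<and>
     (\<forall>q1 q2. is_pullback C p2 p1 q1 q2 \<longrightarrow>
        m \<cdot>\<^bsub>C\<^esub> tuple C p1 p2 (p1 \<cdot>\<^bsub>C\<^esub> q1) (m \<cdot>\<^bsub>C\<^esub> q2) =
        m \<cdot>\<^bsub>C\<^esub> tuple C p1 p2 (m \<cdot>\<^bsub>C\<^esub> q1) (p2 \<cdot>\<^bsub>C\<^esub> q2))"

definition is_internal_groupoid ::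
  "('o, 'a) cat \<Rightarrow> ('o, 'a) rgraph \<Rightarrow> 'a \<Rightarrow> 'a \<Rightarrow> 'a \<Rightarrow> 'a \<Rightarrow> bool" where
  "is_internal_groupoid C G p1 p2 m i \<longleftrightarrow>
     is_internal_category C G p1 p2 m \<and>
     i \<in> hom C (X1 G) (X1 G) \<and>
     src G \<cdot>\<^bsub>C\<^esub> i = tgt G \<and> tgt G \<cdot>\<^bsub>C\<^esub> i = src G \<and>
     m \<cdot>\<^bsub>C\<^esub> tuple C p1 p2 i (Ide C (X1 G)) = ins G \<cdot>\<^bsub>C\<^esub> tgt G \<and>
     m \<cdot>\<^bsub>C\<^esub> tuple C p1 p2 (Ide C (X1 G)) i = ins G \<cdot>\<^bsub>C\<^esub> src G"

definition Cat :: "('o, 'a) cat \<Rightarrow> ('o, 'a) rgraph set" where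
  "Cat C = {G. \<exists>p1 p2 m. is_internal_category C G p1 p2 m}"

definition Grpd :: "('o, 'a) cat \<Rightarrow> ('o, 'a) rgraph set" where
  "Grpd C = {G. \<exists>p1 p2 m i. is_internal_groupoid C G p1 p2 m i}"

text \<open>Closure under quotients only concerns the objects of the subcategory \<open>P\<close>, so \<open>P\<close> is given as
  a set of objects of \<open>Q\<close>; for internal categories and groupoids these are the underlying
  reflexive graphs.\<close>

definition closed_under_quotients :: "('o, 'a) cat \<Rightarrow> 'o set \<Rightarrow> bool" where
  "closed_under_quotients Q P \<longleftrightarrow>
     (\<forall>f. regular_epi Q f \<and> Dom Q f \<in> P \<longrightarrow> Cod Q f \<in> P)"

end

theory Submission
  imports Defs
begin

text \<open>
  Everything is argued with generalised elements, where existential statements hold after restriction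
  along a regular epimorphism.

  If \<open>C\<close> is a Goursat category, the graph of the multiplication of \<open>G\<close> is pushed forward along the
  quotient \<open>f : G \<rightarrow> H\<close>. It is total because composable pairs in \<open>H\<close> lift locally: for lifts \<open>a\<close>, \<open>b\<close>
  that are composable only up to \<open>f\<close>, apply \<open>S R S = R S R\<close> to the pairs \<open>(a, 1)\<close>, \<open>(1, 1)\<close>,
  \<open>(1, 1)\<close>, \<open>(1, b)\<close>, with \<open>R\<close> the kernel pair of \<open>f \<times> f\<close> and \<open>S\<close> that of the middle object. It is
  single-valued by the shifting lemma, which follows from 3-permutability and is applied twice. The
  inverse descends in the same way. Thus categories and groupoids are treated alike.

  Conversely, let \<open>R\<close> and \<open>S\<close> be equivalence relations on \<open>X\<close>. The inverse image of \<open>R\<close> along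
  \<open>s1 : S \<rightarrow> X\<close> is a groupoid on \<open>S\<close>, and its image along \<open>s2\<close> is the reflexive relation \<open>S R S\<close>. If
  the latter is an internal category, it is transitive, so that \<open>R S R \<subseteq> S R S\<close>.
\<close>

section \<open>Regular categories\<close>

context category
begin

text \<open>The two closure conditions are never compared directly. Each implies the weaker
  statement that a regular quotient of a groupoid is an internal category, and this alone yields the
  Goursat property, which in turn yields both.

  The obstacle in a quotient is that the arrow induced between the objects of composable pairs need
  not be a regular epimorphism, and that products of congruent pairs need not be congruent. The
  units resolve both: they are sections compatible with \<open>f\<close>, so they supply the
  intermediate pairs for 3-permutability, and they supply the rectangles for the shifting lemma.
  That lemma is applied twice because one rectangle frees only one factor: first the left factor is
  held fixed, and the outcome is the implication that the second application requires.

  Associativity in the quotient concerns composable triples. A triple is a pair followed by an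
  arrow, which is why the lifting lemma is stated for a pullback of two arbitrary split
  epimorphisms.\<close>

lemma arr_comp: "f \<in> Arr C \<Longrightarrow> g \<in> Arr C \<Longrightarrow> Cod C f = Dom C g \<Longrightarrow> g \<cdot> f \<in> Arr C"
  and dom_comp: "f \<in> Arr C \<Longrightarrow> g \<in> Arr C \<Longrightarrow> Cod C f = Dom C g \<Longrightarrow> Dom C (g \<cdot> f) = Dom C f"
  and cod_comp: "f \<in> Arr C \<Longrightarrow> g \<in> Arr C \<Longrightarrow> Cod C f = Dom C g \<Longrightarrow> Cod C (g \<cdot> f) = Cod C g"
  using Comp_hom[of f "Dom C f" "Cod C f" g "Cod C g"] by (simp_all add: hom_def)

lemma assoc:
  "f \<in> Arr C \<Longrightarrow> g \<in> Arr C \<Longrightarrow> h \<in> Arr C \<Longrightarrow> Cod C f = Dom C g \<Longrightarrow> Cod C g = Dom C h \<Longrightarrow>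
    (h \<cdot> g) \<cdot> f = h \<cdot> (g \<cdot> f)"
  using Comp_assoc[of f "Dom C f" "Cod C f" g "Cod C g" h "Cod C h"] by (simp add: hom_def)

lemma ide_arr: "A \<in> Obj C \<Longrightarrow> Ide C A \<in> Arr C"
  and dom_ide: "A \<in> Obj C \<Longrightarrow> Dom C (Ide C A) = A"
  and cod_ide: "A \<in> Obj C \<Longrightarrow> Cod C (Ide C A) = A"
  using Ide_hom by (simp_all add: hom_def)

lemma comp_ide: "f \<in> Arr C \<Longrightarrow> Dom C f = A \<Longrightarrow> f \<cdot> Ide C A = f"
  and ide_comp: "f \<in> Arr C \<Longrightarrow> Cod C f = A \<Longrightarrow> Ide C A \<cdot> f = f"
  using Comp_Ide[of f] Ide_Comp[of f] by (simp_all add: hom_def)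

lemmas arr_simps = arr_comp dom_comp cod_comp assoc ide_arr dom_ide cod_ide comp_ide ide_comp
  Dom_Obj Cod_Obj

text \<open>The simplifier associates composites to the right, which hides a known factor
  \<open>g \<cdot> f\<close> inside \<open>g \<cdot> (f \<cdot> w)\<close>. Attached by
  \<open>THEN\<close>, this rule evaluates such an equation at an element \<open>w\<close>.\<close>

lemma reassoc:
  "g \<cdot> f = h \<Longrightarrow> f \<in> Arr C \<Longrightarrow> g \<in> Arr C \<Longrightarrow> Cod C f = Dom C g \<Longrightarrow>
    w \<in> Arr C \<Longrightarrow> Cod C w = Dom C f \<Longrightarrow> g \<cdot> (f \<cdot> w) = h \<cdot> w"
  using assoc[of w f g] by simp

text \<open>This says that the induced arrow into a product is a monomorphism, without choosing a
  product.\<close>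

definition jointly_monic :: "'a \<Rightarrow> 'a \<Rightarrow> bool" where
  "jointly_monic a b \<longleftrightarrow> a \<in> Arr C \<and> b \<in> Arr C \<and> Dom C a = Dom C b \<and>
     (\<forall>Z. \<forall>u \<in> hom C Z (Dom C a). \<forall>v \<in> hom C Z (Dom C a).
        a \<cdot> u = a \<cdot> v \<and> b \<cdot> u = b \<cdot> v \<longrightarrow> u = v)"

lemma jointly_monicD:
  "jointly_monic a b \<Longrightarrow> u \<in> hom C Z (Dom C a) \<Longrightarrow> v \<in> hom C Z (Dom C a) \<Longrightarrow>
    a \<cdot> u = a \<cdot> v \<Longrightarrow> b \<cdot> u = b \<cdot> v \<Longrightarrow> u = v"
  by (auto simp: jointly_monic_def)

text \<open>A monomorphism counts as a jointly monic pair with equal legs, so that results on pairs,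
  such as diagonal fill-ins, also serve single arrows.\<close>

lemma mono_arr_iff: "mono_arr C m \<longleftrightarrow> jointly_monic m m"
  by (auto simp: mono_arr_def jointly_monic_def)

lemma tuple_eq:
  assumes "jointly_monic p q" "h \<in> hom C Z (Dom C p)" "p \<cdot> h = a" "q \<cdot> h = b"
  shows "tuple C p q a b = h"
proof -
  \<comment> \<open>The description defining \<open>tuple\<close> takes its domain from
    \<open>a\<close>, so \<open>Z\<close> has to be recognised as that domain.\<close>
  have "Dom C a = Z"
    using assms by (auto simp: jointly_monic_def hom_def arr_simps)
  then show ?thesis
    unfolding tuple_def
    by (intro the_equality) (use assms jointly_monicD[OF assms(1)] in auto)
qed

section \<open>Universal properties of pullbacks and products\<close>

lemma pullbackD:
  assumes "is_pullback C f g p q"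
  shows "f \<in> Arr C" "g \<in> Arr C" "p \<in> Arr C" "q \<in> Arr C" "Cod C f = Cod C g"
    "Dom C q = Dom C p" "Cod C p = Dom C f" "Cod C q = Dom C g" "f \<cdot> p = g \<cdot> q"
  using assms by (auto simp: is_pullback_def hom_def)

lemma pullback_lift:
  assumes "is_pullback C f g p q" "a \<in> hom C Z (Dom C f)" "b \<in> hom C Z (Dom C g)"
    "f \<cdot> a = g \<cdot> b"
  obtains h where "h \<in> hom C Z (Dom C p)" "p \<cdot> h = a" "q \<cdot> h = b"
  using assms unfolding is_pullback_def by blast

lemma pullback_jointly_monic:
  assumes pb: "is_pullback C f g p q"
  shows "jointly_monic p q"
  unfolding jointly_monic_def
proof (intro conjI allI ballI impI)
  note D = pullbackD[OF pb]
  show "p \<in> Arr C" "q \<in> Arr C" "Dom C p = Dom C q" using D by auto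
  fix Z u v assume u: "u \<in> hom C Z (Dom C p)" and v: "v \<in> hom C Z (Dom C p)"
    and eq: "p \<cdot> u = p \<cdot> v \<and> q \<cdot> u = q \<cdot> v"
  have "p \<cdot> u \<in> hom C Z (Dom C f)" "q \<cdot> u \<in> hom C Z (Dom C g)" "f \<cdot> (p \<cdot> u) = g \<cdot> (q \<cdot> u)"
    using u D D(9)[THEN reassoc, of u] by (auto simp: hom_def arr_simps)
  then have "\<exists>!h. h \<in> hom C Z (Dom C p) \<and> p \<cdot> h = p \<cdot> u \<and> q \<cdot> h = q \<cdot> u"
    using pb by (auto simp: is_pullback_def)
  then show "u = v" using u v eq by auto
qed

lemma product_lift:
  assumes "is_product C X Y p q" "a \<in> hom C Z X" "b \<in> hom C Z Y"
  obtains h where "h \<in> hom C Z (Dom C p)" "p \<cdot> h = a" "q \<cdot> h = b"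
  using assms unfolding is_product_def by blast

lemma product_jointly_monic:
  assumes pb: "is_product C X Y p q"
  shows "jointly_monic p q"
  unfolding jointly_monic_def
proof (intro conjI allI ballI impI)
  have D: "p \<in> hom C (Dom C p) X" "q \<in> hom C (Dom C p) Y" using pb by (auto simp: is_product_def)
  show "p \<in> Arr C" "q \<in> Arr C" "Dom C p = Dom C q" using D by (auto simp: hom_def)
  fix Z u v assume u: "u \<in> hom C Z (Dom C p)" and v: "v \<in> hom C Z (Dom C p)"
    and eq: "p \<cdot> u = p \<cdot> v \<and> q \<cdot> u = q \<cdot> v"
  have "p \<cdot> u \<in> hom C Z X" "q \<cdot> u \<in> hom C Z Y"
    using u D by (auto simp: hom_def arr_simps)
  then have "\<exists>!h. h \<in> hom C Z (Dom C p) \<and> p \<cdot> h = p \<cdot> u \<and> q \<cdot> h = q \<cdot> u"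
    using pb by (auto simp: is_product_def)
  then show "u = v" using u v eq by auto
qed

lemma product_tuple:
  assumes "is_product C X Y p q" "a \<in> hom C Z X" "b \<in> hom C Z Y"
  shows "tuple C p q a b \<in> hom C Z (Dom C p)" "p \<cdot> tuple C p q a b = a" "q \<cdot> tuple C p q a b = b"
proof -
  obtain h where h: "h \<in> hom C Z (Dom C p)" "p \<cdot> h = a" "q \<cdot> h = b"
    using product_lift[OF assms] .
  have "tuple C p q a b = h" by (rule tuple_eq[OF product_jointly_monic[OF assms(1)] h])
  then show "tuple C p q a b \<in> hom C Z (Dom C p)" "p \<cdot> tuple C p q a b = a" "q \<cdot> tuple C p q a b = b"
    using h by auto
qed

text \<open>Equality of arrows into a product is tested on the two projections, so the condition is
  the same for every product and the existential choice in \<open>is_relation\<close>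
  disappears.\<close>

lemma is_relation_iff:
  assumes ex: "is_product C X Y p q"
  shows "is_relation C X Y (r1, r2) \<longleftrightarrow>
    r1 \<in> hom C (Dom C r1) X \<and> r2 \<in> hom C (Dom C r1) Y \<and> jointly_monic r1 r2"
proof -
  have key: "mono_arr C (tuple C p q r1 r2) \<longleftrightarrow> jointly_monic r1 r2"
    if r: "r1 \<in> hom C (Dom C r1) X" "r2 \<in> hom C (Dom C r1) Y" and ex: "is_product C X Y p q" for p q
  proof -
    note t = product_tuple[OF ex r]
    have pq: "p \<in> hom C (Dom C p) X" "q \<in> hom C (Dom C p) Y"
      using ex by (auto simp: is_product_def)
    have 1: "tuple C p q r1 r2 \<cdot> u = tuple C p q r1 r2 \<cdot> v \<longleftrightarrow> r1 \<cdot> u = r1 \<cdot> v \<and> r2 \<cdot> u = r2 \<cdot> v"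
      if u: "u \<in> hom C Z (Dom C r1)" and v: "v \<in> hom C Z (Dom C r1)" for Z u v
    proof -
      let ?t = "tuple C p q r1 r2"
      have 2: "p \<cdot> (?t \<cdot> u) = r1 \<cdot> u" "q \<cdot> (?t \<cdot> u) = r2 \<cdot> u"
        "p \<cdot> (?t \<cdot> v) = r1 \<cdot> v" "q \<cdot> (?t \<cdot> v) = r2 \<cdot> v"
        using t(2,3)[THEN reassoc] t(1) pq u v by (auto simp: hom_def)
      have "?t \<cdot> u \<in> hom C Z (Dom C p)" "?t \<cdot> v \<in> hom C Z (Dom C p)"
        using Comp_hom[OF u t(1)] Comp_hom[OF v t(1)] by auto
      with 2 show ?thesis
        using jointly_monicD[OF product_jointly_monic[OF ex], of "?t \<cdot> u" Z "?t \<cdot> v"] by auto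
    qed
    show ?thesis using t(1) r 1 by (auto simp: mono_arr_def jointly_monic_def hom_def)
  qed
  then show ?thesis using ex by (auto simp: is_relation_def)
qed

section \<open>Coequalisers, regular epimorphisms and isomorphisms\<close>

lemma coequaliserD:
  assumes "is_coequaliser C u v e"
  shows "u \<in> Arr C" "v \<in> Arr C" "e \<in> Arr C" "Dom C v = Dom C u" "Cod C v = Cod C u"
    "Dom C e = Cod C u" "e \<cdot> u = e \<cdot> v"
  using assms by (auto simp: is_coequaliser_def hom_def)

lemma coequaliser_lift:
  assumes "is_coequaliser C u v e" "k \<in> hom C (Cod C u) Z" "k \<cdot> u = k \<cdot> v"
  obtains h where "h \<in> hom C (Cod C e) Z" "h \<cdot> e = k"
proof -
  have "\<forall>Z. \<forall>k \<in> hom C (Cod C u) Z. k \<cdot> u = k \<cdot> v \<longrightarrow> (\<exists>!h. h \<in> hom C (Cod C e) Z \<and> h \<cdot> e = k)"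
    using assms(1) by (simp add: is_coequaliser_def)
  then have "\<exists>!h. h \<in> hom C (Cod C e) Z \<and> h \<cdot> e = k" using assms(2,3) by simp
  then show thesis using that by blast
qed

lemma regular_epi_arr: "regular_epi C e \<Longrightarrow> e \<in> Arr C"
  by (auto simp: regular_epi_def is_coequaliser_def hom_def)

lemma regular_epi_cancel:
  assumes "regular_epi C e" "h \<in> Arr C" "k \<in> Arr C" "Dom C h = Cod C e" "Dom C k = Cod C e"
    and eq: "h \<cdot> e = k \<cdot> e"
  shows "h = k"
proof -
  obtain u v where c: "is_coequaliser C u v e" using assms(1) by (auto simp: regular_epi_def)
  note d = c[unfolded is_coequaliser_def] and D = coequaliserD[OF c]
  \<comment> \<open>Uniqueness in a coequaliser is stated for a fixed codomain; that the two
    codomains agree is read off from \<open>eq\<close>.\<close>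
  have Z: "Cod C k = Cod C h" using arg_cong[OF eq, of "Cod C"] assms(2-5) D by (simp add: arr_simps)
  have "h \<cdot> e \<in> hom C (Cod C u) (Cod C h)" "(h \<cdot> e) \<cdot> u = (h \<cdot> e) \<cdot> v"
    using D assms(2-5) by (auto simp: hom_def arr_simps)
  then have "\<exists>!h'. h' \<in> hom C (Cod C e) (Cod C h) \<and> h' \<cdot> e = h \<cdot> e" using d by auto
  moreover have "h \<in> hom C (Cod C e) (Cod C h)" "k \<in> hom C (Cod C e) (Cod C h)"
    using assms(2-5) Z by (auto simp: hom_def)
  ultimately show ?thesis using eq by auto
qed

text \<open>If \<open>e\<close> coequalises \<open>u\<close> and \<open>v\<close>, then so do
  \<open>a \<cdot> k\<close> and \<open>b \<cdot> k\<close>, because they factor through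
  \<open>e\<close>; joint monicity passes this on to \<open>k\<close>, which therefore factors
  through \<open>e\<close>.\<close>

lemma regular_epi_diagonal:
  assumes e: "regular_epi C e" and j: "jointly_monic a b" and k: "k \<in> hom C (Dom C e) (Dom C a)"
    and x: "x \<in> hom C (Cod C e) X" "y \<in> hom C (Cod C e) Y"
    and eq: "a \<cdot> k = x \<cdot> e" "b \<cdot> k = y \<cdot> e"
  obtains h where "h \<in> hom C (Cod C e) (Dom C a)" "h \<cdot> e = k" "a \<cdot> h = x" "b \<cdot> h = y"
proof -
  obtain u v where c: "is_coequaliser C u v e" using e by (auto simp: regular_epi_def)
  note D = coequaliserD[OF c]
  have ab: "a \<in> Arr C" "b \<in> Arr C" "Dom C b = Dom C a" using j by (auto simp: jointly_monic_def)
  have "a \<cdot> (k \<cdot> u) = a \<cdot> (k \<cdot> v)" "b \<cdot> (k \<cdot> u) = b \<cdot> (k \<cdot> v)"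
    using D D(7)[THEN reassoc] k x ab eq[THEN reassoc, of u] eq[THEN reassoc, of v]
    by (auto simp: hom_def arr_simps)
  moreover have "k \<cdot> u \<in> hom C (Dom C u) (Dom C a)" "k \<cdot> v \<in> hom C (Dom C u) (Dom C a)"
    using D k by (auto simp: hom_def arr_simps)
  ultimately have "k \<cdot> u = k \<cdot> v" using jointly_monicD[OF j] by blast
  moreover have "k \<in> hom C (Cod C u) (Dom C a)" using D k by (auto simp: hom_def)
  ultimately obtain h where h: "h \<in> hom C (Cod C e) (Dom C a)" "h \<cdot> e = k" using coequaliser_lift[OF c] by blast
  have "a \<cdot> h = x"
    by (rule regular_epi_cancel[OF e]) (use ab h x eq D in \<open>auto simp: hom_def arr_simps\<close>)
  moreover have "b \<cdot> h = y"
    by (rule regular_epi_cancel[OF e]) (use ab h x eq D in \<open>auto simp: hom_def arr_simps\<close>)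
  ultimately show thesis using that h by blast
qed

definition iso_arr :: "'a \<Rightarrow> bool" where
  "iso_arr m \<longleftrightarrow> m \<in> Arr C \<and> (\<exists>n \<in> hom C (Cod C m) (Dom C m). m \<cdot> n = Ide C (Cod C m) \<and> n \<cdot> m = Ide C (Dom C m))"

lemma mono_split_iso:
  assumes m: "mono_arr C m" and n: "n \<in> hom C (Cod C m) (Dom C m)" "m \<cdot> n = Ide C (Cod C m)"
  shows "iso_arr m"
proof -
  \<comment> \<open>A right inverse of a monomorphism is two-sided: \<open>m\<close> can be
    cancelled from \<open>m \<cdot> (n \<cdot> m) = m\<close>.\<close>
  have "m \<in> Arr C" using m by (simp add: mono_arr_def)
  then have "m \<cdot> (n \<cdot> m) = m \<cdot> Ide C (Dom C m)"
    "n \<cdot> m \<in> hom C (Dom C m) (Dom C m)" "Ide C (Dom C m) \<in> hom C (Dom C m) (Dom C m)"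
    using n(1) n(2)[THEN reassoc, of m] by (auto simp: hom_def arr_simps)
  then have "n \<cdot> m = Ide C (Dom C m)" using m unfolding mono_arr_def by blast
  then show ?thesis using n \<open>m \<in> Arr C\<close> by (auto simp: iso_arr_def)
qed

lemma regular_epi_iso_comp:
  assumes e: "regular_epi C e" and m: "iso_arr m" and dm: "Dom C m = Cod C e"
  shows "regular_epi C (m \<cdot> e)"
proof -
  obtain u v where c: "is_coequaliser C u v e" using e by (auto simp: regular_epi_def)
  note D = coequaliserD[OF c]
  obtain n where n: "n \<in> hom C (Cod C m) (Dom C m)" "m \<cdot> n = Ide C (Cod C m)"
    "n \<cdot> m = Ide C (Dom C m)" and ma: "m \<in> Arr C"
    using m by (auto simp: iso_arr_def)
  have "is_coequaliser C u v (m \<cdot> e)"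
    unfolding is_coequaliser_def
  proof (intro conjI allI ballI impI)
    show "u \<in> Arr C" "v \<in> hom C (Dom C u) (Cod C u)" using D by (auto simp: hom_def)
    show "m \<cdot> e \<in> hom C (Cod C u) (Cod C (m \<cdot> e))" "m \<cdot> e \<cdot> u = m \<cdot> e \<cdot> v"
      using D D(7)[THEN reassoc] ma dm by (auto simp: hom_def arr_simps)
    fix Z k assume k: "k \<in> hom C (Cod C u) Z" "k \<cdot> u = k \<cdot> v"
    then obtain h where h: "h \<in> hom C (Cod C e) Z" "h \<cdot> e = k" using coequaliser_lift[OF c] by blast
    show "\<exists>!h. h \<in> hom C (Cod C (m \<cdot> e)) Z \<and> h \<cdot> (m \<cdot> e) = k"
    proof (rule ex1I[of _ "h \<cdot> n"])
      show "h \<cdot> n \<in> hom C (Cod C (m \<cdot> e)) Z \<and> h \<cdot> n \<cdot> (m \<cdot> e) = k"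
        using D ma dm h n n(3)[THEN reassoc, of e] by (auto simp: hom_def arr_simps)
      fix h' assume h': "h' \<in> hom C (Cod C (m \<cdot> e)) Z \<and> h' \<cdot> (m \<cdot> e) = k"
      have "h' \<cdot> m = h"
        by (rule regular_epi_cancel[OF e])
          (use h' h D ma dm in \<open>auto simp: hom_def arr_simps\<close>)
      moreover have "(h' \<cdot> m) \<cdot> n = h'"
        using h' D(3) ma dm n(1,2) by (simp add: hom_def arr_simps)
      ultimately show "h' = h \<cdot> n" by simp
    qed
  qed
  then show ?thesis by (auto simp: regular_epi_def)
qed

end

locale regular_cat =
  fixes C :: "('o, 'a) cat" (structure)
  assumes regular: "regular_category C"

sublocale regular_cat \<subseteq> category
  using regular by (simp add: regular_category_def)

context regular_cat
begin

section \<open>Binary limits from finite completeness\<close>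

lemma pullback_exists:
  assumes "f \<in> Arr C" "g \<in> Arr C" "Cod C f = Cod C g"
  obtains p q where "is_pullback C f g p q"
proof -
  \<comment> \<open>The shape is the cospan: \<open>0\<close>, \<open>1\<close>, \<open>2\<close>
    are objects and also name their identities, \<open>3\<close> goes from \<open>0\<close> to
    \<open>2\<close> and \<open>4\<close> from \<open>1\<close> to \<open>2\<close>. In every
    composite one factor is an identity, and \<open>v \<le> 2\<close> tests whether it is
    \<open>v\<close>.\<close>
  define J :: "(nat, nat) cat" where "J = \<lparr>Obj = {0,1,2}, Arr = {0,1,2,3,4},
    Dom = (\<lambda>n. if n = 3 then 0 else if n = 4 then 1 else n),
    Cod = (\<lambda>n. if n = 3 \<or> n = 4 then 2 else n),
    Ide = (\<lambda>n. n), Comp = (\<lambda>v u. if v \<le> 2 then u else v)\<rparr>"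
  define F0 where "F0 = (\<lambda>n::nat. if n = 0 then Dom C f else if n = 1 then Dom C g else Cod C f)"
  define F1 where "F1 = (\<lambda>n::nat. if n = 3 then f else if n = 4 then g else Ide C (F0 n))"
  have "category J"
    by unfold_locales (auto simp: J_def hom_def split: if_splits)
  moreover have "is_functor J C F0 F1"
    using assms by (auto simp: is_functor_def J_def F0_def F1_def hom_def arr_simps)
  moreover have "finite (Obj J)" "finite (Arr J)" by (auto simp: J_def)
  moreover have "finitely_complete C" using regular by (simp add: regular_category_def)
  ultimately obtain L \<pi> where l: "is_limit J C F0 F1 L \<pi>"
    unfolding finitely_complete_def by blast
  have co: "is_cone J C F0 F1 M \<rho> \<longleftrightarrow> M \<in> Obj C \<and> \<rho> 0 \<in> hom C M (Dom C f) \<and> \<rho> 1 \<in> hom C M (Dom C g)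
      \<and> \<rho> 2 \<in> hom C M (Cod C f) \<and> f \<cdot> \<rho> 0 = \<rho> 2 \<and> g \<cdot> \<rho> 1 = \<rho> 2" for M \<rho>
    using assms by (auto simp: is_cone_def J_def F0_def F1_def hom_def arr_simps)
  note cl = l[unfolded is_limit_def, THEN conjunct1, unfolded co]
  have "is_pullback C f g (\<pi> 0) (\<pi> 1)"
    unfolding is_pullback_def
  proof (intro conjI allI ballI impI)
    show "f \<in> Arr C" "g \<in> Arr C" "Cod C f = Cod C g" by fact+
    show "\<pi> 0 \<in> hom C (Dom C (\<pi> 0)) (Dom C f)" "\<pi> 1 \<in> hom C (Dom C (\<pi> 0)) (Dom C g)"
      "f \<cdot> \<pi> 0 = g \<cdot> \<pi> 1" using cl by (auto simp: hom_def)
    fix Z a b assume a: "a \<in> hom C Z (Dom C f)" "b \<in> hom C Z (Dom C g)" "f \<cdot> a = g \<cdot> b"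
    define \<rho> where "\<rho> = (\<lambda>n::nat. if n = 0 then a else if n = 1 then b else f \<cdot> a)"
    have "is_cone J C F0 F1 Z \<rho>"
      unfolding co \<rho>_def using a assms by (auto simp: hom_def arr_simps)
    then have "\<exists>!h. h \<in> hom C Z L \<and> (\<forall>i \<in> Obj J. \<pi> i \<cdot> h = \<rho> i)"
      using l unfolding is_limit_def by blast
    moreover have "(\<forall>i \<in> Obj J. \<pi> i \<cdot> h = \<rho> i) \<longleftrightarrow> \<pi> 0 \<cdot> h = a \<and> \<pi> 1 \<cdot> h = b"
      if "h \<in> hom C Z L" for h
    proof -
      \<comment> \<open>The leg to the corner of the cospan is determined by the other two, so the
        limit condition reduces to two equations.\<close>
      have "\<pi> 2 \<cdot> h = f \<cdot> (\<pi> 0 \<cdot> h)"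
        using that cl assms assoc[of h "\<pi> 0" f] by (auto simp: hom_def)
      then show ?thesis by (auto simp: J_def \<rho>_def)
    qed
    moreover have "Dom C (\<pi> 0) = L" using cl by (auto simp: hom_def)
    ultimately show "\<exists>!h. h \<in> hom C Z (Dom C (\<pi> 0)) \<and> \<pi> 0 \<cdot> h = a \<and> \<pi> 1 \<cdot> h = b"
      by (metis (no_types, lifting))
  qed
  then show thesis using that by blast
qed

lemma product_exists:
  assumes "X \<in> Obj C" "Y \<in> Obj C"
  obtains p q where "is_product C X Y p q"
proof -
  \<comment> \<open>The shape is discrete: two objects, with identities as the only arrows.\<close>
  define J :: "(nat, nat) cat" where "J = \<lparr>Obj = {0,1}, Arr = {0,1},
    Dom = (\<lambda>n. n), Cod = (\<lambda>n. n), Ide = (\<lambda>n. n), Comp = (\<lambda>v u. u)\<rparr>"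
  define F0 where "F0 = (\<lambda>n::nat. if n = 0 then X else Y)"
  define F1 where "F1 = (\<lambda>n::nat. Ide C (F0 n))"
  have "category J"
    by unfold_locales (auto simp: J_def hom_def split: if_splits)
  moreover have "is_functor J C F0 F1"
    using assms by (auto simp: is_functor_def J_def F0_def F1_def hom_def arr_simps)
  moreover have "finite (Obj J)" "finite (Arr J)" by (auto simp: J_def)
  moreover have "finitely_complete C" using regular by (simp add: regular_category_def)
  ultimately obtain L \<pi> where l: "is_limit J C F0 F1 L \<pi>"
    unfolding finitely_complete_def by blast
  have co: "is_cone J C F0 F1 M \<rho> \<longleftrightarrow> M \<in> Obj C \<and> \<rho> 0 \<in> hom C M X \<and> \<rho> 1 \<in> hom C M Y" for M \<rho>
    using assms by (auto simp: is_cone_def J_def F0_def F1_def hom_def arr_simps)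
  note cl = l[unfolded is_limit_def, THEN conjunct1, unfolded co]
  have "is_product C X Y (\<pi> 0) (\<pi> 1)"
    unfolding is_product_def
  proof (intro conjI allI ballI impI)
    show "\<pi> 0 \<in> hom C (Dom C (\<pi> 0)) X" "\<pi> 1 \<in> hom C (Dom C (\<pi> 0)) Y"
      using cl by (auto simp: hom_def)
    fix Z a b assume a: "a \<in> hom C Z X" "b \<in> hom C Z Y"
    define \<rho> where "\<rho> = (\<lambda>n::nat. if n = 0 then a else b)"
    have "is_cone J C F0 F1 Z \<rho>"
      unfolding co \<rho>_def using a by (auto simp: hom_def arr_simps)
    then have "\<exists>!h. h \<in> hom C Z L \<and> (\<forall>i \<in> Obj J. \<pi> i \<cdot> h = \<rho> i)"
      using l unfolding is_limit_def by blast
    moreover have "(\<forall>i \<in> Obj J. \<pi> i \<cdot> h = \<rho> i) \<longleftrightarrow> \<pi> 0 \<cdot> h = a \<and> \<pi> 1 \<cdot> h = b" for h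
      by (auto simp: J_def \<rho>_def)
    moreover have "Dom C (\<pi> 0) = L" using cl by (auto simp: hom_def)
    ultimately show "\<exists>!h. h \<in> hom C Z (Dom C (\<pi> 0)) \<and> \<pi> 0 \<cdot> h = a \<and> \<pi> 1 \<cdot> h = b"
      by simp
  qed
  then show thesis using that by blast
qed

text \<open>This is pullback stability of regular epimorphisms in terms of elements:
  \<open>x\<close> lifts along \<open>e\<close> once restricted along a cover \<open>w\<close>. All
  local existence statements below come from it.\<close>

lemma regular_epi_lift:
  assumes "regular_epi C e" "x \<in> hom C Z (Cod C e)"
  obtains W w y where "regular_epi C w" "w \<in> hom C W Z" "y \<in> hom C W (Dom C e)" "e \<cdot> y = x \<cdot> w"
proof -
  have "e \<in> Arr C" "x \<in> Arr C" "Cod C e = Cod C x"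
    using regular_epi_arr assms by (auto simp: hom_def)
  then obtain p q where pb: "is_pullback C e x p q" using pullback_exists by blast
  then have "regular_epi C q" using regular assms(1) by (auto simp: regular_category_def)
  then show thesis using that pb assms(2) by (auto simp: is_pullback_def hom_def)
qed

text \<open>The regular part is the coequaliser \<open>e\<close> of the kernel pair of
  \<open>f\<close>, and \<open>m\<close> is the induced arrow. It is monic because elements of the
  image lift locally to the domain of \<open>f\<close>, where equality under \<open>f\<close> is
  equality under \<open>e\<close>.\<close>

lemma image_factorisation:
  assumes f: "f \<in> Arr C"
  obtains m e where "mono_arr C m" "regular_epi C e" "Dom C e = Dom C f" "Cod C m = Cod C f"
    "Cod C e = Dom C m" "f = m \<cdot> e"
proof -
  obtain p q where pb: "is_pullback C f f p q" using pullback_exists f by blast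
  then obtain e where e: "is_coequaliser C p q e" using regular unfolding regular_category_def by blast
  note D = pullbackD[OF pb]
  have re: "regular_epi C e" using e by (auto simp: regular_epi_def)
  have ea: "e \<in> hom C (Dom C f) (Cod C e)" "e \<cdot> p = e \<cdot> q" using e D by (auto simp: is_coequaliser_def)
  have "f \<in> hom C (Cod C p) (Cod C f)" "f \<cdot> p = f \<cdot> q" using D by (auto simp: hom_def)
  then obtain m where m: "m \<in> hom C (Cod C e) (Cod C f)" "m \<cdot> e = f"
    by (rule coequaliser_lift[OF e])
  have "mono_arr C m"
    unfolding mono_arr_def
  proof (intro conjI allI ballI impI)
    show "m \<in> Arr C" using m by (auto simp: hom_def)
    have dm: "Dom C m = Cod C e" using m by (auto simp: hom_def)
    fix Z u v assume u: "u \<in> hom C Z (Dom C m)" and v: "v \<in> hom C Z (Dom C m)" and eq: "m \<cdot> u = m \<cdot> v"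
    obtain W w x where w: "regular_epi C w" "w \<in> hom C W Z" "x \<in> hom C W (Dom C e)" "e \<cdot> x = u \<cdot> w"
      using regular_epi_lift[OF re] u dm by metis
    \<comment> \<open>The second lift is taken over the cover used for the first, so both can be
      compared over \<open>W'\<close>.\<close>
    obtain W' w' y where w': "regular_epi C w'" "w' \<in> hom C W' W" "y \<in> hom C W' (Dom C e)"
      "e \<cdot> y = (v \<cdot> w) \<cdot> w'"
      using regular_epi_lift[OF re, of "v \<cdot> w" W] Comp_hom[OF w(2) v] dm by metis
    note ty = ea(1) m(1) u v w(2,3) w'(2,3) D(1-8)
    have "f \<cdot> (x \<cdot> w') = m \<cdot> (e \<cdot> (x \<cdot> w'))"
      using ty m(2)[THEN reassoc, of "x \<cdot> w'"] by (simp add: hom_def arr_simps)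
    also have "\<dots> = m \<cdot> (u \<cdot> (w \<cdot> w'))"
      using ty w(4)[THEN reassoc, of w'] by (simp add: hom_def arr_simps)
    also have "\<dots> = m \<cdot> (v \<cdot> (w \<cdot> w'))"
      using ty eq[THEN reassoc, of "w \<cdot> w'"] by (simp add: hom_def arr_simps)
    also have "\<dots> = m \<cdot> (e \<cdot> y)"
      using ty by (simp add: w'(4) hom_def arr_simps)
    also have "\<dots> = f \<cdot> y"
      using ty m(2)[THEN reassoc, of y] by (simp add: hom_def arr_simps)
    finally have "f \<cdot> (x \<cdot> w') = f \<cdot> y" .
    moreover have "x \<cdot> w' \<in> hom C W' (Dom C f)" "y \<in> hom C W' (Dom C f)"
      using ty by (auto simp: hom_def arr_simps)
    ultimately obtain h where h: "h \<in> hom C W' (Dom C p)" "p \<cdot> h = x \<cdot> w'" "q \<cdot> h = y"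
      using pullback_lift[OF pb] by metis
    \<comment> \<open>The two lifts form an element \<open>h\<close> of the kernel pair of
      \<open>f\<close>, whose projections \<open>e\<close> coequalises.\<close>
    have "(u \<cdot> w) \<cdot> w' = e \<cdot> (p \<cdot> h)"
      unfolding h using ty w(4)[THEN reassoc, of w'] by (simp add: hom_def arr_simps)
    also have "\<dots> = e \<cdot> (q \<cdot> h)"
      using ea(2)[THEN reassoc, of h] ty h(1) by (simp add: hom_def arr_simps)
    also have "\<dots> = (v \<cdot> w) \<cdot> w'" unfolding h w'(4) ..
    finally have "(u \<cdot> w) \<cdot> w' = (v \<cdot> w) \<cdot> w'" .
    then have "u \<cdot> w = v \<cdot> w"
      by (intro regular_epi_cancel[OF w'(1), of "u \<cdot> w" "v \<cdot> w"])
        (use ty in \<open>simp_all add: hom_def arr_simps\<close>)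
    then show "u = v"
      by (intro regular_epi_cancel[OF w(1), of u v]) (use ty in \<open>simp_all add: hom_def\<close>)
  qed
  then show thesis
    by (intro that[of m e]) (use re m ea(1) in \<open>simp_all add: hom_def\<close>)
qed

text \<open>In a regular category, extremal epimorphisms are regular: applied to the image
  factorisation, the condition splits the monic part, which is then an isomorphism.\<close>

lemma regular_epiI:
  assumes f: "f \<in> Arr C"
    and ext: "\<And>m h. mono_arr C m \<Longrightarrow> h \<in> hom C (Dom C f) (Dom C m) \<Longrightarrow> Cod C m = Cod C f \<Longrightarrow> m \<cdot> h = f \<Longrightarrow>
      \<exists>n \<in> hom C (Cod C f) (Dom C m). m \<cdot> n = Ide C (Cod C f)"
  shows "regular_epi C f"
proof -
  obtain m e where m: "mono_arr C m" "regular_epi C e" "Dom C e = Dom C f" "Cod C m = Cod C f"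
    "Cod C e = Dom C m" "f = m \<cdot> e" using image_factorisation[OF f] .
  have "\<exists>n \<in> hom C (Cod C f) (Dom C m). m \<cdot> n = Ide C (Cod C f)"
    by (rule ext[where h = e]) (use m regular_epi_arr[OF m(2)] in \<open>auto simp: hom_def\<close>)
  then have "iso_arr m" using mono_split_iso[OF m(1)] m(4) by auto
  then show ?thesis using regular_epi_iso_comp[OF m(2), of m] m by auto
qed

text \<open>A composite of coequalisers is not visibly a coequaliser, but extremality composes: a
  monomorphism through which \<open>g \<cdot> f\<close> factors is split by two successive diagonal
  fill-ins, first along \<open>f\<close> and then along \<open>g\<close>.\<close>

lemma regular_epi_comp:
  assumes f: "regular_epi C f" and g: "regular_epi C g" and eq: "Cod C f = Dom C g"
  shows "regular_epi C (g \<cdot> f)"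
proof (rule regular_epiI)
  note ty = regular_epi_arr[OF f] regular_epi_arr[OF g] eq
  show "g \<cdot> f \<in> Arr C" using ty by (simp add: arr_simps)
  fix m h assume m: "mono_arr C m" "h \<in> hom C (Dom C (g \<cdot> f)) (Dom C m)" "Cod C m = Cod C (g \<cdot> f)"
    "m \<cdot> h = g \<cdot> f"
  have h: "h \<in> hom C (Dom C f) (Dom C m)" using m ty by (auto simp: arr_simps)
  obtain t where t: "t \<in> hom C (Cod C f) (Dom C m)" "m \<cdot> t = g"
    by (rule regular_epi_diagonal[OF f m(1)[unfolded mono_arr_iff] h, of g "Cod C g" g "Cod C g"])
      (use m(4) ty in \<open>auto simp: hom_def\<close>)
  obtain n where "n \<in> hom C (Cod C g) (Dom C m)" "m \<cdot> n = Ide C (Cod C g)"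
    by (rule regular_epi_diagonal[OF g m(1)[unfolded mono_arr_iff], of t "Ide C (Cod C g)" "Cod C g" "Ide C (Cod C g)" "Cod C g"])
      (use t ty in \<open>auto simp: hom_def arr_simps\<close>)
  then show "\<exists>n \<in> hom C (Cod C (g \<cdot> f)) (Dom C m). m \<cdot> n = Ide C (Cod C (g \<cdot> f))"
    using ty by (auto simp: arr_simps)
qed

text \<open>A monomorphism through which \<open>g\<close> factors is also one through which
  \<open>g \<cdot> f\<close> factors, so the splitting for the composite serves
  \<open>g\<close>.\<close>

lemma regular_epi_right_cancel:
  assumes gf: "regular_epi C (g \<cdot> f)" and f: "f \<in> Arr C" and g: "g \<in> Arr C" and eq: "Cod C f = Dom C g"
  shows "regular_epi C g"
proof (rule regular_epiI)
  show "g \<in> Arr C" by fact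
  fix m h assume m: "mono_arr C m" "h \<in> hom C (Dom C g) (Dom C m)" "Cod C m = Cod C g" "m \<cdot> h = g"
  have ma: "m \<in> Arr C" using m by (simp add: mono_arr_def)
  obtain n where "n \<in> hom C (Cod C (g \<cdot> f)) (Dom C m)" "m \<cdot> n = Ide C (Cod C g)"
    by (rule regular_epi_diagonal[OF gf m(1)[unfolded mono_arr_iff], of "h \<cdot> f" "Ide C (Cod C g)" "Cod C g" "Ide C (Cod C g)" "Cod C g"])
      (use m m(4)[THEN reassoc, of f] f g eq ma in \<open>auto simp: hom_def arr_simps\<close>)
  then show "\<exists>n \<in> hom C (Cod C g) (Dom C m). m \<cdot> n = Ide C (Cod C g)"
    using f g eq by (auto simp: arr_simps)
qed

lemma ide_regular_epi:
  assumes "A \<in> Obj C"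
  shows "regular_epi C (Ide C A)"
proof (rule regular_epiI)
  show "Ide C A \<in> Arr C" using assms by (simp add: arr_simps)
  fix m h assume "mono_arr C m" "h \<in> hom C (Dom C (Ide C A)) (Dom C m)" "m \<cdot> h = Ide C A"
  then show "\<exists>n\<in>hom C (Cod C (Ide C A)) (Dom C m). m \<cdot> n = Ide C (Cod C (Ide C A))"
    using assms by (auto simp: arr_simps)
qed

lemma split_epi_regular:
  assumes "f \<in> hom C A B" "s \<in> hom C B A" "f \<cdot> s = Ide C B"
  shows "regular_epi C f"
  by (rule regular_epi_right_cancel[of _ s]) (use assms ide_regular_epi[of B] Cod_Obj[of f] in \<open>auto simp: hom_def\<close>)

text \<open>Local surjectivity suffices: \<open>w\<close> is the restriction of the generic element
  of \<open>B\<close> and \<open>y\<close> a local lift of it.\<close>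

lemma regular_epi_if_lift:
  assumes "f \<in> hom C A B" "regular_epi C w" "w \<in> hom C W B" "y \<in> hom C W A" "f \<cdot> y = w"
  shows "regular_epi C f"
  by (rule regular_epi_right_cancel[of _ y]) (use assms in \<open>auto simp: hom_def\<close>)

text \<open>The descent principle for elements: an arrow that is constant on the fibres of
  \<open>e\<close> factors through \<open>e\<close>. The condition is used only at the pair that
  \<open>e\<close> coequalises.\<close>

lemma regular_epi_extend:
  assumes e: "regular_epi C e" and k: "k \<in> hom C (Dom C e) Y"
    and comp: "\<And>Z x x'. x \<in> hom C Z (Dom C e) \<Longrightarrow> x' \<in> hom C Z (Dom C e) \<Longrightarrow> e \<cdot> x = e \<cdot> x' \<Longrightarrow> k \<cdot> x = k \<cdot> x'"
  obtains h where "h \<in> hom C (Cod C e) Y" "h \<cdot> e = k"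
proof -
  obtain u v where c: "is_coequaliser C u v e" using e by (auto simp: regular_epi_def)
  note d = coequaliserD[OF c]
  have "k \<cdot> u = k \<cdot> v" "k \<in> hom C (Cod C u) Y"
    using comp[of u "Dom C u" v] d k by (auto simp: hom_def)
  then show thesis using coequaliser_lift[OF c] that by blast
qed

end

section \<open>Relations and the Goursat property in terms of generalised elements\<close>

context regular_cat
begin

text \<open>The pair \<open>(x, y)\<close> is a generalised element with common domain
  \<open>Dom C x\<close>. The notion makes sense for any span; it is applied to relations and also
  to the source and target of a graph.\<close>

definition mem :: "'a \<Rightarrow> 'a \<Rightarrow> 'a \<Rightarrow> 'a \<Rightarrow> bool" where
  "mem r1 r2 x y \<longleftrightarrow> (\<exists>k \<in> hom C (Dom C x) (Dom C r1). r1 \<cdot> k = x \<and> r2 \<cdot> k = y)"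

lemma memI: "k \<in> hom C Z (Dom C r1) \<Longrightarrow> r1 \<in> Arr C \<Longrightarrow> r1 \<cdot> k = x \<Longrightarrow> r2 \<cdot> k = y \<Longrightarrow> mem r1 r2 x y"
  by (auto simp: mem_def hom_def arr_simps)

lemma memE:
  assumes "mem r1 r2 x y" "x \<in> hom C Z X"
  obtains k where "k \<in> hom C Z (Dom C r1)" "r1 \<cdot> k = x" "r2 \<cdot> k = y"
  using assms unfolding mem_def hom_def by blast

lemma mem_restrict:
  assumes m: "mem r1 r2 x y" and x: "x \<in> hom C Z X" and w: "w \<in> hom C W Z"
    and r: "r1 \<in> Arr C" "r2 \<in> Arr C" "Dom C r2 = Dom C r1"
  shows "mem r1 r2 (x \<cdot> w) (y \<cdot> w)"
proof -
  obtain k where k: "k \<in> hom C Z (Dom C r1)" "r1 \<cdot> k = x" "r2 \<cdot> k = y" using memE[OF m x] .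
  show ?thesis
    by (rule memI[of "k \<cdot> w" W]) (use k w r k(2,3)[THEN reassoc, of w] in \<open>auto simp: hom_def arr_simps\<close>)
qed

text \<open>Membership in a relation descends along covers: the witness over \<open>W\<close> is the
  upper side of a square whose diagonal exists by joint monicity of the legs.\<close>

lemma mem_local:
  assumes m: "mem r1 r2 (x \<cdot> w) (y \<cdot> w)" and j: "jointly_monic r1 r2"
    and w: "regular_epi C w" "w \<in> hom C W Z" and x: "x \<in> hom C Z X" and y: "y \<in> hom C Z Y"
  shows "mem r1 r2 x y"
proof -
  obtain k where k: "k \<in> hom C W (Dom C r1)" "r1 \<cdot> k = x \<cdot> w" "r2 \<cdot> k = y \<cdot> w"
    using memE[OF m Comp_hom[OF w(2) x]] .
  obtain h where "h \<in> hom C (Cod C w) (Dom C r1)" "r1 \<cdot> h = x" "r2 \<cdot> h = y"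
    by (rule regular_epi_diagonal[OF w(1) j, of k x X y Y]) (use k w x y in \<open>auto simp: hom_def\<close>)
  then show ?thesis using j w by (intro memI) (auto simp: jointly_monic_def hom_def)
qed

text \<open>Inclusion is membership of the generic element, whose components are the legs
  themselves.\<close>

lemma rel_le_mem: "rel_le C (r1, r2) (s1, s2) \<longleftrightarrow> mem s1 s2 r1 r2"
  by (simp add: rel_le_def mem_def)

section \<open>Relations and their composites\<close>

lemma is_relation_objD: "is_relation C X Y (r1, r2) \<Longrightarrow> X \<in> Obj C \<and> Y \<in> Obj C"
  using Cod_Obj by (auto simp: is_relation_def hom_def)

lemma relation_iff:
  assumes "X \<in> Obj C" "Y \<in> Obj C"
  shows "is_relation C X Y (r1, r2) \<longleftrightarrow>
    r1 \<in> hom C (Dom C r1) X \<and> r2 \<in> hom C (Dom C r1) Y \<and> jointly_monic r1 r2"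
proof -
  obtain p q where "is_product C X Y p q" using product_exists[OF assms] .
  from is_relation_iff[OF this] show ?thesis .
qed

lemma relationD:
  assumes "is_relation C X Y (r1, r2)"
  shows "r1 \<in> Arr C" "r2 \<in> Arr C" "Dom C r2 = Dom C r1" "Cod C r1 = X" "Cod C r2 = Y" "jointly_monic r1 r2"
  using assms relation_iff[of X Y r1 r2] is_relation_objD[OF assms] by (auto simp: hom_def)

text \<open>Both the product and the tuples disappear: \<open>t1\<close>, \<open>t2\<close> are
  jointly monic, so their tuple is always monic, and a factorisation of tuples is a pair of
  equations between components.\<close>

lemma is_composite_iff:
  assumes R: "is_relation C X Y (r1, r2)" and S: "is_relation C Y Z (s1, s2)" and T: "is_relation C X Z (t1, t2)"
  shows "is_composite C X Y Z (s1, s2) (r1, r2) (t1, t2) \<longleftrightarrow>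
    (\<exists>p1 p2 e. is_pullback C r2 s1 p1 p2 \<and> regular_epi C e \<and> Dom C e = Dom C p1 \<and> Cod C e = Dom C t1 \<and>
      t1 \<cdot> e = r1 \<cdot> p1 \<and> t2 \<cdot> e = s2 \<cdot> p2)" (is "?L \<longleftrightarrow> ?R")
proof -
  note tyR = relationD[OF R] and tyS = relationD[OF S] and tyT = relationD[OF T]
  have key: "is_image C (tuple C q1 q2 (r1 \<cdot> p1) (s2 \<cdot> p2)) (tuple C q1 q2 t1 t2) \<longleftrightarrow>
      (\<exists>e. regular_epi C e \<and> Dom C e = Dom C p1 \<and> Cod C e = Dom C t1 \<and>
      t1 \<cdot> e = r1 \<cdot> p1 \<and> t2 \<cdot> e = s2 \<cdot> p2)" (is "?I \<longleftrightarrow> ?E")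
    if pb: "is_pullback C r2 s1 p1 p2" and pr: "is_product C X Z q1 q2" for p1 p2 q1 q2
  proof -
    note D = pullbackD[OF pb]
    have t12: "t1 \<in> hom C (Dom C t1) X" "t2 \<in> hom C (Dom C t1) Z" using tyT by (auto simp: hom_def)
    have h12: "r1 \<cdot> p1 \<in> hom C (Dom C p1) X" "s2 \<cdot> p2 \<in> hom C (Dom C p1) Z"
      using tyR(1-5) tyS(1-5) D(1-8) by (simp_all add: hom_def arr_simps)
    note t = product_tuple[OF pr t12] and h = product_tuple[OF pr h12]
    let ?t = "tuple C q1 q2 t1 t2" and ?h = "tuple C q1 q2 (r1 \<cdot> p1) (s2 \<cdot> p2)"
    have q: "q1 \<in> Arr C" "q2 \<in> Arr C" "Dom C q2 = Dom C q1"
      using product_jointly_monic[OF pr] by (auto simp: jointly_monic_def)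
    have "?h = ?t \<cdot> e \<longleftrightarrow> t1 \<cdot> e = r1 \<cdot> p1 \<and> t2 \<cdot> e = s2 \<cdot> p2"
      if e: "e \<in> hom C (Dom C p1) (Dom C t1)" for e
    proof -
      have "q1 \<cdot> (?t \<cdot> e) = t1 \<cdot> e" "q2 \<cdot> (?t \<cdot> e) = t2 \<cdot> e"
        using t(2,3)[THEN reassoc, of e] t(1) e q by (auto simp: hom_def)
      moreover have "?t \<cdot> e \<in> hom C (Dom C p1) (Dom C q1)" using Comp_hom[OF e t(1)] .
      ultimately show ?thesis
        using h(2,3) jointly_monicD[OF product_jointly_monic[OF pr] h(1), of "?t \<cdot> e"] by metis
    qed
    note eq = this
    have mono: "mono_arr C ?t"
      unfolding mono_arr_def
    proof (intro conjI allI ballI impI)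
      show "?t \<in> Arr C" using t by (auto simp: hom_def)
      have dt: "Dom C ?t = Dom C t1" "?t \<in> Arr C" using t(1) by (auto simp: hom_def)
      fix W u v assume u: "u \<in> hom C W (Dom C ?t)" and v: "v \<in> hom C W (Dom C ?t)" and uv: "?t \<cdot> u = ?t \<cdot> v"
      have "t1 \<cdot> u = q1 \<cdot> (?t \<cdot> u)" "t1 \<cdot> v = q1 \<cdot> (?t \<cdot> v)" "t2 \<cdot> u = q2 \<cdot> (?t \<cdot> u)" "t2 \<cdot> v = q2 \<cdot> (?t \<cdot> v)"
        using t(2,3)[THEN reassoc, of u] t(2,3)[THEN reassoc, of v] t(1) q u v by (auto simp: hom_def)
      then show "u = v" using jointly_monicD[OF tyT(6), of u W v] u v uv dt by auto
    qed
    show ?thesis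
    proof
      assume ?I
      then obtain e where e: "regular_epi C e" "Cod C e = Dom C ?t" "?h = ?t \<cdot> e" unfolding is_image_def by auto
      have "Dom C ?h = Dom C e"
        unfolding e(3) using e(1,2) regular_epi_arr[OF e(1)] t(1) by (simp add: hom_def arr_simps)
      then have "e \<in> hom C (Dom C p1) (Dom C t1)"
        using e(1,2) regular_epi_arr[OF e(1)] t(1) h(1) by (simp add: hom_def)
      with e eq[of e] show ?E by (auto simp: hom_def)
    next
      assume ?E
      then obtain e where e: "regular_epi C e" "Dom C e = Dom C p1" "Cod C e = Dom C t1"
        "t1 \<cdot> e = r1 \<cdot> p1" "t2 \<cdot> e = s2 \<cdot> p2" by blast
      then have "e \<in> hom C (Dom C p1) (Dom C t1)" using regular_epi_arr[OF e(1)] by (simp add: hom_def)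
      with eq[of e] e t(1) mono show ?I unfolding is_image_def
        by (intro conjI exI[of _ e]) (auto simp: hom_def)
    qed
  qed
  obtain q1 q2 where pr: "is_product C X Z q1 q2"
    using product_exists is_relation_objD[OF T] by blast
  show ?thesis
  proof
    assume ?L
    then obtain p1 p2 q1 q2 where "is_pullback C r2 s1 p1 p2" "is_product C X Z q1 q2"
      "is_image C (tuple C q1 q2 (r1 \<cdot> p1) (s2 \<cdot> p2)) (tuple C q1 q2 t1 t2)"
      unfolding is_composite_def by auto
    with key show ?R by blast
  next
    assume ?R
    then obtain p1 p2 where "is_pullback C r2 s1 p1 p2" "\<exists>e. regular_epi C e \<and> Dom C e = Dom C p1 \<and>
      Cod C e = Dom C t1 \<and> t1 \<cdot> e = r1 \<cdot> p1 \<and> t2 \<cdot> e = s2 \<cdot> p2" by blast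
    with key[OF _ pr] have "is_pullback C r2 s1 p1 p2 \<and> is_product C X Z q1 q2 \<and>
      is_image C (tuple C q1 q2 (r1 \<cdot> p1) (s2 \<cdot> p2)) (tuple C q1 q2 t1 t2)" using pr by blast
    then show ?L unfolding is_composite_def prod.case using R S T by blast
  qed
qed

lemma is_compositeD:
  assumes "is_composite C X Y Z (s1, s2) (r1, r2) (t1, t2)"
  shows "is_relation C X Y (r1, r2)" "is_relation C Y Z (s1, s2)" "is_relation C X Z (t1, t2)"
  using assms by (simp_all add: is_composite_def)

text \<open>The middle element lives in the pullback, and the composite is only an image of that
  pullback, so it can be produced only after restriction along a cover.\<close>

lemma composite_memE:
  assumes c: "is_composite C X Y Z (s1, s2) (r1, r2) (t1, t2)" and m: "mem t1 t2 x z" and x: "x \<in> hom C A X"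
  obtains B w y where "regular_epi C w" "w \<in> hom C B A" "y \<in> hom C B Y" "mem r1 r2 (x \<cdot> w) y" "mem s1 s2 y (z \<cdot> w)"
proof -
  note R = relationD[OF is_compositeD(1)[OF c]] and S = relationD[OF is_compositeD(2)[OF c]]
    and T = relationD[OF is_compositeD(3)[OF c]]
  obtain p1 p2 e where pb: "is_pullback C r2 s1 p1 p2" and e: "regular_epi C e" "Dom C e = Dom C p1"
    "Cod C e = Dom C t1" "t1 \<cdot> e = r1 \<cdot> p1" "t2 \<cdot> e = s2 \<cdot> p2"
    using is_composite_iff[OF is_compositeD[OF c]] c by blast
  note D = pullbackD[OF pb]
  obtain k where k: "k \<in> hom C A (Dom C t1)" "t1 \<cdot> k = x" "t2 \<cdot> k = z" using memE[OF m x] .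
  obtain B w h where w: "regular_epi C w" "w \<in> hom C B A" and h: "h \<in> hom C B (Dom C e)" "e \<cdot> h = k \<cdot> w"
    using regular_epi_lift[OF e(1)] k(1) e(3) by metis
  note ty = R(1-5) S(1-5) T(1-5) D(1-8) k(1) w(2) h(1) e(2,3) regular_epi_arr[OF e(1)]
  show thesis
  proof (rule that[OF w])
    show "r2 \<cdot> (p1 \<cdot> h) \<in> hom C B Y" using ty by (simp add: hom_def arr_simps)
    have "r1 \<cdot> (p1 \<cdot> h) = t1 \<cdot> (k \<cdot> w)" "s2 \<cdot> (p2 \<cdot> h) = t2 \<cdot> (k \<cdot> w)"
      using ty e(4,5)[THEN reassoc, of h] h(2) by (simp_all add: hom_def arr_simps)
    then have "r1 \<cdot> (p1 \<cdot> h) = x \<cdot> w" "s2 \<cdot> (p2 \<cdot> h) = z \<cdot> w"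
      using ty k(2,3)[THEN reassoc, of w] by (simp_all add: hom_def)
    moreover have "s1 \<cdot> (p2 \<cdot> h) = r2 \<cdot> (p1 \<cdot> h)"
      using ty D(9)[THEN reassoc, of h] by (simp add: hom_def arr_simps)
    ultimately show "mem r1 r2 (x \<cdot> w) (r2 \<cdot> (p1 \<cdot> h))" "mem s1 s2 (r2 \<cdot> (p1 \<cdot> h)) (z \<cdot> w)"
      by (intro memI[of "p1 \<cdot> h" B] memI[of "p2 \<cdot> h" B]; use ty in \<open>simp add: hom_def arr_simps\<close>)+
  qed
qed

lemma composite_memI:
  assumes c: "is_composite C X Y Z (s1, s2) (r1, r2) (t1, t2)" and m: "mem r1 r2 x y" "mem s1 s2 y z"
    and x: "x \<in> hom C A X" and y: "y \<in> hom C A Y"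
  shows "mem t1 t2 x z"
proof -
  note R = relationD[OF is_compositeD(1)[OF c]] and S = relationD[OF is_compositeD(2)[OF c]]
    and T = relationD[OF is_compositeD(3)[OF c]]
  obtain p1 p2 e where pb: "is_pullback C r2 s1 p1 p2" and e: "regular_epi C e" "Dom C e = Dom C p1"
    "Cod C e = Dom C t1" "t1 \<cdot> e = r1 \<cdot> p1" "t2 \<cdot> e = s2 \<cdot> p2"
    using is_composite_iff[OF is_compositeD[OF c]] c by blast
  note D = pullbackD[OF pb]
  obtain k where k: "k \<in> hom C A (Dom C r1)" "r1 \<cdot> k = x" "r2 \<cdot> k = y" using memE[OF m(1) x] .
  obtain l where l: "l \<in> hom C A (Dom C s1)" "s1 \<cdot> l = y" "s2 \<cdot> l = z" using memE[OF m(2) y] .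
  obtain h where h: "h \<in> hom C A (Dom C p1)" "p1 \<cdot> h = k" "p2 \<cdot> h = l"
    using pullback_lift[OF pb, of k A l] k l R(3) by auto
  note ty = R(1-5) S(1-5) T(1-5) D(1-8) k(1) l(1) h(1) e(2,3) regular_epi_arr[OF e(1)]
  have "t1 \<cdot> (e \<cdot> h) = r1 \<cdot> (p1 \<cdot> h)" "t2 \<cdot> (e \<cdot> h) = s2 \<cdot> (p2 \<cdot> h)"
    using ty e(4,5)[THEN reassoc, of h] by (simp_all add: hom_def arr_simps)
  then show ?thesis
    unfolding h k l by (intro memI[of "e \<cdot> h" A]) (use ty in \<open>simp_all add: hom_def arr_simps\<close>)
qed

lemma composite_exists:
  assumes R: "is_relation C X Y (r1, r2)" and S: "is_relation C Y Z (s1, s2)"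
  obtains t1 t2 where "is_composite C X Y Z (s1, s2) (r1, r2) (t1, t2)"
proof -
  note tyR = relationD[OF R] and tyS = relationD[OF S]
  obtain p1 p2 where pb: "is_pullback C r2 s1 p1 p2" using pullback_exists tyR tyS by metis
  note D = pullbackD[OF pb]
  have X: "X \<in> Obj C" and Z: "Z \<in> Obj C" using is_relation_objD[OF R] is_relation_objD[OF S] by auto
  obtain q1 q2 where pr: "is_product C X Z q1 q2" using product_exists[OF X Z] .
  have q: "q1 \<in> Arr C" "q2 \<in> Arr C" "Dom C q2 = Dom C q1" "Cod C q1 = X" "Cod C q2 = Z"
    using pr by (auto simp: is_product_def hom_def)
  obtain f where f: "f \<in> hom C (Dom C p1) (Dom C q1)" "q1 \<cdot> f = r1 \<cdot> p1" "q2 \<cdot> f = s2 \<cdot> p2"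
    by (rule product_lift[OF pr, of "r1 \<cdot> p1" "Dom C p1" "s2 \<cdot> p2"])
      (use tyR(1-5) tyS(1-5) D(1-8) in \<open>simp_all add: hom_def arr_simps\<close>)
  have fa: "f \<in> Arr C" using f by (simp add: hom_def)
  obtain m e where m: "mono_arr C m" "regular_epi C e" "Dom C e = Dom C f" "Cod C m = Cod C f"
    "Cod C e = Dom C m" "f = m \<cdot> e" using image_factorisation[OF fa] .
  have ma: "m \<in> Arr C" using m(1) by (simp add: mono_arr_def)
  note ty = q f(1) m(3-5) ma regular_epi_arr[OF m(2)]
  have j: "jointly_monic (q1 \<cdot> m) (q2 \<cdot> m)"
    unfolding jointly_monic_def
  proof (intro conjI allI ballI impI)
    show "q1 \<cdot> m \<in> Arr C" "q2 \<cdot> m \<in> Arr C" "Dom C (q1 \<cdot> m) = Dom C (q2 \<cdot> m)"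
      using ty by (simp_all add: hom_def arr_simps)
    fix W u v assume u: "u \<in> hom C W (Dom C (q1 \<cdot> m))" and v: "v \<in> hom C W (Dom C (q1 \<cdot> m))"
      and eq: "q1 \<cdot> m \<cdot> u = q1 \<cdot> m \<cdot> v \<and> q2 \<cdot> m \<cdot> u = q2 \<cdot> m \<cdot> v"
    have u': "u \<in> hom C W (Dom C m)" and v': "v \<in> hom C W (Dom C m)"
      using u v ty by (simp_all add: hom_def arr_simps)
    have "m \<cdot> u = m \<cdot> v"
      by (rule jointly_monicD[OF product_jointly_monic[OF pr], of _ W])
        (use u' v' eq ty in \<open>simp_all add: hom_def arr_simps\<close>)
    then show "u = v" using jointly_monicD[OF m(1)[unfolded mono_arr_iff] u' v'] by simp
  qed
  have T: "is_relation C X Z (q1 \<cdot> m, q2 \<cdot> m)"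
    unfolding relation_iff[OF X Z] using j ty by (simp add: hom_def arr_simps)
  have "q1 \<cdot> m \<cdot> e = r1 \<cdot> p1" "q2 \<cdot> m \<cdot> e = s2 \<cdot> p2"
    unfolding f(2,3)[symmetric] m(6) using ty by (simp_all add: hom_def arr_simps)
  then have "is_composite C X Y Z (s1, s2) (r1, r2) (q1 \<cdot> m, q2 \<cdot> m)"
    unfolding is_composite_iff[OF R S T]
    using pb m(2) ty by (intro exI[of _ p1] exI[of _ p2] exI[of _ e]) (simp add: hom_def arr_simps)
  then show thesis using that by blast
qed

text \<open>The intersection of the kernel pairs of \<open>g1\<close> and \<open>g2\<close> is again
  the kernel pair of one arrow, so statements about single kernel pairs apply to it.\<close>

lemma joint_map:
  assumes "g1 \<in> hom C X A1" "g2 \<in> hom C X A2"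
  obtains g A where "g \<in> hom C X A"
    "\<And>Z x x'. x \<in> hom C Z X \<Longrightarrow> x' \<in> hom C Z X \<Longrightarrow> g \<cdot> x = g \<cdot> x' \<longleftrightarrow> g1 \<cdot> x = g1 \<cdot> x' \<and> g2 \<cdot> x = g2 \<cdot> x'"
proof -
  have "A1 \<in> Obj C" "A2 \<in> Obj C" using assms Cod_Obj by (auto simp: hom_def)
  then obtain p q where pr: "is_product C A1 A2 p q" using product_exists by blast
  obtain g where g: "g \<in> hom C X (Dom C p)" "p \<cdot> g = g1" "q \<cdot> g = g2" using product_lift[OF pr assms] .
  have pq: "p \<in> Arr C" "q \<in> Arr C" "Dom C q = Dom C p"
    using product_jointly_monic[OF pr] by (auto simp: jointly_monic_def)
  have "g \<cdot> x = g \<cdot> x' \<longleftrightarrow> g1 \<cdot> x = g1 \<cdot> x' \<and> g2 \<cdot> x = g2 \<cdot> x'"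
    if x: "x \<in> hom C Z X" and x': "x' \<in> hom C Z X" for Z x x'
  proof -
    have e: "p \<cdot> (g \<cdot> x) = g1 \<cdot> x" "p \<cdot> (g \<cdot> x') = g1 \<cdot> x'" "q \<cdot> (g \<cdot> x) = g2 \<cdot> x" "q \<cdot> (g \<cdot> x') = g2 \<cdot> x'"
      using g(2,3)[THEN reassoc, of x] g(2,3)[THEN reassoc, of x'] g(1) pq x x' by (simp_all add: hom_def)
    show ?thesis
      using jointly_monicD[OF product_jointly_monic[OF pr] Comp_hom[OF x g(1)] Comp_hom[OF x' g(1)]] e
      by (metis)
  qed
  with g(1) show thesis using that by blast
qed

section \<open>Kernel pairs and consequences of 3-permutability\<close>

lemma kernel_pair_equivalence:
  assumes pb: "is_pullback C h h s1 s2"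
  shows "equivalence_rel C (Dom C h) (s1, s2)"
proof -
  note D = pullbackD[OF pb]
  let ?X = "Dom C h"
  have X: "?X \<in> Obj C" using D Dom_Obj by simp
  note j = pullback_jointly_monic[OF pb]
  have "is_relation C ?X ?X (s1, s2)"
    unfolding relation_iff[OF X X] using D j by (simp add: hom_def)
  moreover have "reflexive_rel C ?X (s1, s2)"
    unfolding reflexive_rel_def prod.case
    by (rule pullback_lift[OF pb, of "Ide C ?X" ?X "Ide C ?X"]) (use X in \<open>auto simp: hom_def arr_simps\<close>)
  moreover have "symmetric_rel C (s1, s2)"
    unfolding symmetric_rel_def prod.case
    by (rule pullback_lift[OF pb, of "s2" "Dom C s1" "s1"]) (use D in \<open>auto simp: hom_def arr_simps\<close>)
  moreover have "transitive_rel C (s1, s2)"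
  proof -
    obtain p1 p2 where pb': "is_pullback C s2 s1 p1 p2" using pullback_exists[of s2 s1] D by auto
    note D' = pullbackD[OF pb']
    obtain k where "k \<in> hom C (Dom C p1) (Dom C s1)" "s1 \<cdot> k = s1 \<cdot> p1" "s2 \<cdot> k = s2 \<cdot> p2"
    proof (rule pullback_lift[OF pb, of "s1 \<cdot> p1" "Dom C p1" "s2 \<cdot> p2"])
      show "s1 \<cdot> p1 \<in> hom C (Dom C p1) (Dom C h)" "s2 \<cdot> p2 \<in> hom C (Dom C p1) (Dom C h)"
        using D(1-8) D'(1-8) by (simp_all add: hom_def arr_simps)
      have "h \<cdot> (s1 \<cdot> p1) = h \<cdot> (s2 \<cdot> p1)" using D D'(1-8) D(9)[THEN reassoc, of p1] by (simp add: arr_simps)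
      also have "\<dots> = h \<cdot> (s1 \<cdot> p2)" using D' by simp
      also have "\<dots> = h \<cdot> (s2 \<cdot> p2)" using D D'(1-8) D(9)[THEN reassoc, of p2] by (simp add: arr_simps)
      finally show "h \<cdot> (s1 \<cdot> p1) = h \<cdot> (s2 \<cdot> p2)" .
    qed
    then show ?thesis unfolding transitive_rel_def using pb' by auto
  qed
  ultimately show ?thesis by (simp add: equivalence_rel_def)
qed

lemma kernel_pair_mem:
  assumes pb: "is_pullback C h h s1 s2" and x: "x \<in> hom C Z (Dom C h)" and y: "y \<in> hom C Z (Dom C h)"
  shows "mem s1 s2 x y \<longleftrightarrow> h \<cdot> x = h \<cdot> y"
proof
  note D = pullbackD[OF pb]
  assume "mem s1 s2 x y"
  then obtain k where k: "k \<in> hom C Z (Dom C s1)" "s1 \<cdot> k = x" "s2 \<cdot> k = y" using memE x by metis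
  then show "h \<cdot> x = h \<cdot> y"
    using D(9)[THEN reassoc, of k] D(1-8) assoc[of k s2 h] by (simp add: hom_def)
next
  assume "h \<cdot> x = h \<cdot> y"
  then obtain k where "k \<in> hom C Z (Dom C s1)" "s1 \<cdot> k = x" "s2 \<cdot> k = y" by (rule pullback_lift[OF pb x y])
  then show "mem s1 s2 x y" using pullbackD(3)[OF pb] by (intro memI)
qed

lemma rel_le_memD:
  assumes le: "rel_le C (r1, r2) (s1, s2)" and m: "mem r1 r2 x y" and x: "x \<in> hom C Z X"
    and r: "r1 \<in> Arr C" and s: "s1 \<in> Arr C" "s2 \<in> Arr C" "Dom C s2 = Dom C s1"
  shows "mem s1 s2 x y"
proof -
  obtain k where k: "k \<in> hom C Z (Dom C r1)" "r1 \<cdot> k = x" "r2 \<cdot> k = y" using memE[OF m x] .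
  show ?thesis
    using mem_restrict[OF le[unfolded rel_le_mem], of "Dom C r1" "Cod C r1" k Z] k r s by (simp add: hom_def)
qed

text \<open>With \<open>R\<close> and \<open>S\<close> the kernel pairs of \<open>g\<close> and
  \<open>h\<close>, this is the inclusion of \<open>S R S\<close> in \<open>R S R\<close> read on
  elements: a path of type \<open>S\<close>, \<open>R\<close>, \<open>S\<close> is replaced by one
  of type \<open>R\<close>, \<open>S\<close>, \<open>R\<close> with the same ends. The cover
  \<open>w\<close> comes from unfolding the two images in \<open>R S R\<close>.\<close>

lemma goursat_zigzag:
  assumes G: "goursat_category C" and g: "g \<in> hom C X A" and h: "h \<in> hom C X B"
    and x: "x0 \<in> hom C Z X" "x1 \<in> hom C Z X" "x2 \<in> hom C Z X" "x3 \<in> hom C Z X"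
    and eq: "h \<cdot> x0 = h \<cdot> x1" "g \<cdot> x1 = g \<cdot> x2" "h \<cdot> x2 = h \<cdot> x3"
  obtains W w y1 y2 where "regular_epi C w" "w \<in> hom C W Z" "y1 \<in> hom C W X" "y2 \<in> hom C W X"
    "g \<cdot> (x0 \<cdot> w) = g \<cdot> y1" "h \<cdot> y1 = h \<cdot> y2" "g \<cdot> y2 = g \<cdot> (x3 \<cdot> w)"
proof -
  have gh: "g \<in> Arr C" "h \<in> Arr C" "Dom C g = X" "Dom C h = X" using g h by (auto simp: hom_def)
  obtain r1 r2 where pr: "is_pullback C g g r1 r2" using pullback_exists gh by blast
  obtain s1 s2 where ps: "is_pullback C h h s1 s2" using pullback_exists gh by blast
  have eR: "equivalence_rel C X (r1, r2)" and eS: "equivalence_rel C X (s1, s2)"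
    using kernel_pair_equivalence[OF pr] kernel_pair_equivalence[OF ps] gh by auto
  have R: "is_relation C X X (r1, r2)" and S: "is_relation C X X (s1, s2)"
    using eR eS by (auto simp: equivalence_rel_def)
  note mR = kernel_pair_mem[OF pr, unfolded gh] and mS = kernel_pair_mem[OF ps, unfolded gh]
  obtain a1 a2 where SR: "is_composite C X X X (s1, s2) (r1, r2) (a1, a2)" using composite_exists[OF R S] .
  obtain b1 b2 where RSR: "is_composite C X X X (r1, r2) (a1, a2) (b1, b2)"
    using composite_exists[OF is_compositeD(3)[OF SR] R] .
  obtain c1 c2 where RS: "is_composite C X X X (r1, r2) (s1, s2) (c1, c2)" using composite_exists[OF S R] .
  obtain d1 d2 where SRS: "is_composite C X X X (s1, s2) (c1, c2) (d1, d2)"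
    using composite_exists[OF is_compositeD(3)[OF RS] S] .
  have "rel_eq C (b1, b2) (d1, d2)"
    using G eR eS SR RSR RS SRS unfolding goursat_category_def by blast
  then have le: "rel_le C (d1, d2) (b1, b2)" by (simp add: rel_eq_def)
  have "mem c1 c2 x0 x2"
    using composite_memI[OF RS, of x0 x1 x2 Z] mR mS x eq by blast
  then have "mem d1 d2 x0 x3"
    using composite_memI[OF SRS, of x0 x2 x3 Z] mS x eq by blast
  then have "mem b1 b2 x0 x3"
    using rel_le_memD[OF le _ x(1)] relationD[OF is_compositeD(3)[OF SRS]] relationD[OF is_compositeD(3)[OF RSR]]
    by simp
  then obtain V v y where v: "regular_epi C v" "v \<in> hom C V Z" "y \<in> hom C V X"
    "mem a1 a2 (x0 \<cdot> v) y" "mem r1 r2 y (x3 \<cdot> v)" using composite_memE[OF RSR _ x(1)] by metis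
  obtain W w y1 where w: "regular_epi C w" "w \<in> hom C W V" "y1 \<in> hom C W X"
    "mem r1 r2 ((x0 \<cdot> v) \<cdot> w) y1" "mem s1 s2 y1 (y \<cdot> w)"
    using composite_memE[OF SR v(4) Comp_hom[OF v(2) x(1)]] by metis
  note ty = x v(2,3) w(2,3) gh
  have h': "(x0 \<cdot> v) \<cdot> w \<in> hom C W X" "y \<cdot> w \<in> hom C W X" "x3 \<cdot> v \<in> hom C V X"
    using ty by (simp_all add: hom_def arr_simps)
  have e: "g \<cdot> ((x0 \<cdot> v) \<cdot> w) = g \<cdot> y1" "h \<cdot> y1 = h \<cdot> (y \<cdot> w)" "g \<cdot> y = g \<cdot> (x3 \<cdot> v)"
    using mR[OF h'(1) w(3)] mS[OF w(3) h'(2)] mR[OF v(3) h'(3)] w v by auto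
  show thesis
  proof (rule that[of "v \<cdot> w" W y1 "y \<cdot> w"])
    show "regular_epi C (v \<cdot> w)" using regular_epi_comp[OF w(1) v(1)] ty by (simp add: hom_def)
    show "v \<cdot> w \<in> hom C W Z" "y1 \<in> hom C W X" "y \<cdot> w \<in> hom C W X"
      using ty by (simp_all add: hom_def arr_simps)
    show "g \<cdot> (x0 \<cdot> (v \<cdot> w)) = g \<cdot> y1" using e(1) ty by (simp add: hom_def arr_simps)
    show "h \<cdot> y1 = h \<cdot> (y \<cdot> w)" by (rule e)
    show "g \<cdot> (y \<cdot> w) = g \<cdot> (x3 \<cdot> (v \<cdot> w))" using e(3)[THEN reassoc, of w] ty by (simp add: hom_def arr_simps)
  qed
qed

text \<open>The shifting lemma for the kernels of \<open>r\<close>, \<open>s\<close>,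
  \<open>t\<close>, with \<open>a\<close>, \<open>b\<close>, \<open>c\<close>, \<open>d\<close> as
  the corners of a rectangle. The path \<open>c\<close>, \<open>a\<close>, \<open>b\<close>,
  \<open>d\<close> runs through \<open>s\<close>, then \<open>r\<close> and \<open>t\<close>
  together, then \<open>s\<close>. Permuting it gives \<open>y1\<close> and \<open>y2\<close> with
  the same value under \<open>s\<close>, where \<open>c\<close>, \<open>y1\<close> and
  \<open>y2\<close>, \<open>d\<close> agree under both \<open>r\<close> and \<open>t\<close>. Since
  \<open>c\<close> and \<open>d\<close> agree under \<open>r\<close>, so do \<open>y1\<close> and
  \<open>y2\<close>, and \<open>imp\<close> applies to them.\<close>

lemma goursat_shifting:
  assumes G: "goursat_category C" and r: "r \<in> hom C X R" and s: "s \<in> hom C X S" and t: "t \<in> hom C X T"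
    and imp: "\<And>Z u v. u \<in> hom C Z X \<Longrightarrow> v \<in> hom C Z X \<Longrightarrow> r \<cdot> u = r \<cdot> v \<Longrightarrow> s \<cdot> u = s \<cdot> v \<Longrightarrow> t \<cdot> u = t \<cdot> v"
    and x: "a \<in> hom C Z X" "b \<in> hom C Z X" "c \<in> hom C Z X" "d \<in> hom C Z X"
    and eq: "r \<cdot> a = r \<cdot> b" "t \<cdot> a = t \<cdot> b" "s \<cdot> a = s \<cdot> c" "s \<cdot> b = s \<cdot> d" "r \<cdot> c = r \<cdot> d"
  shows "t \<cdot> c = t \<cdot> d"
proof -
  obtain g A where g: "g \<in> hom C X A" and geq:
    "\<And>Z x x'. x \<in> hom C Z X \<Longrightarrow> x' \<in> hom C Z X \<Longrightarrow> g \<cdot> x = g \<cdot> x' \<longleftrightarrow> r \<cdot> x = r \<cdot> x' \<and> t \<cdot> x = t \<cdot> x'"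
    by (rule joint_map[OF r t]) blast
  have ab: "g \<cdot> a = g \<cdot> b" using geq[OF x(1,2)] eq by simp
  obtain W w y1 y2 where w: "regular_epi C w" "w \<in> hom C W Z" "y1 \<in> hom C W X" "y2 \<in> hom C W X"
    "g \<cdot> (c \<cdot> w) = g \<cdot> y1" "s \<cdot> y1 = s \<cdot> y2" "g \<cdot> y2 = g \<cdot> (d \<cdot> w)"
    by (rule goursat_zigzag[OF G g s x(3,1,2,4) eq(3)[symmetric] ab eq(4)]) blast
  have cw: "c \<cdot> w \<in> hom C W X" and dw: "d \<cdot> w \<in> hom C W X" using Comp_hom w x by auto
  have e1: "r \<cdot> (c \<cdot> w) = r \<cdot> y1" "t \<cdot> (c \<cdot> w) = t \<cdot> y1" using geq[OF cw w(3)] w(5) by auto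
  have e2: "r \<cdot> y2 = r \<cdot> (d \<cdot> w)" "t \<cdot> y2 = t \<cdot> (d \<cdot> w)" using geq[OF w(4) dw] w(7) by auto
  have "r \<cdot> (c \<cdot> w) = r \<cdot> (d \<cdot> w)"
    using eq(5)[THEN reassoc, of w] x w(2) r by (simp add: hom_def arr_simps)
  then have "t \<cdot> y1 = t \<cdot> y2" using imp[OF w(3,4)] w(6) e1 e2 by simp
  then have e: "t \<cdot> (c \<cdot> w) = t \<cdot> (d \<cdot> w)" using e1 e2 by simp
  show ?thesis
    by (rule regular_epi_cancel[OF w(1)]) (use e x w(2) t in \<open>simp_all add: hom_def arr_simps\<close>)
qed

end

section \<open>Internal categories in terms of generalised elements\<close>

context category
begin

lemma pullback_tuple:
  assumes pb: "is_pullback C f g p q" and "a \<in> hom C Z (Dom C f)" "b \<in> hom C Z (Dom C g)" "f \<cdot> a = g \<cdot> b"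
  shows "tuple C p q a b \<in> hom C Z (Dom C p)" "p \<cdot> tuple C p q a b = a" "q \<cdot> tuple C p q a b = b"
proof -
  obtain h where h: "h \<in> hom C Z (Dom C p)" "p \<cdot> h = a" "q \<cdot> h = b" by (rule pullback_lift[OF assms])
  have "tuple C p q a b = h" by (rule tuple_eq[OF pullback_jointly_monic[OF pb] h])
  with h show "tuple C p q a b \<in> hom C Z (Dom C p)" "p \<cdot> tuple C p q a b = a" "q \<cdot> tuple C p q a b = b"
    by simp_all
qed

text \<open>A Yoneda argument: an equation between arrows is an equation between their values at all
  elements \<open>y\<close>, and the identity of \<open>Y\<close> is the generic one. The element
  \<open>z\<close> names the pair without using \<open>tuple\<close>.\<close>

lemma tuple_law_iff:
  assumes pb: "is_pullback C f g p q" and ab: "a \<in> hom C Y (Dom C f)" "b \<in> hom C Y (Dom C g)" "f \<cdot> a = g \<cdot> b"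
    and m: "m \<in> hom C (Dom C p) M" and k: "k \<in> hom C Y M"
  shows "m \<cdot> tuple C p q a b = k \<longleftrightarrow>
    (\<forall>Z. \<forall>y \<in> hom C Z Y. \<forall>z \<in> hom C Z (Dom C p). p \<cdot> z = a \<cdot> y \<and> q \<cdot> z = b \<cdot> y \<longrightarrow> m \<cdot> z = k \<cdot> y)"
    (is "?L \<longleftrightarrow> ?R")
proof
  let ?t = "tuple C p q a b"
  note t = pullback_tuple[OF pb ab] and D = pullbackD[OF pb]
  assume ?L
  show ?R
  proof (intro allI ballI impI)
    fix Z y z assume y: "y \<in> hom C Z Y" and z: "z \<in> hom C Z (Dom C p)" and eq: "p \<cdot> z = a \<cdot> y \<and> q \<cdot> z = b \<cdot> y"
    have "p \<cdot> (?t \<cdot> y) = a \<cdot> y" "q \<cdot> (?t \<cdot> y) = b \<cdot> y"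
      using t(2,3)[THEN reassoc, of y] t(1) y D(1-8) by (simp_all add: hom_def)
    then have "z = ?t \<cdot> y"
      using jointly_monicD[OF pullback_jointly_monic[OF pb] z Comp_hom[OF y t(1)]] eq by simp
    then show "m \<cdot> z = k \<cdot> y"
      using \<open>?L\<close>[THEN reassoc, of y] m t(1) y by (simp add: hom_def)
  qed
next
  note t = pullback_tuple[OF pb ab]
  assume R: ?R
  have Y: "Y \<in> Obj C" using ab Dom_Obj by (auto simp: hom_def)
  show ?L
    using R[rule_format, OF Ide_hom[OF Y] t(1)] t(2,3) Comp_Ide[OF ab(1)] Comp_Ide[OF ab(2)] Comp_Ide[OF k]
    by simp
qed

end

context regular_cat
begin

lemma reflexive_graphD:
  assumes "is_reflexive_graph C G"
  shows "X1 G \<in> Obj C" "X0 G \<in> Obj C" "src G \<in> Arr C" "tgt G \<in> Arr C" "ins G \<in> Arr C"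
    "Dom C (src G) = X1 G" "Dom C (tgt G) = X1 G" "Dom C (ins G) = X0 G"
    "Cod C (src G) = X0 G" "Cod C (tgt G) = X0 G" "Cod C (ins G) = X1 G"
    "src G \<cdot> ins G = Ide C (X0 G)" "tgt G \<cdot> ins G = Ide C (X0 G)"
  using assms by (auto simp: is_reflexive_graph_def hom_def)

text \<open>In the associativity clause a triple \<open>(x, y, z)\<close> is given by two pairs that
  share an arrow, \<open>u = (x, y)\<close> and \<open>v = (y, z)\<close>; then
  \<open>u' = (x, y z)\<close> and \<open>v' = (x y, z)\<close>.\<close>

lemma is_internal_category_iff:
  "is_internal_category C G p1 p2 m \<longleftrightarrow>
     is_reflexive_graph C G \<and> is_pullback C (tgt G) (src G) p1 p2 \<and>
     m \<in> hom C (Dom C p1) (X1 G) \<and> src G \<cdot> m = src G \<cdot> p1 \<and> tgt G \<cdot> m = tgt G \<cdot> p2 \<and>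
     (\<forall>Z. \<forall>y \<in> hom C Z (X1 G). \<forall>z \<in> hom C Z (Dom C p1).
        p1 \<cdot> z = ins G \<cdot> (src G \<cdot> y) \<and> p2 \<cdot> z = y \<longrightarrow> m \<cdot> z = y) \<and>
     (\<forall>Z. \<forall>y \<in> hom C Z (X1 G). \<forall>z \<in> hom C Z (Dom C p1).
        p1 \<cdot> z = y \<and> p2 \<cdot> z = ins G \<cdot> (tgt G \<cdot> y) \<longrightarrow> m \<cdot> z = y) \<and>
     (\<forall>Z. \<forall>u \<in> hom C Z (Dom C p1). \<forall>v \<in> hom C Z (Dom C p1).
        \<forall>u' \<in> hom C Z (Dom C p1). \<forall>v' \<in> hom C Z (Dom C p1).
        p2 \<cdot> u = p1 \<cdot> v \<and> p1 \<cdot> u' = p1 \<cdot> u \<and> p2 \<cdot> u' = m \<cdot> v \<and> p1 \<cdot> v' = m \<cdot> u \<and> p2 \<cdot> v' = p2 \<cdot> v \<longrightarrow>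
        m \<cdot> u' = m \<cdot> v')"
    (is "?L \<longleftrightarrow> ?G \<and> ?P \<and> ?M \<and> ?S \<and> ?T \<and> ?UL \<and> ?UR \<and> ?A")
proof -
  have ul: "m \<cdot> tuple C p1 p2 (ins G \<cdot> src G) (Ide C (X1 G)) = Ide C (X1 G) \<longleftrightarrow> ?UL"
   and ur: "m \<cdot> tuple C p1 p2 (Ide C (X1 G)) (ins G \<cdot> tgt G) = Ide C (X1 G) \<longleftrightarrow> ?UR"
   and ass: "(\<forall>q1 q2. is_pullback C p2 p1 q1 q2 \<longrightarrow>
        m \<cdot> tuple C p1 p2 (p1 \<cdot> q1) (m \<cdot> q2) = m \<cdot> tuple C p1 p2 (m \<cdot> q1) (p2 \<cdot> q2)) \<longleftrightarrow> ?A"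
   if G: ?G and pb: ?P and M: ?M and S: ?S and T: ?T
  proof -
    note g = reflexive_graphD[OF G] and D = pullbackD[OF pb]
    have m: "m \<in> Arr C" "Dom C m = Dom C p1" "Cod C m = X1 G" using M by (auto simp: hom_def)
    have si: "src G \<cdot> (ins G \<cdot> f) = f" "tgt G \<cdot> (ins G \<cdot> f) = f" if "f \<in> Arr C" "Cod C f = X0 G" for f
      using g(1-11) g(12,13)[THEN reassoc, of f] that by (simp_all add: arr_simps)
    have "m \<cdot> tuple C p1 p2 (ins G \<cdot> src G) (Ide C (X1 G)) = Ide C (X1 G) \<longleftrightarrow>
      (\<forall>Z. \<forall>y \<in> hom C Z (X1 G). \<forall>z \<in> hom C Z (Dom C p1).
        p1 \<cdot> z = ins G \<cdot> src G \<cdot> y \<and> p2 \<cdot> z = Ide C (X1 G) \<cdot> y \<longrightarrow> m \<cdot> z = Ide C (X1 G) \<cdot> y)"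
      by (rule tuple_law_iff[OF pb, of _ _ _ _ "X1 G"]) (use g(1-11) m in \<open>simp_all add: hom_def arr_simps si\<close>)
    also have "\<dots> \<longleftrightarrow> ?UL"
      using g(1-11) by (simp add: hom_def arr_simps)
    finally show "m \<cdot> tuple C p1 p2 (ins G \<cdot> src G) (Ide C (X1 G)) = Ide C (X1 G) \<longleftrightarrow> ?UL" .
    have "m \<cdot> tuple C p1 p2 (Ide C (X1 G)) (ins G \<cdot> tgt G) = Ide C (X1 G) \<longleftrightarrow>
      (\<forall>Z. \<forall>y \<in> hom C Z (X1 G). \<forall>z \<in> hom C Z (Dom C p1).
        p1 \<cdot> z = Ide C (X1 G) \<cdot> y \<and> p2 \<cdot> z = ins G \<cdot> tgt G \<cdot> y \<longrightarrow> m \<cdot> z = Ide C (X1 G) \<cdot> y)"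
      by (rule tuple_law_iff[OF pb, of _ _ _ _ "X1 G"]) (use g(1-11) m in \<open>simp_all add: hom_def arr_simps si\<close>)
    also have "\<dots> \<longleftrightarrow> ?UR"
      using g(1-11) by (simp add: hom_def arr_simps)
    finally show "m \<cdot> tuple C p1 p2 (Ide C (X1 G)) (ins G \<cdot> tgt G) = Ide C (X1 G) \<longleftrightarrow> ?UR" .
    show "(\<forall>q1 q2. is_pullback C p2 p1 q1 q2 \<longrightarrow>
        m \<cdot> tuple C p1 p2 (p1 \<cdot> q1) (m \<cdot> q2) = m \<cdot> tuple C p1 p2 (m \<cdot> q1) (p2 \<cdot> q2)) \<longleftrightarrow> ?A"
    proof -
      have Dg: "Cod C p1 = X1 G" "Cod C p2 = X1 G" using D g by simp_all
      \<comment> \<open>The pairs entering the associativity law are composable, so that their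
        tuples exist.\<close>
      have tup: "p1 \<cdot> q1 \<in> hom C (Dom C q1) (X1 G) \<and> m \<cdot> q2 \<in> hom C (Dom C q1) (X1 G) \<and>
          m \<cdot> q1 \<in> hom C (Dom C q1) (X1 G) \<and> p2 \<cdot> q2 \<in> hom C (Dom C q1) (X1 G) \<and>
          tgt G \<cdot> (p1 \<cdot> q1) = src G \<cdot> (m \<cdot> q2) \<and> tgt G \<cdot> (m \<cdot> q1) = src G \<cdot> (p2 \<cdot> q2)"
        if pq: "is_pullback C p2 p1 q1 q2" for q1 q2
      proof -
        note E = pullbackD[OF pq]
        have "tgt G \<cdot> (p1 \<cdot> q1) = src G \<cdot> (p2 \<cdot> q1)" "tgt G \<cdot> (p1 \<cdot> q2) = src G \<cdot> (p2 \<cdot> q2)"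
          using D(1-8) E(1-8) g(1-11) D(9)[THEN reassoc, of q1] D(9)[THEN reassoc, of q2] by (simp_all add: arr_simps)
        moreover have "src G \<cdot> (m \<cdot> q2) = src G \<cdot> (p1 \<cdot> q2)" "tgt G \<cdot> (m \<cdot> q1) = tgt G \<cdot> (p2 \<cdot> q1)"
          using D(1-8) E(1-8) g(1-11) m S[THEN reassoc, of q2] T[THEN reassoc, of q1] by (simp_all add: arr_simps)
        ultimately show ?thesis using D(1-8) E g(1-11) m Dg by (simp add: hom_def arr_simps)
      qed
      show ?thesis
      proof
        assume A: ?A
        show "\<forall>q1 q2. is_pullback C p2 p1 q1 q2 \<longrightarrow>
          m \<cdot> tuple C p1 p2 (p1 \<cdot> q1) (m \<cdot> q2) = m \<cdot> tuple C p1 p2 (m \<cdot> q1) (p2 \<cdot> q2)"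
        proof (intro allI impI)
          fix q1 q2 assume pq: "is_pullback C p2 p1 q1 q2"
          note E = pullbackD[OF pq] and tt = tup[OF pq]
          have t1: "p1 \<cdot> q1 \<in> hom C (Dom C q1) (Dom C (tgt G))" "m \<cdot> q2 \<in> hom C (Dom C q1) (Dom C (src G))"
            "tgt G \<cdot> (p1 \<cdot> q1) = src G \<cdot> (m \<cdot> q2)"
           and t2: "m \<cdot> q1 \<in> hom C (Dom C q1) (Dom C (tgt G))" "p2 \<cdot> q2 \<in> hom C (Dom C q1) (Dom C (src G))"
            "tgt G \<cdot> (m \<cdot> q1) = src G \<cdot> (p2 \<cdot> q2)"
            using tt g(6,7) by simp_all
          have q: "q1 \<in> hom C (Dom C q1) (Dom C p1)" "q2 \<in> hom C (Dom C q1) (Dom C p1)"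
            using E D by (simp_all add: hom_def)
          show "m \<cdot> tuple C p1 p2 (p1 \<cdot> q1) (m \<cdot> q2) = m \<cdot> tuple C p1 p2 (m \<cdot> q1) (p2 \<cdot> q2)"
            using A[rule_format, OF q pullback_tuple(1)[OF pb t1] pullback_tuple(1)[OF pb t2]]
              pullback_tuple(2,3)[OF pb t1] pullback_tuple(2,3)[OF pb t2] E(9) by simp
        qed
      next
        assume A: "\<forall>q1 q2. is_pullback C p2 p1 q1 q2 \<longrightarrow>
          m \<cdot> tuple C p1 p2 (p1 \<cdot> q1) (m \<cdot> q2) = m \<cdot> tuple C p1 p2 (m \<cdot> q1) (p2 \<cdot> q2)"
        \<comment> \<open>One pullback of triples suffices for this direction, since any
          \<open>u\<close> and \<open>v\<close> that share an arrow factor through it.\<close>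
        obtain q1 q2 where pq: "is_pullback C p2 p1 q1 q2" using pullback_exists[of p2 p1] D Dg by auto
        note E = pullbackD[OF pq] and tt = tup[OF pq]
        have t1: "p1 \<cdot> q1 \<in> hom C (Dom C q1) (Dom C (tgt G))" "m \<cdot> q2 \<in> hom C (Dom C q1) (Dom C (src G))"
            "tgt G \<cdot> (p1 \<cdot> q1) = src G \<cdot> (m \<cdot> q2)"
           and t2: "m \<cdot> q1 \<in> hom C (Dom C q1) (Dom C (tgt G))" "p2 \<cdot> q2 \<in> hom C (Dom C q1) (Dom C (src G))"
            "tgt G \<cdot> (m \<cdot> q1) = src G \<cdot> (p2 \<cdot> q2)"
            using tt g(6,7) by simp_all
        define k where "k = m \<cdot> tuple C p1 p2 (p1 \<cdot> q1) (m \<cdot> q2)"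
        have k: "k \<in> hom C (Dom C q1) (X1 G)"
          unfolding k_def using Comp_hom[OF pullback_tuple(1)[OF pb t1] M] .
        have k': "m \<cdot> tuple C p1 p2 (m \<cdot> q1) (p2 \<cdot> q2) = k" using A pq k_def by simp
        note L1 = tuple_law_iff[OF pb t1 M k, THEN iffD1, OF k_def[symmetric], rule_format]
          and L2 = tuple_law_iff[OF pb t2 M k, THEN iffD1, OF k', rule_format]
        show ?A
        proof (intro allI ballI impI)
          fix Z u v u' v'
          assume h: "u \<in> hom C Z (Dom C p1)" "v \<in> hom C Z (Dom C p1)" "u' \<in> hom C Z (Dom C p1)" "v' \<in> hom C Z (Dom C p1)"
            and e: "p2 \<cdot> u = p1 \<cdot> v \<and> p1 \<cdot> u' = p1 \<cdot> u \<and> p2 \<cdot> u' = m \<cdot> v \<and> p1 \<cdot> v' = m \<cdot> u \<and> p2 \<cdot> v' = p2 \<cdot> v"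
          obtain y where y: "y \<in> hom C Z (Dom C q1)" "q1 \<cdot> y = u" "q2 \<cdot> y = v"
            by (rule pullback_lift[OF pq, of u Z v]) (use h e D in simp_all)
          have a: "p1 \<cdot> q1 \<cdot> y = p1 \<cdot> u" "m \<cdot> q2 \<cdot> y = m \<cdot> v" "m \<cdot> q1 \<cdot> y = m \<cdot> u" "p2 \<cdot> q2 \<cdot> y = p2 \<cdot> v"
            using D(1-8) E(1-8) m y by (simp_all add: hom_def arr_simps)
          have "m \<cdot> u' = k \<cdot> y" by (rule L1[OF y(1) h(3)]) (use e a in simp)
          moreover have "m \<cdot> v' = k \<cdot> y" by (rule L2[OF y(1) h(4)]) (use e a in simp)
          ultimately show "m \<cdot> u' = m \<cdot> v'" by simp
        qed
      qed
    qed
  qed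
  show ?thesis
    unfolding is_internal_category_def using ul ur ass by (intro iffI; elim conjE; intro conjI; assumption?; blast)
qed

lemma is_internal_groupoid_iff:
  "is_internal_groupoid C G p1 p2 m i \<longleftrightarrow>
     is_internal_category C G p1 p2 m \<and> i \<in> hom C (X1 G) (X1 G) \<and>
     src G \<cdot> i = tgt G \<and> tgt G \<cdot> i = src G \<and>
     (\<forall>Z. \<forall>y \<in> hom C Z (X1 G). \<forall>z \<in> hom C Z (Dom C p1).
        p1 \<cdot> z = i \<cdot> y \<and> p2 \<cdot> z = y \<longrightarrow> m \<cdot> z = ins G \<cdot> (tgt G \<cdot> y)) \<and>
     (\<forall>Z. \<forall>y \<in> hom C Z (X1 G). \<forall>z \<in> hom C Z (Dom C p1).
        p1 \<cdot> z = y \<and> p2 \<cdot> z = i \<cdot> y \<longrightarrow> m \<cdot> z = ins G \<cdot> (src G \<cdot> y))"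
    (is "?L \<longleftrightarrow> ?C \<and> ?I \<and> ?S \<and> ?T \<and> ?IL \<and> ?IR")
proof -
  have il: "m \<cdot> tuple C p1 p2 i (Ide C (X1 G)) = ins G \<cdot> tgt G \<longleftrightarrow> ?IL"
   and ir: "m \<cdot> tuple C p1 p2 (Ide C (X1 G)) i = ins G \<cdot> src G \<longleftrightarrow> ?IR"
   if c: ?C and I: ?I and S: ?S and T: ?T
  proof -
    have G: "is_reflexive_graph C G" and pb: "is_pullback C (tgt G) (src G) p1 p2"
      and M: "m \<in> hom C (Dom C p1) (X1 G)"
      using c by (simp_all add: is_internal_category_def)
    note g = reflexive_graphD[OF G]
    have "m \<cdot> tuple C p1 p2 i (Ide C (X1 G)) = ins G \<cdot> tgt G \<longleftrightarrow>
      (\<forall>Z. \<forall>y \<in> hom C Z (X1 G). \<forall>z \<in> hom C Z (Dom C p1).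
        p1 \<cdot> z = i \<cdot> y \<and> p2 \<cdot> z = Ide C (X1 G) \<cdot> y \<longrightarrow> m \<cdot> z = ins G \<cdot> tgt G \<cdot> y)"
      by (rule tuple_law_iff[OF pb, of _ _ _ _ "X1 G"]) (use g(1-11) M I S T in \<open>simp_all add: hom_def arr_simps\<close>)
    also have "\<dots> \<longleftrightarrow> ?IL"
      using g(1-11) by (simp add: hom_def arr_simps)
    finally show "m \<cdot> tuple C p1 p2 i (Ide C (X1 G)) = ins G \<cdot> tgt G \<longleftrightarrow> ?IL" .
    have "m \<cdot> tuple C p1 p2 (Ide C (X1 G)) i = ins G \<cdot> src G \<longleftrightarrow>
      (\<forall>Z. \<forall>y \<in> hom C Z (X1 G). \<forall>z \<in> hom C Z (Dom C p1).
        p1 \<cdot> z = Ide C (X1 G) \<cdot> y \<and> p2 \<cdot> z = i \<cdot> y \<longrightarrow> m \<cdot> z = ins G \<cdot> src G \<cdot> y)"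
      by (rule tuple_law_iff[OF pb, of _ _ _ _ "X1 G"]) (use g(1-11) M I S T in \<open>simp_all add: hom_def arr_simps\<close>)
    also have "\<dots> \<longleftrightarrow> ?IR"
      using g(1-11) by (simp add: hom_def arr_simps)
    finally show "m \<cdot> tuple C p1 p2 (Ide C (X1 G)) i = ins G \<cdot> src G \<longleftrightarrow> ?IR" .
  qed
  show ?thesis
    unfolding is_internal_groupoid_def using il ir by blast
qed

end

section \<open>Quotients of internal categories in Goursat categories\<close>

context regular_cat
begin

text \<open>The map induced on pullbacks is locally surjective. The sections \<open>s\<close>,
  \<open>t\<close> play the role of units: they turn a point of \<open>B\<close> into an element of
  \<open>A\<close> or \<open>D\<close> over it, compatibly with the quotient maps. The lemma serves
  composable pairs and, with pairs in place of \<open>A\<close>, composable triples.\<close>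

lemma goursat_pullback_lift:
  assumes G: "goursat_category C"
    and up: "\<alpha> \<in> hom C A B" "s \<in> hom C B A" "\<alpha> \<cdot> s = Ide C B" "\<gamma> \<in> hom C D B" "t \<in> hom C B D" "\<gamma> \<cdot> t = Ide C B"
    and down: "\<alpha>' \<in> hom C A' B'" "s' \<in> hom C B' A'" "\<gamma>' \<in> hom C D' B'" "t' \<in> hom C B' D'"
    and f: "fa \<in> hom C A A'" "fb \<in> hom C B B'" "fc \<in> hom C D D'" "regular_epi C fa" "regular_epi C fc"
    and sq: "\<alpha>' \<cdot> fa = fb \<cdot> \<alpha>" "\<gamma>' \<cdot> fc = fb \<cdot> \<gamma>" "fa \<cdot> s = s' \<cdot> fb" "fc \<cdot> t = t' \<cdot> fb"
    and pb: "is_pullback C \<alpha> \<gamma> p1 p2"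
    and x: "a' \<in> hom C Z A'" "c' \<in> hom C Z D'" "\<alpha>' \<cdot> a' = \<gamma>' \<cdot> c'"
  obtains W w z where "regular_epi C w" "w \<in> hom C W Z" "z \<in> hom C W (Dom C p1)"
    "fa \<cdot> (p1 \<cdot> z) = a' \<cdot> w" "fc \<cdot> (p2 \<cdot> z) = c' \<cdot> w"
proof -
  note D = pullbackD[OF pb]
  obtain V v a0 where v: "regular_epi C v" "v \<in> hom C V Z" "a0 \<in> hom C V A" "fa \<cdot> a0 = a' \<cdot> v"
    using regular_epi_lift[OF f(4), of a' Z] x f(1) by (auto simp: hom_def)
  obtain W w c where w: "regular_epi C w" "w \<in> hom C W V" "c \<in> hom C W D" "fc \<cdot> c = (c' \<cdot> v) \<cdot> w"
    using regular_epi_lift[OF f(5), of "c' \<cdot> v" V] Comp_hom[OF v(2) x(2)] f(3) by (auto simp: hom_def)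
  define a where "a = a0 \<cdot> w"
  have B: "B \<in> Obj C" using up Cod_Obj by (auto simp: hom_def)
  note ty = up(1,2,4,5) down f(1-3) D(1-8) B x(1,2) v(2,3) w(2,3)
  have a: "a \<in> hom C W A" using ty by (simp add: a_def hom_def arr_simps)
  have fca: "fa \<cdot> a = a' \<cdot> (v \<cdot> w)" "fc \<cdot> c = c' \<cdot> (v \<cdot> w)"
    using ty v(4)[THEN reassoc, of w] w(4) by (simp_all add: a_def hom_def arr_simps)
  have el: "\<alpha> \<cdot> (s \<cdot> u) = u" "\<gamma> \<cdot> (t \<cdot> u) = u" "fa \<cdot> (s \<cdot> u) = s' \<cdot> (fb \<cdot> u)" "fc \<cdot> (t \<cdot> u) = t' \<cdot> (fb \<cdot> u)"
    if "u \<in> Arr C" "Cod C u = B" for u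
    using ty that up(3,6)[THEN reassoc, of u] sq(3,4)[THEN reassoc, of u] by (simp_all add: hom_def arr_simps)
  \<comment> \<open>The lifts \<open>a\<close> and \<open>c\<close> were chosen independently, so
    their images in \<open>B\<close> agree only under \<open>fb\<close>. The zigzag below repairs
    this.\<close>
  have fb: "fb \<cdot> (\<alpha> \<cdot> a) = fb \<cdot> (\<gamma> \<cdot> c)"
  proof -
    have "fb \<cdot> (\<alpha> \<cdot> a) = \<alpha>' \<cdot> (fa \<cdot> a)" using sq(1)[THEN reassoc, of a] ty a by (simp add: hom_def arr_simps)
    also have "\<dots> = \<gamma>' \<cdot> (c' \<cdot> (v \<cdot> w))"
      using x(3)[THEN reassoc, of "v \<cdot> w"] ty by (simp add: fca hom_def arr_simps)
    also have "\<dots> = fb \<cdot> (\<gamma> \<cdot> c)"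
      using sq(2)[THEN reassoc, of c] ty by (simp add: fca[symmetric] hom_def arr_simps)
    finally show ?thesis .
  qed
  note ty' = ty a
  have pr: "\<exists>u \<in> hom C W (Dom C p1). p1 \<cdot> u = k \<and> p2 \<cdot> u = l"
    if kl: "k \<in> hom C W A" "l \<in> hom C W D" "\<alpha> \<cdot> k = \<gamma> \<cdot> l" for k l
  proof -
    have "k \<in> hom C W (Dom C \<alpha>)" "l \<in> hom C W (Dom C \<gamma>)" using kl up by (auto simp: hom_def)
    from pullback_lift[OF pb this kl(3)] show ?thesis by blast
  qed
  \<comment> \<open>The path of pairs is \<open>(a, 1)\<close>, \<open>(1, 1)\<close>,
    \<open>(1, 1)\<close>, \<open>(1, c)\<close>, where the units lie over
    \<open>\<alpha> \<cdot> a\<close> in the first two and over \<open>\<gamma> \<cdot> c\<close> in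
    the last two. Outer steps keep the point of \<open>B\<close>; by \<open>fb\<close>, the middle
    step keeps the image in the quotient.\<close>
  obtain u0 where u0: "u0 \<in> hom C W (Dom C p1)" "p1 \<cdot> u0 = a" "p2 \<cdot> u0 = t \<cdot> (\<alpha> \<cdot> a)"
    using pr[of a "t \<cdot> (\<alpha> \<cdot> a)"] ty' by (auto simp: hom_def arr_simps el)
  obtain u1 where u1: "u1 \<in> hom C W (Dom C p1)" "p1 \<cdot> u1 = s \<cdot> (\<alpha> \<cdot> a)" "p2 \<cdot> u1 = t \<cdot> (\<alpha> \<cdot> a)"
    using pr[of "s \<cdot> (\<alpha> \<cdot> a)" "t \<cdot> (\<alpha> \<cdot> a)"] ty' by (auto simp: hom_def arr_simps el)
  obtain u2 where u2: "u2 \<in> hom C W (Dom C p1)" "p1 \<cdot> u2 = s \<cdot> (\<gamma> \<cdot> c)" "p2 \<cdot> u2 = t \<cdot> (\<gamma> \<cdot> c)"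
    using pr[of "s \<cdot> (\<gamma> \<cdot> c)" "t \<cdot> (\<gamma> \<cdot> c)"] ty' by (auto simp: hom_def arr_simps el)
  obtain u3 where u3: "u3 \<in> hom C W (Dom C p1)" "p1 \<cdot> u3 = s \<cdot> (\<gamma> \<cdot> c)" "p2 \<cdot> u3 = c"
    using pr[of "s \<cdot> (\<gamma> \<cdot> c)" "c"] ty' by (auto simp: hom_def arr_simps el)
  have h: "\<alpha> \<cdot> p1 \<in> hom C (Dom C p1) B" and g12: "fa \<cdot> p1 \<in> hom C (Dom C p1) A'" "fc \<cdot> p2 \<in> hom C (Dom C p1) D'"
    using ty by (simp_all add: hom_def arr_simps)
  obtain g Q where g: "g \<in> hom C (Dom C p1) Q" and geq:
    "\<And>Z x x'. x \<in> hom C Z (Dom C p1) \<Longrightarrow> x' \<in> hom C Z (Dom C p1) \<Longrightarrow>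
      g \<cdot> x = g \<cdot> x' \<longleftrightarrow> (fa \<cdot> p1) \<cdot> x = (fa \<cdot> p1) \<cdot> x' \<and> (fc \<cdot> p2) \<cdot> x = (fc \<cdot> p2) \<cdot> x'"
    by (rule joint_map[OF g12]) blast
  have ap: "\<alpha> \<cdot> p1 \<cdot> u = \<alpha> \<cdot> (p1 \<cdot> u)" "fa \<cdot> p1 \<cdot> u = fa \<cdot> (p1 \<cdot> u)" "fc \<cdot> p2 \<cdot> u = fc \<cdot> (p2 \<cdot> u)"
    if "u \<in> hom C Y (Dom C p1)" for u Y
    using that ty by (simp_all add: hom_def arr_simps)
  have e1: "\<alpha> \<cdot> p1 \<cdot> u0 = \<alpha> \<cdot> p1 \<cdot> u1"
    using ty' el[of "\<alpha> \<cdot> a"] by (simp add: ap[OF u0(1)] ap[OF u1(1)] u0 u1 hom_def arr_simps)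
  have e3: "\<alpha> \<cdot> p1 \<cdot> u2 = \<alpha> \<cdot> p1 \<cdot> u3"
    by (simp add: ap[OF u2(1)] ap[OF u3(1)] u2 u3)
  have e2: "g \<cdot> u1 = g \<cdot> u2"
    unfolding geq[OF u1(1) u2(1)]
    using ty' el[of "\<alpha> \<cdot> a"] el[of "\<gamma> \<cdot> c"] fb by (simp add: ap[OF u1(1)] ap[OF u2(1)] u1 u2 hom_def arr_simps)
  obtain W' w' y1 y2 where y: "regular_epi C w'" "w' \<in> hom C W' W" "y1 \<in> hom C W' (Dom C p1)" "y2 \<in> hom C W' (Dom C p1)"
    "g \<cdot> (u0 \<cdot> w') = g \<cdot> y1" "\<alpha> \<cdot> p1 \<cdot> y1 = \<alpha> \<cdot> p1 \<cdot> y2" "g \<cdot> y2 = g \<cdot> (u3 \<cdot> w')"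
    by (rule goursat_zigzag[OF G g h u0(1) u1(1) u2(1) u3(1) e1 e2 e3]) blast
  have uw: "u0 \<cdot> w' \<in> hom C W' (Dom C p1)" "u3 \<cdot> w' \<in> hom C W' (Dom C p1)" using Comp_hom y(2) u0(1) u3(1) by auto
  have y1: "fa \<cdot> (p1 \<cdot> y1) = a' \<cdot> (v \<cdot> (w \<cdot> w'))"
  proof -
    have "fa \<cdot> (p1 \<cdot> y1) = fa \<cdot> (p1 \<cdot> (u0 \<cdot> w'))" using y(5) geq[OF uw(1) y(3)] ap[OF uw(1)] ap[OF y(3)] by simp
    also have "p1 \<cdot> (u0 \<cdot> w') = a \<cdot> w'" using u0(2)[THEN reassoc, of w'] u0(1) y(2) ty by (simp add: hom_def)
    also have "fa \<cdot> (a \<cdot> w') = a' \<cdot> (v \<cdot> (w \<cdot> w'))"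
      using fca(1)[THEN reassoc, of w'] y(2) ty' by (simp add: hom_def arr_simps)
    finally show ?thesis .
  qed
  have y2: "fc \<cdot> (p2 \<cdot> y2) = c' \<cdot> (v \<cdot> (w \<cdot> w'))"
  proof -
    have "fc \<cdot> (p2 \<cdot> y2) = fc \<cdot> (p2 \<cdot> (u3 \<cdot> w'))" using y(7) geq[OF y(4) uw(2)] ap[OF uw(2)] ap[OF y(4)] by simp
    also have "p2 \<cdot> (u3 \<cdot> w') = c \<cdot> w'" using u3(3)[THEN reassoc, of w'] u3(1) y(2) ty by (simp add: hom_def)
    also have "fc \<cdot> (c \<cdot> w') = c' \<cdot> (v \<cdot> (w \<cdot> w'))"
      using fca(2)[THEN reassoc, of w'] y(2) ty' by (simp add: hom_def arr_simps)
    finally show ?thesis .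
  qed
  \<comment> \<open>The pair \<open>y1\<close> has the right first component and \<open>y2\<close>
    the right second one. They lie over the same point of \<open>B\<close>, so these two components
    form an element of the pullback.\<close>
  obtain z where z: "z \<in> hom C W' (Dom C p1)" "p1 \<cdot> z = p1 \<cdot> y1" "p2 \<cdot> z = p2 \<cdot> y2"
  proof (rule pullback_lift[OF pb, of "p1 \<cdot> y1" W' "p2 \<cdot> y2"])
    show "p1 \<cdot> y1 \<in> hom C W' (Dom C \<alpha>)" "p2 \<cdot> y2 \<in> hom C W' (Dom C \<gamma>)"
      using y(3,4) ty by (simp_all add: hom_def arr_simps)
    show "\<alpha> \<cdot> (p1 \<cdot> y1) = \<gamma> \<cdot> (p2 \<cdot> y2)"
      using y(6) ap(1)[OF y(3)] ap(1)[OF y(4)] D(9)[THEN reassoc, of y2] y(4) D(1-8) by (simp add: hom_def arr_simps)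
  qed
  have "regular_epi C (w \<cdot> w')" using regular_epi_comp[OF y(1) w(1)] y(2) w(2) by (simp add: hom_def)
  then have "regular_epi C (v \<cdot> (w \<cdot> w'))"
    using regular_epi_comp[OF _ v(1), of "w \<cdot> w'"] y(2) w(2) v(2) by (simp add: hom_def arr_simps)
  moreover have "v \<cdot> (w \<cdot> w') \<in> hom C W' Z" using y(2) w(2) v(2) by (simp add: hom_def arr_simps)
  ultimately show thesis using that z y1 y2 by metis
qed

end

text \<open>The quotient is recorded by its two components, since regular epimorphisms of reflexive
  graphs are exactly the componentwise ones, as shown further below.\<close>

locale graph_quotient = regular_cat +
  fixes G H f0 f1 p1 p2 m
  assumes goursat: "goursat_category C"
    and cat: "is_internal_category C G p1 p2 m"
    and H: "is_reflexive_graph C H"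
    and f0: "regular_epi C f0" "f0 \<in> hom C (X0 G) (X0 H)"
    and f1: "regular_epi C f1" "f1 \<in> hom C (X1 G) (X1 H)"
    and f_src: "src H \<cdot> f1 = f0 \<cdot> src G"
    and f_tgt: "tgt H \<cdot> f1 = f0 \<cdot> tgt G"
    and f_ins: "f1 \<cdot> ins G = ins H \<cdot> f0"
begin

lemma G: "is_reflexive_graph C G" and pb: "is_pullback C (tgt G) (src G) p1 p2"
  and m_hom: "m \<in> hom C (Dom C p1) (X1 G)" and m_src: "src G \<cdot> m = src G \<cdot> p1" and m_tgt: "tgt G \<cdot> m = tgt G \<cdot> p2"
  using cat by (simp_all add: is_internal_category_def)

lemma unit_left: "y \<in> hom C Z (X1 G) \<Longrightarrow> z \<in> hom C Z (Dom C p1) \<Longrightarrow> p1 \<cdot> z = ins G \<cdot> (src G \<cdot> y) \<Longrightarrow> p2 \<cdot> z = y \<Longrightarrow> m \<cdot> z = y"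
  and unit_right: "y \<in> hom C Z (X1 G) \<Longrightarrow> z \<in> hom C Z (Dom C p1) \<Longrightarrow> p1 \<cdot> z = y \<Longrightarrow> p2 \<cdot> z = ins G \<cdot> (tgt G \<cdot> y) \<Longrightarrow> m \<cdot> z = y"
  and mult_assoc: "u \<in> hom C Z (Dom C p1) \<Longrightarrow> v \<in> hom C Z (Dom C p1) \<Longrightarrow> u' \<in> hom C Z (Dom C p1) \<Longrightarrow> v' \<in> hom C Z (Dom C p1) \<Longrightarrow>
     p2 \<cdot> u = p1 \<cdot> v \<Longrightarrow> p1 \<cdot> u' = p1 \<cdot> u \<Longrightarrow> p2 \<cdot> u' = m \<cdot> v \<Longrightarrow> p1 \<cdot> v' = m \<cdot> u \<Longrightarrow> p2 \<cdot> v' = p2 \<cdot> v \<Longrightarrow>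
        m \<cdot> u' = m \<cdot> v'"
  using cat unfolding is_internal_category_iff by blast+

lemma f_ty: "f0 \<in> Arr C" "Dom C f0 = X0 G" "Cod C f0 = X0 H" "f1 \<in> Arr C" "Dom C f1 = X1 G" "Cod C f1 = X1 H"
  using f0 f1 by (auto simp: hom_def)

lemma p_ty: "p1 \<in> Arr C" "p2 \<in> Arr C" "Cod C p1 = X1 G" "Cod C p2 = X1 G" "Dom C p2 = Dom C p1"
  "m \<in> Arr C" "Dom C m = Dom C p1" "Cod C m = X1 G"
  using pullbackD[OF pb] reflexive_graphD[OF G] m_hom by (auto simp: hom_def)

lemmas ty = reflexive_graphD(1-11)[OF G] reflexive_graphD(1-11)[OF H] f_ty p_ty

lemma mult_elt:
  assumes "z \<in> Arr C" "Cod C z = Dom C p1"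
  shows "tgt G \<cdot> (p1 \<cdot> z) = src G \<cdot> (p2 \<cdot> z)" "src G \<cdot> (m \<cdot> z) = src G \<cdot> (p1 \<cdot> z)" "tgt G \<cdot> (m \<cdot> z) = tgt G \<cdot> (p2 \<cdot> z)"
  using pullbackD(9)[OF pb, THEN reassoc, of z] m_src[THEN reassoc, of z] m_tgt[THEN reassoc, of z] assms ty
  by (simp_all add: arr_simps)

lemma graph_elt:
  assumes "x \<in> Arr C" "Cod C x = X0 G"
  shows "src G \<cdot> (ins G \<cdot> x) = x" "tgt G \<cdot> (ins G \<cdot> x) = x" "f1 \<cdot> (ins G \<cdot> x) = ins H \<cdot> (f0 \<cdot> x)"
  using reflexive_graphD(12,13)[OF G, THEN reassoc, of x] f_ins[THEN reassoc, of x] assms ty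
  by (simp_all add: arr_simps)

lemma map_elt:
  assumes "x \<in> Arr C" "Cod C x = X1 G"
  shows "src H \<cdot> (f1 \<cdot> x) = f0 \<cdot> (src G \<cdot> x)" "tgt H \<cdot> (f1 \<cdot> x) = f0 \<cdot> (tgt G \<cdot> x)"
  using f_src[THEN reassoc, of x] f_tgt[THEN reassoc, of x] assms ty
  by (simp_all add: arr_simps)

lemma pair:
  assumes "x \<in> hom C Z (X1 G)" "y \<in> hom C Z (X1 G)" "tgt G \<cdot> x = src G \<cdot> y"
  obtains z where "z \<in> hom C Z (Dom C p1)" "p1 \<cdot> z = x" "p2 \<cdot> z = y"
  by (rule pullback_lift[OF pb, of x Z y]) (use assms ty in auto)

text \<open>Shifting for \<open>p1\<close>, \<open>p2\<close> and \<open>f1 \<cdot> m\<close>. For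
  \<open>z = (x, y)\<close> and \<open>z' = (x, y')\<close> the opposite edge of the rectangle is
  \<open>(1, y)\<close>, \<open>(1, y')\<close>, whose products are \<open>y\<close> and
  \<open>y'\<close>; the implication holds because a pair is determined by its components.\<close>

lemma mult_cong_right:
  assumes z: "z \<in> hom C Z (Dom C p1)" "z' \<in> hom C Z (Dom C p1)"
    and eq: "p1 \<cdot> z = p1 \<cdot> z'" "f1 \<cdot> (p2 \<cdot> z) = f1 \<cdot> (p2 \<cdot> z')"
  shows "f1 \<cdot> (m \<cdot> z) = f1 \<cdot> (m \<cdot> z')"
proof -
  let ?e = "ins G \<cdot> (tgt G \<cdot> (p1 \<cdot> z))"
  obtain a where a: "a \<in> hom C Z (Dom C p1)" "p1 \<cdot> a = ?e" "p2 \<cdot> a = p2 \<cdot> z"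
    by (rule pair[of ?e Z "p2 \<cdot> z"]) (use z ty in \<open>simp_all add: hom_def arr_simps mult_elt graph_elt\<close>)
  have tz: "tgt G \<cdot> (p1 \<cdot> z) = src G \<cdot> (p2 \<cdot> z)" "tgt G \<cdot> (p1 \<cdot> z) = src G \<cdot> (p2 \<cdot> z')"
    using z mult_elt(1)[of z] mult_elt(1)[of z'] eq(1) by (simp_all add: hom_def)
  have ety: "?e \<in> hom C Z (X1 G)" "p2 \<cdot> z' \<in> hom C Z (X1 G)" "p2 \<cdot> z \<in> hom C Z (X1 G)"
    and te: "tgt G \<cdot> ?e = tgt G \<cdot> (p1 \<cdot> z)"
    using z ty by (simp_all add: hom_def arr_simps graph_elt)
  obtain b where b: "b \<in> hom C Z (Dom C p1)" "p1 \<cdot> b = ?e" "p2 \<cdot> b = p2 \<cdot> z'"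
    by (rule pair[OF ety(1,2)]) (use te tz in auto)
  have ma: "m \<cdot> a = p2 \<cdot> z" by (rule unit_left[OF ety(3) a(1)]) (use a tz in simp_all)
  have mb: "m \<cdot> b = p2 \<cdot> z'" by (rule unit_left[OF ety(2) b(1)]) (use b tz in simp_all)
  have fm: "f1 \<cdot> m \<cdot> u = f1 \<cdot> (m \<cdot> u)" if "u \<in> hom C Y (Dom C p1)" for u Y
    using that ty by (simp add: hom_def arr_simps)
  have hm: "p1 \<in> hom C (Dom C p1) (X1 G)" "p2 \<in> hom C (Dom C p1) (X1 G)" "f1 \<cdot> m \<in> hom C (Dom C p1) (X1 H)"
    using ty by (simp_all add: hom_def arr_simps)
  have "f1 \<cdot> m \<cdot> z = f1 \<cdot> m \<cdot> z'"
  proof (rule goursat_shifting[OF goursat hm, of a Z b z z'])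
    show "f1 \<cdot> m \<cdot> u = f1 \<cdot> m \<cdot> v" if "u \<in> hom C Y (Dom C p1)" "v \<in> hom C Y (Dom C p1)" "p1 \<cdot> u = p1 \<cdot> v" "p2 \<cdot> u = p2 \<cdot> v" for u v Y
      using jointly_monicD[OF pullback_jointly_monic[OF pb] that] by simp
  qed (use z a b ma mb eq fm[OF a(1)] fm[OF b(1)] in simp_all)
  then show ?thesis using fm z by simp
qed

text \<open>Shifting again, now for the joint map of \<open>f1 \<cdot> p1\<close> and
  \<open>f1 \<cdot> p2\<close>, for \<open>p1\<close>, and for \<open>f1 \<cdot> m\<close>. The
  opposite edge for \<open>(x, y)\<close>, \<open>(x', y')\<close> is \<open>(x, 1)\<close>,
  \<open>(x', 1)\<close>, with products \<open>x\<close> and \<open>x'\<close>; the implication is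
  \<open>mult_cong_right\<close>.\<close>

lemma mult_cong:
  assumes z: "z \<in> hom C Z (Dom C p1)" "z' \<in> hom C Z (Dom C p1)"
    and eq: "f1 \<cdot> (p1 \<cdot> z) = f1 \<cdot> (p1 \<cdot> z')" "f1 \<cdot> (p2 \<cdot> z) = f1 \<cdot> (p2 \<cdot> z')"
  shows "f1 \<cdot> (m \<cdot> z) = f1 \<cdot> (m \<cdot> z')"
proof -
  have unit: "\<exists>a \<in> hom C Z (Dom C p1). p1 \<cdot> a = p1 \<cdot> z \<and> p2 \<cdot> a = ins G \<cdot> (tgt G \<cdot> (p1 \<cdot> z)) \<and> m \<cdot> a = p1 \<cdot> z"
    if z: "z \<in> hom C Z (Dom C p1)" for z
  proof -
    have ety: "p1 \<cdot> z \<in> hom C Z (X1 G)" "ins G \<cdot> (tgt G \<cdot> (p1 \<cdot> z)) \<in> hom C Z (X1 G)"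
      "tgt G \<cdot> (p1 \<cdot> z) = src G \<cdot> (ins G \<cdot> (tgt G \<cdot> (p1 \<cdot> z)))"
      using z ty by (simp_all add: hom_def arr_simps graph_elt)
    obtain a where a: "a \<in> hom C Z (Dom C p1)" "p1 \<cdot> a = p1 \<cdot> z" "p2 \<cdot> a = ins G \<cdot> (tgt G \<cdot> (p1 \<cdot> z))"
      by (rule pair[OF ety])
    moreover have "m \<cdot> a = p1 \<cdot> z" by (rule unit_right[OF ety(1) a(1)]) (use a in simp_all)
    ultimately show ?thesis by blast
  qed
  obtain a where a: "a \<in> hom C Z (Dom C p1)" "p1 \<cdot> a = p1 \<cdot> z" "p2 \<cdot> a = ins G \<cdot> (tgt G \<cdot> (p1 \<cdot> z))" "m \<cdot> a = p1 \<cdot> z"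
    using unit[OF z(1)] by blast
  obtain b where b: "b \<in> hom C Z (Dom C p1)" "p1 \<cdot> b = p1 \<cdot> z'" "p2 \<cdot> b = ins G \<cdot> (tgt G \<cdot> (p1 \<cdot> z'))" "m \<cdot> b = p1 \<cdot> z'"
    using unit[OF z(2)] by blast
  have ft: "f1 \<cdot> (ins G \<cdot> (tgt G \<cdot> (p1 \<cdot> u))) = ins H \<cdot> (tgt H \<cdot> (f1 \<cdot> (p1 \<cdot> u)))" if "u \<in> hom C Z (Dom C p1)" for u
    using that ty by (simp add: hom_def arr_simps graph_elt map_elt)
  have fm: "f1 \<cdot> m \<cdot> u = f1 \<cdot> (m \<cdot> u)" "f1 \<cdot> p1 \<cdot> u = f1 \<cdot> (p1 \<cdot> u)" "f1 \<cdot> p2 \<cdot> u = f1 \<cdot> (p2 \<cdot> u)" if "u \<in> hom C Y (Dom C p1)" for u Y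
    using that ty by (simp_all add: hom_def arr_simps)
  have hm: "p1 \<in> hom C (Dom C p1) (X1 G)" "f1 \<cdot> m \<in> hom C (Dom C p1) (X1 H)"
    and hr: "f1 \<cdot> p1 \<in> hom C (Dom C p1) (X1 H)" "f1 \<cdot> p2 \<in> hom C (Dom C p1) (X1 H)"
    using ty by (simp_all add: hom_def arr_simps)
  obtain r R where r: "r \<in> hom C (Dom C p1) R" and req:
    "\<And>Z x x'. x \<in> hom C Z (Dom C p1) \<Longrightarrow> x' \<in> hom C Z (Dom C p1) \<Longrightarrow>
      r \<cdot> x = r \<cdot> x' \<longleftrightarrow> (f1 \<cdot> p1) \<cdot> x = (f1 \<cdot> p1) \<cdot> x' \<and> (f1 \<cdot> p2) \<cdot> x = (f1 \<cdot> p2) \<cdot> x'"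
    by (rule joint_map[OF hr]) blast
  have "f1 \<cdot> m \<cdot> z = f1 \<cdot> m \<cdot> z'"
  proof (rule goursat_shifting[OF goursat r hm, of a Z b z z'])
    show "f1 \<cdot> m \<cdot> u = f1 \<cdot> m \<cdot> v" if "u \<in> hom C Y (Dom C p1)" "v \<in> hom C Y (Dom C p1)" "r \<cdot> u = r \<cdot> v" "p1 \<cdot> u = p1 \<cdot> v" for u v Y
      using mult_cong_right[OF that(1,2,4)] that(3) req[OF that(1,2)] fm[OF that(1)] fm[OF that(2)] by simp
    show "r \<cdot> a = r \<cdot> b" unfolding req[OF a(1) b(1)] using fm[OF a(1)] fm[OF b(1)] a(2,3) b(2,3) ft z eq by simp
    show "r \<cdot> z = r \<cdot> z'" unfolding req[OF z] using fm[OF z(1)] fm[OF z(2)] eq by simp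
  qed (use z a b eq fm[OF a(1)] fm[OF b(1)] in simp_all)
  then show ?thesis using fm z by simp
qed

end

locale quotient_pairs = graph_quotient +
  fixes p1' p2' \<phi>
  assumes pb': "is_pullback C (tgt H) (src H) p1' p2'"
    and \<phi>_hom: "\<phi> \<in> hom C (Dom C p1) (Dom C p1')"
    and \<phi>_p: "p1' \<cdot> \<phi> = f1 \<cdot> p1" "p2' \<cdot> \<phi> = f1 \<cdot> p2"
begin

lemma p'_ty: "p1' \<in> Arr C" "p2' \<in> Arr C" "Cod C p1' = X1 H" "Cod C p2' = X1 H" "Dom C p2' = Dom C p1'"
  "\<phi> \<in> Arr C" "Dom C \<phi> = Dom C p1" "Cod C \<phi> = Dom C p1'"
  using pullbackD[OF pb'] reflexive_graphD[OF H] \<phi>_hom by (auto simp: hom_def)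

lemmas ty' = ty p'_ty

lemma pair_elt':
  assumes "z \<in> Arr C" "Cod C z = Dom C p1'"
  shows "tgt H \<cdot> (p1' \<cdot> z) = src H \<cdot> (p2' \<cdot> z)"
  using pullbackD(9)[OF pb', THEN reassoc, of z] assms ty' by (simp add: arr_simps)

lemma \<phi>_elt:
  assumes "z \<in> Arr C" "Cod C z = Dom C p1"
  shows "p1' \<cdot> (\<phi> \<cdot> z) = f1 \<cdot> (p1 \<cdot> z)" "p2' \<cdot> (\<phi> \<cdot> z) = f1 \<cdot> (p2 \<cdot> z)"
  using \<phi>_p[THEN reassoc, of z] assms ty' by (simp_all add: arr_simps)

lemma pair_eq':
  assumes "u \<in> hom C Z (Dom C p1')" "v \<in> hom C Z (Dom C p1')" "p1' \<cdot> u = p1' \<cdot> v" "p2' \<cdot> u = p2' \<cdot> v"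
  shows "u = v"
  using jointly_monicD[OF pullback_jointly_monic[OF pb'] assms] .

text \<open>The lifting lemma for \<open>tgt\<close> and \<open>src\<close>, with \<open>ins\<close>
  as the common section.\<close>

lemma lift_pair:
  assumes z': "z' \<in> hom C Z (Dom C p1')"
  obtains W w z where "regular_epi C w" "w \<in> hom C W Z" "z \<in> hom C W (Dom C p1)" "\<phi> \<cdot> z = z' \<cdot> w"
proof -
  note g = G[unfolded is_reflexive_graph_def] and h = H[unfolded is_reflexive_graph_def]
  have e: "p1' \<cdot> z' \<in> hom C Z (X1 H)" "p2' \<cdot> z' \<in> hom C Z (X1 H)" "tgt H \<cdot> (p1' \<cdot> z') = src H \<cdot> (p2' \<cdot> z')"
    using z' ty' by (simp_all add: hom_def arr_simps pair_elt')
  obtain W w z where w: "regular_epi C w" "w \<in> hom C W Z" "z \<in> hom C W (Dom C p1)"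
    "f1 \<cdot> (p1 \<cdot> z) = p1' \<cdot> z' \<cdot> w" "f1 \<cdot> (p2 \<cdot> z) = p2' \<cdot> z' \<cdot> w"
    by (rule goursat_pullback_lift[OF goursat, of "tgt G" "X1 G" "X0 G" "ins G" "src G" "X1 G" "ins G"
        "tgt H" "X1 H" "X0 H" "ins H" "src H" "X1 H" "ins H" f1 f0 f1 p1 p2 "p1' \<cdot> z'" Z "p2' \<cdot> z'"])
      (use g h f0 f1 f_src f_tgt f_ins pb e in auto)
  have "\<phi> \<cdot> z = z' \<cdot> w"
    by (rule pair_eq'[of _ W]) (use w z' ty' in \<open>simp_all add: hom_def arr_simps \<phi>_elt\<close>)
  with w that show thesis by blast
qed

text \<open>The identity on the object of composable pairs of \<open>H\<close> is the generic such
  pair, and it lifts locally.\<close>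

lemma \<phi>_regular: "regular_epi C \<phi>"
proof -
  have P': "Dom C p1' \<in> Obj C" using ty' Dom_Obj by simp
  obtain W w z where w: "regular_epi C w" "w \<in> hom C W (Dom C p1')" "z \<in> hom C W (Dom C p1)"
    "\<phi> \<cdot> z = Ide C (Dom C p1') \<cdot> w"
    by (rule lift_pair[OF Ide_hom[OF P']])
  have "\<phi> \<cdot> z = w" using w(2,4) by (simp add: hom_def arr_simps)
  then show ?thesis using regular_epi_if_lift[OF \<phi>_hom w(1-3)] by simp
qed

text \<open>Elements identified by \<open>\<phi>\<close> have congruent components, so
  \<open>mult_cong\<close> is the fibre condition for descent along \<open>\<phi>\<close>.\<close>

lemma quotient_mult_exists:
  obtains m' where "m' \<in> hom C (Dom C p1') (X1 H)" "m' \<cdot> \<phi> = f1 \<cdot> m"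
proof -
  have k: "f1 \<cdot> m \<in> hom C (Dom C \<phi>) (X1 H)" using ty' by (simp add: hom_def arr_simps)
  have cong: "f1 \<cdot> m \<cdot> x = f1 \<cdot> m \<cdot> x'"
    if "x \<in> hom C Z (Dom C \<phi>)" "x' \<in> hom C Z (Dom C \<phi>)" "\<phi> \<cdot> x = \<phi> \<cdot> x'" for Z x x'
  proof -
    have x: "x \<in> hom C Z (Dom C p1)" "x' \<in> hom C Z (Dom C p1)" using that ty' by auto
    have "f1 \<cdot> (p1 \<cdot> x) = f1 \<cdot> (p1 \<cdot> x')" "f1 \<cdot> (p2 \<cdot> x) = f1 \<cdot> (p2 \<cdot> x')"
      using \<phi>_elt[of x] \<phi>_elt[of x'] x that(3) by (simp_all add: hom_def)
    from mult_cong[OF x this] show ?thesis using x ty' by (simp add: hom_def arr_simps)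
  qed
  obtain h where "h \<in> hom C (Cod C \<phi>) (X1 H)" "h \<cdot> \<phi> = f1 \<cdot> m"
    by (rule regular_epi_extend[OF \<phi>_regular k cong])
  then show thesis using that ty' by simp
qed

end

locale quotient_mult = quotient_pairs +
  fixes m'
  assumes m'_hom: "m' \<in> hom C (Dom C p1') (X1 H)" and m'_\<phi>: "m' \<cdot> \<phi> = f1 \<cdot> m"
begin

lemma m'_ty: "m' \<in> Arr C" "Dom C m' = Dom C p1'" "Cod C m' = X1 H"
  using m'_hom by (auto simp: hom_def)

lemmas ty'' = ty' m'_ty

lemma m'_elt:
  assumes "z \<in> Arr C" "Cod C z = Dom C p1"
  shows "m' \<cdot> (\<phi> \<cdot> z) = f1 \<cdot> (m \<cdot> z)"
  using m'_\<phi>[THEN reassoc, of z] assms ty'' by (simp add: arr_simps)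

lemma m'_local:
  assumes w: "regular_epi C w" "w \<in> hom C W Z" and z': "z' \<in> hom C Z (Dom C p1')" and z: "z \<in> hom C W (Dom C p1)"
    and eq: "f1 \<cdot> (p1 \<cdot> z) = p1' \<cdot> (z' \<cdot> w)" "f1 \<cdot> (p2 \<cdot> z) = p2' \<cdot> (z' \<cdot> w)"
  shows "m' \<cdot> (z' \<cdot> w) = f1 \<cdot> (m \<cdot> z)"
proof -
  have "\<phi> \<cdot> z = z' \<cdot> w"
    by (rule pair_eq'[of _ W]) (use w z z' eq ty'' in \<open>simp_all add: hom_def arr_simps \<phi>_elt\<close>)
  then show ?thesis using m'_elt[of z] z by (simp add: hom_def)
qed

text \<open>A product in \<open>H\<close> is computed on any local lift of the pair to
  \<open>G\<close>, and the equation then descends along the cover. Unit and inverse laws of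
  \<open>H\<close> are obtained this way.\<close>

lemma m'_eqI:
  assumes w: "regular_epi C w" "w \<in> hom C W Z" and z': "z' \<in> hom C Z (Dom C p1')" and z: "z \<in> hom C W (Dom C p1)"
    and eq: "f1 \<cdot> (p1 \<cdot> z) = p1' \<cdot> (z' \<cdot> w)" "f1 \<cdot> (p2 \<cdot> z) = p2' \<cdot> (z' \<cdot> w)"
    and y: "y \<in> hom C Z (X1 H)" "f1 \<cdot> (m \<cdot> z) = y \<cdot> w"
  shows "m' \<cdot> z' = y"
  by (rule regular_epi_cancel[OF w(1)])
    (use w z' y m'_local[OF w z' z eq] ty'' in \<open>simp_all add: hom_def arr_simps\<close>)

lemma quotient_category: "is_internal_category C H p1' p2' m'"
  unfolding is_internal_category_iff
proof (intro conjI allI ballI impI H pb' m'_hom)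
  have "src H \<cdot> m' \<cdot> \<phi> = src H \<cdot> p1' \<cdot> \<phi>" "tgt H \<cdot> m' \<cdot> \<phi> = tgt H \<cdot> p2' \<cdot> \<phi>"
    using ty'' m_src m_tgt by (simp_all add: arr_simps m'_\<phi> \<phi>_p map_elt)
  then show "src H \<cdot> m' = src H \<cdot> p1'" "tgt H \<cdot> m' = tgt H \<cdot> p2'"
    by - (rule regular_epi_cancel[OF \<phi>_regular]; use ty'' in \<open>simp add: arr_simps\<close>)+
next
  fix Z y' z' assume y': "y' \<in> hom C Z (X1 H)" and z': "z' \<in> hom C Z (Dom C p1')"
    and eq: "p1' \<cdot> z' = ins H \<cdot> (src H \<cdot> y') \<and> p2' \<cdot> z' = y'"
  obtain W w y where w: "regular_epi C w" "w \<in> hom C W Z" and y: "y \<in> hom C W (X1 G)" "f1 \<cdot> y = y' \<cdot> w"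
    using regular_epi_lift[OF f1(1), of y' Z] y' f_ty by metis
  have ety: "ins G \<cdot> (src G \<cdot> y) \<in> hom C W (X1 G)" "tgt G \<cdot> (ins G \<cdot> (src G \<cdot> y)) = src G \<cdot> y"
    using y ty'' by (simp_all add: hom_def arr_simps graph_elt)
  \<comment> \<open>The pair in \<open>H\<close> need not be lifted by the Goursat argument here: a
    lift of the single arrow \<open>y'\<close> already has its unit in \<open>G\<close>.\<close>
  obtain z where z: "z \<in> hom C W (Dom C p1)" "p1 \<cdot> z = ins G \<cdot> (src G \<cdot> y)" "p2 \<cdot> z = y"
    by (rule pair[OF ety(1) y(1) ety(2)])
  have mz: "m \<cdot> z = y" by (rule unit_left[OF y(1) z(1,2,3)])
  have e1: "f1 \<cdot> (ins G \<cdot> (src G \<cdot> y)) = ins H \<cdot> (src H \<cdot> (y' \<cdot> w))"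
    using y(1) ty'' by (simp add: hom_def arr_simps graph_elt map_elt y(2)[symmetric])
  show "m' \<cdot> z' = y'"
  proof (rule m'_eqI[OF w z' z(1) _ _ y'])
    show "f1 \<cdot> (p1 \<cdot> z) = p1' \<cdot> (z' \<cdot> w)"
      using e1 z eq[THEN conjunct1, THEN reassoc, of w] w(2) z' y' ty'' by (simp add: hom_def arr_simps)
    show "f1 \<cdot> (p2 \<cdot> z) = p2' \<cdot> (z' \<cdot> w)"
      using z(3) y(2) eq[THEN conjunct2, THEN reassoc, of w] w(2) z' ty'' by (simp add: hom_def)
    show "f1 \<cdot> (m \<cdot> z) = y' \<cdot> w" using mz y by simp
  qed
next
  fix Z y' z' assume y': "y' \<in> hom C Z (X1 H)" and z': "z' \<in> hom C Z (Dom C p1')"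
    and eq: "p1' \<cdot> z' = y' \<and> p2' \<cdot> z' = ins H \<cdot> (tgt H \<cdot> y')"
  obtain W w y where w: "regular_epi C w" "w \<in> hom C W Z" and y: "y \<in> hom C W (X1 G)" "f1 \<cdot> y = y' \<cdot> w"
    using regular_epi_lift[OF f1(1), of y' Z] y' f_ty by metis
  have ety: "ins G \<cdot> (tgt G \<cdot> y) \<in> hom C W (X1 G)" "tgt G \<cdot> y = src G \<cdot> (ins G \<cdot> (tgt G \<cdot> y))"
    using y ty'' by (simp_all add: hom_def arr_simps graph_elt)
  obtain z where z: "z \<in> hom C W (Dom C p1)" "p1 \<cdot> z = y" "p2 \<cdot> z = ins G \<cdot> (tgt G \<cdot> y)"
    by (rule pair[OF y(1) ety])
  have mz: "m \<cdot> z = y" by (rule unit_right[OF y(1) z(1,2,3)])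
  have e1: "f1 \<cdot> (ins G \<cdot> (tgt G \<cdot> y)) = ins H \<cdot> (tgt H \<cdot> (y' \<cdot> w))"
    using y(1) ty'' by (simp add: hom_def arr_simps graph_elt map_elt y(2)[symmetric])
  show "m' \<cdot> z' = y'"
  proof (rule m'_eqI[OF w z' z(1) _ _ y'])
    show "f1 \<cdot> (p2 \<cdot> z) = p2' \<cdot> (z' \<cdot> w)"
      using e1 z eq[THEN conjunct2, THEN reassoc, of w] w(2) z' y' ty'' by (simp add: hom_def arr_simps)
    show "f1 \<cdot> (p1 \<cdot> z) = p1' \<cdot> (z' \<cdot> w)"
      using z(2) y(2) eq[THEN conjunct1, THEN reassoc, of w] w(2) z' ty'' by (simp add: hom_def)
    show "f1 \<cdot> (m \<cdot> z) = y' \<cdot> w" using mz y by simp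
  qed
next
  fix Z u v u' v'
  assume h: "u \<in> hom C Z (Dom C p1')" "v \<in> hom C Z (Dom C p1')" "u' \<in> hom C Z (Dom C p1')" "v' \<in> hom C Z (Dom C p1')"
    and eq: "p2' \<cdot> u = p1' \<cdot> v \<and> p1' \<cdot> u' = p1' \<cdot> u \<and> p2' \<cdot> u' = m' \<cdot> v \<and> p1' \<cdot> v' = m' \<cdot> u \<and> p2' \<cdot> v' = p2' \<cdot> v"
  \<comment> \<open>Preparation for lifting triples: \<open>tgt G \<cdot> p2\<close> takes the place
    of \<open>tgt G\<close> in the lifting lemma. Its section \<open>s\<close> sends an object to
    the pair of two copies of its identity, and \<open>\<phi>s\<close> says that this is compatible
    with the quotient.\<close>
  have insG: "ins G \<in> hom C (X0 G) (X1 G)" "tgt G \<cdot> ins G = src G \<cdot> ins G"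
    using ty reflexive_graphD[OF G] by (simp_all add: hom_def)
  obtain s where s: "s \<in> hom C (X0 G) (Dom C p1)" "p1 \<cdot> s = ins G" "p2 \<cdot> s = ins G"
    by (rule pair[OF insG(1,1,2)])
  obtain s' where s': "s' \<in> hom C (X0 H) (Dom C p1')" "p1' \<cdot> s' = ins H" "p2' \<cdot> s' = ins H"
    by (rule pullback_lift[OF pb', of "ins H" "X0 H" "ins H"])
      (use ty reflexive_graphD[OF H] in \<open>simp_all add: hom_def\<close>)
  note tys = s(1) s'(1) ty''
  have \<phi>s: "\<phi> \<cdot> s = s' \<cdot> f0"
    by (rule pair_eq'[of _ "X0 G"])
      (use tys s(2,3) f_ins s'(2,3)[THEN reassoc, of f0] in \<open>simp_all add: hom_def arr_simps \<phi>_elt\<close>)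
  obtain q1 q2 where pq: "is_pullback C (tgt G \<cdot> p2) (src G) q1 q2"
    using pullback_exists[of "tgt G \<cdot> p2" "src G"] ty by (auto simp: arr_simps)
  note E = pullbackD[OF pq]
  have up: "tgt G \<cdot> p2 \<in> hom C (Dom C p1) (X0 G)" "tgt G \<cdot> p2 \<cdot> s = Ide C (X0 G)"
    "tgt H \<cdot> p2' \<in> hom C (Dom C p1') (X0 H)" "tgt H \<cdot> p2' \<cdot> \<phi> = f0 \<cdot> (tgt G \<cdot> p2)"
    "p2' \<cdot> v \<in> hom C Z (X1 H)" "tgt H \<cdot> p2' \<cdot> u = src H \<cdot> (p2' \<cdot> v)"
    using tys s(3) reflexive_graphD(13)[OF G] \<phi>_p h pair_elt'[of v] eq
    by (simp_all add: hom_def arr_simps map_elt)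
  note g = G[unfolded is_reflexive_graph_def] and hh = H[unfolded is_reflexive_graph_def]
  obtain W w z where w: "regular_epi C w" "w \<in> hom C W Z" and z: "z \<in> hom C W (Dom C q1)"
    "\<phi> \<cdot> (q1 \<cdot> z) = u \<cdot> w" "f1 \<cdot> (q2 \<cdot> z) = p2' \<cdot> v \<cdot> w"
    by (rule goursat_pullback_lift[OF goursat up(1) s(1) up(2) _ insG(1) _ up(3) s'(1) _ _ \<phi>_hom f0(2) f1(2)
          \<phi>_regular f1(1) up(4) f_src \<phi>s f_ins pq h(1) up(5,6)]) (use g hh in auto)
  \<comment> \<open>The lifted triple is the pair \<open>U\<close> followed by \<open>c\<close>. As
    in the clause for associativity, \<open>V\<close> consists of its last two arrows, and
    \<open>U'\<close>, \<open>V'\<close> are the two bracketings.\<close>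
  define U c where "U = q1 \<cdot> z" and "c = q2 \<cdot> z"
  have U: "U \<in> hom C W (Dom C p1)" and c: "c \<in> hom C W (X1 G)" and tU: "tgt G \<cdot> (p2 \<cdot> U) = src G \<cdot> c"
    using z(1) E(1-8) ty E(9)[THEN reassoc, of z] by (simp_all add: U_def c_def hom_def arr_simps)
  have \<phi>U: "\<phi> \<cdot> U = u \<cdot> w" and fc: "f1 \<cdot> c = p2' \<cdot> (v \<cdot> w)"
    using z tys h w(2) by (simp_all add: U_def c_def hom_def arr_simps)
  note tyU = U c h w(2) ty''
  have p2U: "p2 \<cdot> U \<in> hom C W (X1 G)" "p1 \<cdot> U \<in> hom C W (X1 G)" "m \<cdot> U \<in> hom C W (X1 G)"
    using tyU by (simp_all add: hom_def arr_simps)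
  obtain V where V: "V \<in> hom C W (Dom C p1)" "p1 \<cdot> V = p2 \<cdot> U" "p2 \<cdot> V = c"
    by (rule pair[OF p2U(1) c tU])
  have mU: "src G \<cdot> (m \<cdot> V) = tgt G \<cdot> (p1 \<cdot> U)" "tgt G \<cdot> (m \<cdot> U) = src G \<cdot> c" "m \<cdot> V \<in> hom C W (X1 G)"
    using mult_elt[of V] mult_elt[of U] U V tU Comp_hom[OF V(1) m_hom] by (simp_all add: hom_def)
  obtain U' where U': "U' \<in> hom C W (Dom C p1)" "p1 \<cdot> U' = p1 \<cdot> U" "p2 \<cdot> U' = m \<cdot> V"
    by (rule pair[OF p2U(2) mU(3) mU(1)[symmetric]])
  obtain V' where V': "V' \<in> hom C W (Dom C p1)" "p1 \<cdot> V' = m \<cdot> U" "p2 \<cdot> V' = c"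
    by (rule pair[OF p2U(3) c mU(2)])
  have mm: "m \<cdot> U' = m \<cdot> V'"
    by (rule mult_assoc[OF U V(1) U'(1) V'(1)]) (use U' V' V in simp_all)
  have fU: "f1 \<cdot> (p1 \<cdot> U) = p1' \<cdot> (u \<cdot> w)" "f1 \<cdot> (p2 \<cdot> U) = p2' \<cdot> (u \<cdot> w)"
    using \<phi>_elt[of U] \<phi>U U by (simp_all add: hom_def)
  have ew: "p2' \<cdot> (u \<cdot> w) = p1' \<cdot> (v \<cdot> w)" "p1' \<cdot> (u' \<cdot> w) = p1' \<cdot> (u \<cdot> w)" "p2' \<cdot> (u' \<cdot> w) = m' \<cdot> (v \<cdot> w)"
    "p1' \<cdot> (v' \<cdot> w) = m' \<cdot> (u \<cdot> w)" "p2' \<cdot> (v' \<cdot> w) = p2' \<cdot> (v \<cdot> w)"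
  proof -
    have r: "k \<cdot> (x \<cdot> w) = (k \<cdot> x) \<cdot> w" if "k \<in> Arr C" "Dom C k = Dom C p1'" "x \<in> hom C Z (Dom C p1')" for k x
      using that w(2) by (simp add: hom_def arr_simps)
    show "p2' \<cdot> (u \<cdot> w) = p1' \<cdot> (v \<cdot> w)" "p1' \<cdot> (u' \<cdot> w) = p1' \<cdot> (u \<cdot> w)" "p2' \<cdot> (u' \<cdot> w) = m' \<cdot> (v \<cdot> w)"
      "p1' \<cdot> (v' \<cdot> w) = m' \<cdot> (u \<cdot> w)" "p2' \<cdot> (v' \<cdot> w) = p2' \<cdot> (v \<cdot> w)"
      using eq r[OF _ _ h(1)] r[OF _ _ h(2)] r[OF _ _ h(3)] r[OF _ _ h(4)] ty'' by simp_all
  qed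
  have 1: "m' \<cdot> (v \<cdot> w) = f1 \<cdot> (m \<cdot> V)"
    by (rule m'_local[OF w h(2) V(1)]) (use V fU fc ew in simp_all)
  have 2: "m' \<cdot> (u \<cdot> w) = f1 \<cdot> (m \<cdot> U)"
    by (rule m'_local[OF w h(1) U]) (use fU in simp_all)
  have 3: "m' \<cdot> (u' \<cdot> w) = f1 \<cdot> (m \<cdot> U')"
    by (rule m'_local[OF w h(3) U'(1)]) (use U' fU 1 ew in simp_all)
  have 4: "m' \<cdot> (v' \<cdot> w) = f1 \<cdot> (m \<cdot> V')"
    by (rule m'_local[OF w h(4) V'(1)]) (use V' fc 2 ew in simp_all)
  show "m' \<cdot> u' = m' \<cdot> v'"
    by (rule regular_epi_cancel[OF w(1)]) (use 3 4 mm h w(2) ty'' in \<open>simp_all add: hom_def arr_simps\<close>)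
qed

text \<open>Shifting for \<open>f1\<close>, \<open>src G\<close> and \<open>f1 \<cdot> i\<close>.
  The opposite edge for \<open>x\<close>, \<open>x'\<close> consists of the identities at their
  sources, which are their own inverses; the implication is the case of equal sources.\<close>

lemma inverse_cong:
  assumes gpd: "is_internal_groupoid C G p1 p2 m i"
    and x: "x \<in> hom C Z (X1 G)" "x' \<in> hom C Z (X1 G)" and eq: "f1 \<cdot> x = f1 \<cdot> x'"
  shows "f1 \<cdot> (i \<cdot> x) = f1 \<cdot> (i \<cdot> x')"
proof -
  have i: "i \<in> hom C (X1 G) (X1 G)" "src G \<cdot> i = tgt G" "tgt G \<cdot> i = src G"
    and il: "\<And>Z y z. y \<in> hom C Z (X1 G) \<Longrightarrow> z \<in> hom C Z (Dom C p1) \<Longrightarrow> p1 \<cdot> z = i \<cdot> y \<Longrightarrow> p2 \<cdot> z = y \<Longrightarrow> m \<cdot> z = ins G \<cdot> (tgt G \<cdot> y)"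
    and ir: "\<And>Z y z. y \<in> hom C Z (X1 G) \<Longrightarrow> z \<in> hom C Z (Dom C p1) \<Longrightarrow> p1 \<cdot> z = y \<Longrightarrow> p2 \<cdot> z = i \<cdot> y \<Longrightarrow> m \<cdot> z = ins G \<cdot> (src G \<cdot> y)"
    using gpd unfolding is_internal_groupoid_iff by blast+
  note tyi = i(1) ty''
  have ie: "src G \<cdot> (i \<cdot> y) = tgt G \<cdot> y" "tgt G \<cdot> (i \<cdot> y) = src G \<cdot> y" "i \<cdot> y \<in> hom C Y (X1 G)"
    if "y \<in> hom C Y (X1 G)" for Y y
    using i(2,3)[THEN reassoc, of y] that tyi by (simp_all add: hom_def arr_simps)
  \<comment> \<open>Equal sources make \<open>i y\<close> composable with \<open>y'\<close>. Then
    \<open>i y = (i y) (y' (i y')) = ((i y) y') (i y')\<close>, and the bracket is congruent to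
    \<open>(i y) y\<close>, an identity, so \<open>mult_cong\<close> replaces the right side by
    \<open>i y'\<close>.\<close>
  have same_src: "f1 \<cdot> (i \<cdot> y) = f1 \<cdot> (i \<cdot> y')"
    if y: "y \<in> hom C Y (X1 G)" "y' \<in> hom C Y (X1 G)" and feq: "f1 \<cdot> y = f1 \<cdot> y'" and seq: "src G \<cdot> y = src G \<cdot> y'" for Y y y'
  proof -
    note iy = ie[OF y(1)] ie[OF y(2)]
    obtain a where a: "a \<in> hom C Y (Dom C p1)" "p1 \<cdot> a = i \<cdot> y" "p2 \<cdot> a = y'"
      by (rule pair[OF iy(3) y(2)]) (use iy seq in simp)
    obtain a0 where a0: "a0 \<in> hom C Y (Dom C p1)" "p1 \<cdot> a0 = i \<cdot> y" "p2 \<cdot> a0 = y"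
      by (rule pair[OF iy(3) y(1)]) (use iy in simp)
    obtain b where b: "b \<in> hom C Y (Dom C p1)" "p1 \<cdot> b = y'" "p2 \<cdot> b = i \<cdot> y'"
      by (rule pair[OF y(2) iy(6)]) (use iy in simp)
    have may: "m \<cdot> a \<in> hom C Y (X1 G)" using Comp_hom[OF a(1) m_hom] .
    have ma: "tgt G \<cdot> (m \<cdot> a) = tgt G \<cdot> y'" using mult_elt(3)[of a] a by (simp add: hom_def)
    obtain c where c: "c \<in> hom C Y (Dom C p1)" "p1 \<cdot> c = m \<cdot> a" "p2 \<cdot> c = i \<cdot> y'"
      by (rule pair[OF may iy(6)]) (use ma iy in simp)
    have mb: "m \<cdot> b = ins G \<cdot> (src G \<cdot> y')" by (rule ir[OF y(2) b])
    have bty: "m \<cdot> b \<in> hom C Y (X1 G)" using Comp_hom[OF b(1) m_hom] .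
    have sb: "tgt G \<cdot> (i \<cdot> y) = src G \<cdot> (m \<cdot> b)"
      using mult_elt(2)[of b] b iy seq by (simp add: hom_def)
    obtain d where d: "d \<in> hom C Y (Dom C p1)" "p1 \<cdot> d = i \<cdot> y" "p2 \<cdot> d = m \<cdot> b"
      by (rule pair[OF iy(3) bty sb])
    have md: "m \<cdot> d = i \<cdot> y"
      by (rule unit_right[OF iy(3) d(1,2)]) (use d mb iy seq in simp)
    have mc: "m \<cdot> d = m \<cdot> c"
      by (rule mult_assoc[OF a(1) b(1) d(1) c(1)]) (use a b c d in simp_all)
    have ty2: "ins G \<cdot> (tgt G \<cdot> y') \<in> hom C Y (X1 G)" "tgt G \<cdot> (ins G \<cdot> (tgt G \<cdot> y')) = src G \<cdot> (i \<cdot> y')"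
      using y tyi iy by (simp_all add: hom_def arr_simps graph_elt)
    obtain c' where c': "c' \<in> hom C Y (Dom C p1)" "p1 \<cdot> c' = ins G \<cdot> (tgt G \<cdot> y')" "p2 \<cdot> c' = i \<cdot> y'"
      by (rule pair[OF ty2(1) iy(6) ty2(2)])
    have mc': "m \<cdot> c' = i \<cdot> y'"
      by (rule unit_left[OF iy(6) c'(1)]) (use c' iy in simp_all)
    have "f1 \<cdot> (m \<cdot> a) = f1 \<cdot> (m \<cdot> a0)"
      by (rule mult_cong[OF a(1) a0(1)]) (use a a0 feq in simp_all)
    also have "m \<cdot> a0 = ins G \<cdot> (tgt G \<cdot> y)" by (rule il[OF y(1) a0])
    also have "f1 \<cdot> (ins G \<cdot> (tgt G \<cdot> y)) = ins H \<cdot> (tgt H \<cdot> (f1 \<cdot> y))"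
      using y(1) ty'' by (simp add: hom_def arr_simps graph_elt map_elt)
    also have "\<dots> = f1 \<cdot> (ins G \<cdot> (tgt G \<cdot> y'))"
      unfolding feq using y(2) ty'' by (simp add: hom_def arr_simps graph_elt map_elt)
    finally have "f1 \<cdot> (m \<cdot> c) = f1 \<cdot> (m \<cdot> c')"
      by (intro mult_cong[OF c(1) c'(1)]) (simp_all add: c c')
    then show ?thesis using mc md mc' by simp
  qed
  have inv_ide: "i \<cdot> (ins G \<cdot> y) = ins G \<cdot> y" if y: "y \<in> hom C Y (X0 G)" for Y y
  proof -
    have e: "ins G \<cdot> y \<in> hom C Y (X1 G)" "src G \<cdot> (ins G \<cdot> y) = y" "tgt G \<cdot> (ins G \<cdot> y) = y"
      using y ty'' by (simp_all add: hom_def arr_simps graph_elt)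
    note ii = ie[OF e(1)]
    obtain a where a: "a \<in> hom C Y (Dom C p1)" "p1 \<cdot> a = i \<cdot> (ins G \<cdot> y)" "p2 \<cdot> a = ins G \<cdot> y"
      by (rule pair[OF ii(3) e(1)]) (use ii in simp)
    have "m \<cdot> a = i \<cdot> (ins G \<cdot> y)"
      by (rule unit_right[OF ii(3) a(1,2)]) (use a ii e in simp)
    moreover have "m \<cdot> a = ins G \<cdot> (tgt G \<cdot> (ins G \<cdot> y))" by (rule il[OF e(1) a])
    ultimately show ?thesis using e by simp
  qed
  have hm: "f1 \<in> hom C (X1 G) (X1 H)" "src G \<in> hom C (X1 G) (X0 G)" "f1 \<cdot> i \<in> hom C (X1 G) (X1 H)"
    using tyi by (simp_all add: hom_def arr_simps)
  have fi: "f1 \<cdot> i \<cdot> y = f1 \<cdot> (i \<cdot> y)" if "y \<in> hom C Y (X1 G)" for y Y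
    using that tyi by (simp add: hom_def arr_simps)
  define a b where "a = ins G \<cdot> (src G \<cdot> x)" and "b = ins G \<cdot> (src G \<cdot> x')"
  have ab: "a \<in> hom C Z (X1 G)" "b \<in> hom C Z (X1 G)" "src G \<cdot> a = src G \<cdot> x" "src G \<cdot> b = src G \<cdot> x'"
    using x ty'' by (simp_all add: a_def b_def hom_def arr_simps graph_elt)
  have iab: "i \<cdot> a = a" "i \<cdot> b = b"
    using inv_ide[of "src G \<cdot> x" Z] inv_ide[of "src G \<cdot> x'" Z] x ty'' by (simp_all add: a_def b_def hom_def arr_simps)
  have "f1 \<cdot> a = ins H \<cdot> (src H \<cdot> (f1 \<cdot> x))" "f1 \<cdot> b = ins H \<cdot> (src H \<cdot> (f1 \<cdot> x'))"
    using x ty'' by (simp_all add: a_def b_def hom_def arr_simps graph_elt map_elt)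
  then have fab: "f1 \<cdot> a = f1 \<cdot> b" using eq by simp
  have "f1 \<cdot> i \<cdot> x = f1 \<cdot> i \<cdot> x'"
  proof (rule goursat_shifting[OF goursat hm, of a Z b x x'])
    show "f1 \<cdot> i \<cdot> u = f1 \<cdot> i \<cdot> v"
      if "u \<in> hom C Y (X1 G)" "v \<in> hom C Y (X1 G)" "f1 \<cdot> u = f1 \<cdot> v" "src G \<cdot> u = src G \<cdot> v" for u v Y
      using same_src[OF that] fi that by simp
  qed (use ab x fab eq iab fi[OF ab(1)] fi[OF ab(2)] in simp_all)
  then show ?thesis using fi x by simp
qed

text \<open>\<open>inverse_cong\<close> is the fibre condition for descending
  \<open>f1 \<cdot> i\<close> along \<open>f1\<close>; the inverse laws then hold on local
  lifts.\<close>

lemma quotient_groupoid: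
  assumes gpd: "is_internal_groupoid C G p1 p2 m i"
  shows "\<exists>i'. is_internal_groupoid C H p1' p2' m' i'"
proof -
  have i: "i \<in> hom C (X1 G) (X1 G)" "src G \<cdot> i = tgt G" "tgt G \<cdot> i = src G"
    and il: "\<And>Z y z. y \<in> hom C Z (X1 G) \<Longrightarrow> z \<in> hom C Z (Dom C p1) \<Longrightarrow> p1 \<cdot> z = i \<cdot> y \<Longrightarrow> p2 \<cdot> z = y \<Longrightarrow> m \<cdot> z = ins G \<cdot> (tgt G \<cdot> y)"
    and ir: "\<And>Z y z. y \<in> hom C Z (X1 G) \<Longrightarrow> z \<in> hom C Z (Dom C p1) \<Longrightarrow> p1 \<cdot> z = y \<Longrightarrow> p2 \<cdot> z = i \<cdot> y \<Longrightarrow> m \<cdot> z = ins G \<cdot> (src G \<cdot> y)"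
    using gpd unfolding is_internal_groupoid_iff by blast+
  note tyi = i(1) ty''
  have ie: "src G \<cdot> (i \<cdot> y) = tgt G \<cdot> y" "tgt G \<cdot> (i \<cdot> y) = src G \<cdot> y" "i \<cdot> y \<in> hom C Y (X1 G)"
    if "y \<in> hom C Y (X1 G)" for Y y
    using i(2,3)[THEN reassoc, of y] that tyi by (simp_all add: hom_def arr_simps)
  have k: "f1 \<cdot> i \<in> hom C (Dom C f1) (X1 H)" using tyi by (simp add: hom_def arr_simps)
  have cong: "f1 \<cdot> i \<cdot> x = f1 \<cdot> i \<cdot> x'"
    if "x \<in> hom C Z (Dom C f1)" "x' \<in> hom C Z (Dom C f1)" "f1 \<cdot> x = f1 \<cdot> x'" for Z x x'
    using inverse_cong[OF gpd, of x Z x'] that tyi by (simp add: hom_def arr_simps)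
  obtain i' where "i' \<in> hom C (Cod C f1) (X1 H)" and i'_f1: "i' \<cdot> f1 = f1 \<cdot> i"
    by (rule regular_epi_extend[OF f1(1) k cong])
  then have i': "i' \<in> hom C (X1 H) (X1 H)" using f_ty by simp
  note tyi' = i' tyi
  have i'_elt: "i' \<cdot> (f1 \<cdot> x) = f1 \<cdot> (i \<cdot> x)" if "x \<in> hom C Y (X1 G)" for x Y
    using i'_f1[THEN reassoc, of x] that tyi' by (simp add: hom_def arr_simps)
  have "src H \<cdot> i' \<cdot> f1 = tgt H \<cdot> f1" "tgt H \<cdot> i' \<cdot> f1 = src H \<cdot> f1"
    using tyi' i(2,3) by (simp_all add: hom_def arr_simps i'_f1 map_elt f_src f_tgt)
  then have st: "src H \<cdot> i' = tgt H" "tgt H \<cdot> i' = src H"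
    by - (rule regular_epi_cancel[OF f1(1)]; use tyi' in \<open>simp add: hom_def arr_simps\<close>)+
  have "is_internal_groupoid C H p1' p2' m' i'"
    unfolding is_internal_groupoid_iff
  proof (intro conjI allI ballI impI quotient_category i' st)
    fix Z y' z' assume y': "y' \<in> hom C Z (X1 H)" and z': "z' \<in> hom C Z (Dom C p1')"
      and eq: "p1' \<cdot> z' = i' \<cdot> y' \<and> p2' \<cdot> z' = y'"
    obtain W w y where w: "regular_epi C w" "w \<in> hom C W Z" and y: "y \<in> hom C W (X1 G)" "f1 \<cdot> y = y' \<cdot> w"
      using regular_epi_lift[OF f1(1), of y' Z] y' f_ty by metis
    obtain z where z: "z \<in> hom C W (Dom C p1)" "p1 \<cdot> z = i \<cdot> y" "p2 \<cdot> z = y"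
      by (rule pair[OF ie(3)[OF y(1)] y(1)]) (use ie y in simp)
    have ins': "ins H \<cdot> (tgt H \<cdot> y') \<in> hom C Z (X1 H)" using y' ty'' by (simp add: hom_def arr_simps)
    show "m' \<cdot> z' = ins H \<cdot> (tgt H \<cdot> y')"
    proof (rule m'_eqI[OF w z' z(1) _ _ ins'])
      show "f1 \<cdot> (p1 \<cdot> z) = p1' \<cdot> (z' \<cdot> w)"
        using z(2) i'_elt[OF y(1)] y(2) eq[THEN conjunct1, THEN reassoc, of w] w(2) z' y' tyi'
        by (simp add: hom_def arr_simps)
      show "f1 \<cdot> (p2 \<cdot> z) = p2' \<cdot> (z' \<cdot> w)"
        using z(3) y(2) eq[THEN conjunct2, THEN reassoc, of w] w(2) z' ty'' by (simp add: hom_def)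
      have "f1 \<cdot> (m \<cdot> z) = ins H \<cdot> (tgt H \<cdot> (f1 \<cdot> y))"
        using il[OF y(1) z] y(1) ty'' by (simp add: hom_def arr_simps graph_elt map_elt)
      then show "f1 \<cdot> (m \<cdot> z) = ins H \<cdot> (tgt H \<cdot> y') \<cdot> w"
        unfolding y(2) using y' w(2) ty'' by (simp add: hom_def arr_simps)
    qed
  next
    fix Z y' z' assume y': "y' \<in> hom C Z (X1 H)" and z': "z' \<in> hom C Z (Dom C p1')"
      and eq: "p1' \<cdot> z' = y' \<and> p2' \<cdot> z' = i' \<cdot> y'"
    obtain W w y where w: "regular_epi C w" "w \<in> hom C W Z" and y: "y \<in> hom C W (X1 G)" "f1 \<cdot> y = y' \<cdot> w"
      using regular_epi_lift[OF f1(1), of y' Z] y' f_ty by metis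
    obtain z where z: "z \<in> hom C W (Dom C p1)" "p1 \<cdot> z = y" "p2 \<cdot> z = i \<cdot> y"
      by (rule pair[OF y(1) ie(3)[OF y(1)]]) (use ie y in simp)
    have ins': "ins H \<cdot> (src H \<cdot> y') \<in> hom C Z (X1 H)" using y' ty'' by (simp add: hom_def arr_simps)
    show "m' \<cdot> z' = ins H \<cdot> (src H \<cdot> y')"
    proof (rule m'_eqI[OF w z' z(1) _ _ ins'])
      show "f1 \<cdot> (p2 \<cdot> z) = p2' \<cdot> (z' \<cdot> w)"
        using z(3) i'_elt[OF y(1)] y(2) eq[THEN conjunct2, THEN reassoc, of w] w(2) z' y' tyi'
        by (simp add: hom_def arr_simps)
      show "f1 \<cdot> (p1 \<cdot> z) = p1' \<cdot> (z' \<cdot> w)"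
        using z(2) y(2) eq[THEN conjunct1, THEN reassoc, of w] w(2) z' ty'' by (simp add: hom_def)
      have "f1 \<cdot> (m \<cdot> z) = ins H \<cdot> (src H \<cdot> (f1 \<cdot> y))"
        using ir[OF y(1) z] y(1) ty'' by (simp add: hom_def arr_simps graph_elt map_elt)
      then show "f1 \<cdot> (m \<cdot> z) = ins H \<cdot> (src H \<cdot> y') \<cdot> w"
        unfolding y(2) using y' w(2) ty'' by (simp add: hom_def arr_simps)
    qed
  qed
  then show ?thesis by blast
qed

end

section \<open>Regular epimorphisms of reflexive graphs\<close>

lemma RG_simps: "Obj (RG C) = {G. is_reflexive_graph C G}" "Arr (RG C) = {\<phi>. is_rgmor C \<phi>}"
    "Dom (RG C) = mdom" "Cod (RG C) = mcod"
    "Ide (RG C) G = RGMor G G (Ide C (X0 G)) (Ide C (X1 G))"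
    "\<psi> \<cdot>\<^bsub>RG C\<^esub> \<phi> = RGMor (mdom \<phi>) (mcod \<psi>) (map0 \<psi> \<cdot>\<^bsub>C\<^esub> map0 \<phi>) (map1 \<psi> \<cdot>\<^bsub>C\<^esub> map1 \<phi>)"
  by (simp_all add: RG_def)

lemma hom_RG: "\<phi> \<in> hom (RG C) G H \<longleftrightarrow> is_rgmor C \<phi> \<and> mdom \<phi> = G \<and> mcod \<phi> = H"
  by (auto simp: hom_def RG_simps)

context regular_cat
begin

lemma RG_morD:
  assumes "is_rgmor C \<phi>"
  shows "is_reflexive_graph C (mdom \<phi>)" "is_reflexive_graph C (mcod \<phi>)"
    "map0 \<phi> \<in> Arr C" "Dom C (map0 \<phi>) = X0 (mdom \<phi>)" "Cod C (map0 \<phi>) = X0 (mcod \<phi>)"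
    "map1 \<phi> \<in> Arr C" "Dom C (map1 \<phi>) = X1 (mdom \<phi>)" "Cod C (map1 \<phi>) = X1 (mcod \<phi>)"
    "src (mcod \<phi>) \<cdot> map1 \<phi> = map0 \<phi> \<cdot> src (mdom \<phi>)"
    "tgt (mcod \<phi>) \<cdot> map1 \<phi> = map0 \<phi> \<cdot> tgt (mdom \<phi>)"
    "map1 \<phi> \<cdot> ins (mdom \<phi>) = ins (mcod \<phi>) \<cdot> map0 \<phi>"
  using assms by (auto simp: is_rgmor_def hom_def)

text \<open>The levelwise images form a graph \<open>I\<close>, through which \<open>\<phi>\<close>
  factors as \<open>\<mu>\<close> after \<open>q\<close>. As \<open>\<mu>\<close> is levelwise
  monic, \<open>q\<close> coequalises whatever \<open>\<phi>\<close> does, and hence factors through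
  \<open>\<phi>\<close>. This splits \<open>\<mu>\<close>, so its components are
  isomorphisms.\<close>

lemma regular_epi_RG_components:
  assumes reg: "regular_epi (RG C) \<phi>"
  shows "is_rgmor C \<phi>" "regular_epi C (map0 \<phi>)" "regular_epi C (map1 \<phi>)"
proof -
  interpret RG: category "RG C" by (rule category_RG) (rule category_axioms)
  show mor: "is_rgmor C \<phi>" using RG.regular_epi_arr[OF reg] by (simp add: RG_simps)
  obtain u v where c: "is_coequaliser (RG C) u v \<phi>" using reg by (auto simp: regular_epi_def)
  note c' = RG.coequaliserD[OF c, unfolded RG_simps mem_Collect_eq]
  define G H where "G = mdom \<phi>" and "H = mcod \<phi>"
  note M = RG_morD[OF mor, folded G_def H_def]
  note g = reflexive_graphD[OF M(1)] and h = reflexive_graphD[OF M(2)]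
  obtain m0 q0 where q0: "mono_arr C m0" "regular_epi C q0" "Dom C q0 = Dom C (map0 \<phi>)" "Cod C m0 = Cod C (map0 \<phi>)"
    "Cod C q0 = Dom C m0" "map0 \<phi> = m0 \<cdot> q0" using image_factorisation[OF M(3)] .
  obtain m1 q1 where q1: "mono_arr C m1" "regular_epi C q1" "Dom C q1 = Dom C (map1 \<phi>)" "Cod C m1 = Cod C (map1 \<phi>)"
    "Cod C q1 = Dom C m1" "map1 \<phi> = m1 \<cdot> q1" using image_factorisation[OF M(6)] .
  have m: "m0 \<in> Arr C" "m1 \<in> Arr C" using q0(1) q1(1) by (simp_all add: mono_arr_def)
  have q0': "Dom C q0 = X0 G" "Cod C m0 = X0 H" and q1': "Dom C q1 = X1 G" "Cod C m1 = X1 H"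
    using q0 q1 M by simp_all
  note ty = g(1-11) h(1-11) m regular_epi_arr[OF q0(2)] regular_epi_arr[OF q1(2)] q0' q1' q0(5) q1(5)
  have sq: "src H \<cdot> (m1 \<cdot> q1) = m0 \<cdot> (q0 \<cdot> src G)" "tgt H \<cdot> (m1 \<cdot> q1) = m0 \<cdot> (q0 \<cdot> tgt G)"
    "m1 \<cdot> (q1 \<cdot> ins G) = ins H \<cdot> (m0 \<cdot> q0)"
    using M(9-11) ty unfolding q0(6) q1(6) by (simp_all add: arr_simps)
  \<comment> \<open>The structure arrows of the image graph are diagonal fill-ins between a regular
    epimorphism and a monomorphism.\<close>
  obtain sI where sI: "sI \<in> hom C (Dom C m1) (Dom C m0)" "sI \<cdot> q1 = q0 \<cdot> src G" "m0 \<cdot> sI = src H \<cdot> m1"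
    by (rule regular_epi_diagonal[OF q1(2) q0(1)[unfolded mono_arr_iff], of "q0 \<cdot> src G" "src H \<cdot> m1" "X0 H" "src H \<cdot> m1" "X0 H"])
      (use ty sq in \<open>simp_all add: hom_def arr_simps\<close>)
  obtain tI where tI: "tI \<in> hom C (Dom C m1) (Dom C m0)" "tI \<cdot> q1 = q0 \<cdot> tgt G" "m0 \<cdot> tI = tgt H \<cdot> m1"
    by (rule regular_epi_diagonal[OF q1(2) q0(1)[unfolded mono_arr_iff], of "q0 \<cdot> tgt G" "tgt H \<cdot> m1" "X0 H" "tgt H \<cdot> m1" "X0 H"])
      (use ty sq in \<open>simp_all add: hom_def arr_simps\<close>)
  obtain eI where eI: "eI \<in> hom C (Dom C m0) (Dom C m1)" "eI \<cdot> q0 = q1 \<cdot> ins G" "m1 \<cdot> eI = ins H \<cdot> m0"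
    by (rule regular_epi_diagonal[OF q0(2) q1(1)[unfolded mono_arr_iff], of "q1 \<cdot> ins G" "ins H \<cdot> m0" "X1 H" "ins H \<cdot> m0" "X1 H"])
      (use ty sq in \<open>simp_all add: hom_def arr_simps\<close>)
  define I where "I = RGraph (Dom C m1) (Dom C m0) sI tI eI"
  note ty' = ty sI(1) tI(1) eI(1)
  have I0: "Dom C m0 \<in> Obj C" "Dom C m1 \<in> Obj C" using m Dom_Obj by auto
  have mono0: "x = y" if "x \<in> hom C Z (Dom C m0)" "y \<in> hom C Z (Dom C m0)" "m0 \<cdot> x = m0 \<cdot> y" for x y Z
    using jointly_monicD[OF q0(1)[unfolded mono_arr_iff] that that(3)] .
  have mono1: "x = y" if "x \<in> hom C Z (Dom C m1)" "y \<in> hom C Z (Dom C m1)" "m1 \<cdot> x = m1 \<cdot> y" for x y Z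
    using jointly_monicD[OF q1(1)[unfolded mono_arr_iff] that that(3)] .
  have sec: "sI \<cdot> eI = Ide C (Dom C m0)" "tI \<cdot> eI = Ide C (Dom C m0)"
  proof -
    have hi: "src H \<cdot> (ins H \<cdot> m0) = m0" "tgt H \<cdot> (ins H \<cdot> m0) = m0"
      using h(12,13)[THEN reassoc, of m0] ty by (simp_all add: arr_simps)
    show "sI \<cdot> eI = Ide C (Dom C m0)"
      by (rule mono0[of _ "Dom C m0"])
        (use ty' I0 sI(3)[THEN reassoc, of eI] eI(3) hi in \<open>simp_all add: hom_def arr_simps\<close>)
    show "tI \<cdot> eI = Ide C (Dom C m0)"
      by (rule mono0[of _ "Dom C m0"])
        (use ty' I0 tI(3)[THEN reassoc, of eI] eI(3) hi in \<open>simp_all add: hom_def arr_simps\<close>)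
  qed
  have I: "is_reflexive_graph C I"
    unfolding is_reflexive_graph_def I_def using ty' I0 sec by simp
  define q where "q = RGMor G I q0 q1"
  define \<mu> where "\<mu> = RGMor I H m0 m1"
  have q: "is_rgmor C q"
    unfolding is_rgmor_def q_def using M(1) I ty' sI(2) tI(2) eI(2) by (simp add: I_def hom_def)
  have \<mu>: "is_rgmor C \<mu>"
    unfolding is_rgmor_def \<mu>_def using M(2) I ty' sI(3) tI(3) eI(3) by (simp add: I_def hom_def)
  have \<phi>: "\<phi> = \<mu> \<cdot>\<^bsub>RG C\<^esub> q"
    by (rule rgmor.expand) (simp add: RG_simps \<mu>_def q_def G_def H_def q0(6) q1(6))
  have muv: "map0 \<phi> \<cdot> map0 u = map0 \<phi> \<cdot> map0 v" "map1 \<phi> \<cdot> map1 u = map1 \<phi> \<cdot> map1 v"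
    using c'(7) by simp_all
  have cu: "mcod u = G" "mcod v = G" "mdom v = mdom u" using c' by (simp_all add: G_def)
  note uty = RG_morD(3-8)[OF c'(1), unfolded cu] and vty = RG_morD(3-8)[OF c'(2), unfolded cu]
  have "q0 \<cdot> map0 u = q0 \<cdot> map0 v"
    by (rule mono0[of _ "X0 (mdom u)"])
      (use ty uty vty muv(1)[unfolded q0(6)] in \<open>simp_all add: hom_def arr_simps\<close>)
  moreover have "q1 \<cdot> map1 u = q1 \<cdot> map1 v"
    by (rule mono1[of _ "X1 (mdom u)"])
      (use ty uty vty muv(2)[unfolded q1(6)] in \<open>simp_all add: hom_def arr_simps\<close>)
  ultimately have quv: "q \<cdot>\<^bsub>RG C\<^esub> u = q \<cdot>\<^bsub>RG C\<^esub> v"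
    by (simp add: RG_simps q_def cu)
  have "q \<in> hom (RG C) (Cod (RG C) u) I" by (simp add: hom_RG q RG_simps cu) (simp add: q_def)
  then obtain n where n: "n \<in> hom (RG C) (Cod (RG C) \<phi>) I" "n \<cdot>\<^bsub>RG C\<^esub> \<phi> = q"
    using RG.coequaliser_lift[OF c _ quv] by blast
  have nm: "is_rgmor C n" "mdom n = H" "mcod n = I" using n(1) by (simp_all add: hom_RG RG_simps H_def)
  have \<mu>h: "\<mu> \<in> Arr (RG C)" "n \<in> Arr (RG C)" "\<phi> \<in> Arr (RG C)" "Dom (RG C) \<mu> = I" "Cod (RG C) \<mu> = H" "Dom (RG C) n = H" "Cod (RG C) n = I"
    "Cod (RG C) \<phi> = H" "H \<in> Obj (RG C)"
    using \<mu> nm mor M(2) by (simp_all add: RG_simps \<mu>_def H_def)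
  \<comment> \<open>Both sides agree after \<open>\<phi>\<close>, since \<open>n\<close> takes
    \<open>\<phi>\<close> to \<open>q\<close> and \<open>\<mu>\<close> takes \<open>q\<close> to
    \<open>\<phi>\<close>.\<close>
  have "\<mu> \<cdot>\<^bsub>RG C\<^esub> n = Ide (RG C) H"
  proof (rule RG.regular_epi_cancel[OF reg])
    show "\<mu> \<cdot>\<^bsub>RG C\<^esub> n \<cdot>\<^bsub>RG C\<^esub> \<phi> = Ide (RG C) H \<cdot>\<^bsub>RG C\<^esub> \<phi>"
      using \<mu>h n(2) \<phi> by (simp add: RG.arr_simps)
  qed (use \<mu>h in \<open>simp_all add: RG.arr_simps\<close>)
  then have id: "m0 \<cdot> map0 n = Ide C (X0 H)" "m1 \<cdot> map1 n = Ide C (X1 H)"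
    by (simp_all add: RG_simps \<mu>_def)
  note nty = RG_morD(3-8)[OF nm(1), unfolded nm I_def rgraph.sel]
  have "iso_arr m0" "iso_arr m1"
    by (rule mono_split_iso[OF q0(1), of "map0 n"] mono_split_iso[OF q1(1), of "map1 n"];
        use nty id ty in \<open>simp add: hom_def\<close>)+
  then show "regular_epi C (map0 \<phi>)" "regular_epi C (map1 \<phi>)"
    unfolding q0(6) q1(6) using regular_epi_iso_comp q0(2,5) q1(2,5) by simp_all
qed

text \<open>The levelwise kernel pairs form a reflexive graph \<open>K\<close> with two morphisms to
  the domain, and \<open>\<phi>\<close> is shown to be their coequaliser. Arrows out of the quotient
  are found levelwise.\<close>

lemma regular_epi_RG_if_components:
  assumes mor: "is_rgmor C \<phi>" and e0: "regular_epi C (map0 \<phi>)" and e1: "regular_epi C (map1 \<phi>)"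
  shows "regular_epi (RG C) \<phi>"
proof -
  define G H f0 f1 where "G = mdom \<phi>" and "H = mcod \<phi>" and "f0 = map0 \<phi>" and "f1 = map1 \<phi>"
  note M = RG_morD[OF mor, folded G_def H_def f0_def f1_def] and e = e0[folded f0_def] e1[folded f1_def]
  note g = reflexive_graphD[OF M(1)] and h = reflexive_graphD[OF M(2)]
  obtain a0 b0 where k0: "is_pullback C f0 f0 a0 b0" using pullback_exists M(3) by blast
  obtain a1 b1 where k1: "is_pullback C f1 f1 a1 b1" using pullback_exists M(6) by blast
  note D0 = pullbackD[OF k0] and D1 = pullbackD[OF k1]
  note ty = g(1-11) h(1-11) M(3-8) D0(3,4,6-8) D1(3,4,6-8)
  have s: "f0 \<cdot> (src G \<cdot> x) = src H \<cdot> (f1 \<cdot> x)" "f0 \<cdot> (tgt G \<cdot> x) = tgt H \<cdot> (f1 \<cdot> x)" if "x \<in> Arr C" "Cod C x = X1 G" for x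
    using M(9,10)[THEN reassoc, of x] ty that by (simp_all add: arr_simps)
  have t: "f1 \<cdot> (ins G \<cdot> x) = ins H \<cdot> (f0 \<cdot> x)" if "x \<in> Arr C" "Cod C x = X0 G" for x
    using M(11)[THEN reassoc, of x] ty that by (simp_all add: arr_simps)
  obtain sK where sK: "sK \<in> hom C (Dom C a1) (Dom C a0)" "a0 \<cdot> sK = src G \<cdot> a1" "b0 \<cdot> sK = src G \<cdot> b1"
    by (rule pullback_lift[OF k0, of "src G \<cdot> a1" "Dom C a1" "src G \<cdot> b1"])
      (use ty s[of a1] s[of b1] D1(9) in \<open>simp_all add: hom_def arr_simps\<close>)
  obtain tK where tK: "tK \<in> hom C (Dom C a1) (Dom C a0)" "a0 \<cdot> tK = tgt G \<cdot> a1" "b0 \<cdot> tK = tgt G \<cdot> b1"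
    by (rule pullback_lift[OF k0, of "tgt G \<cdot> a1" "Dom C a1" "tgt G \<cdot> b1"])
      (use ty s[of a1] s[of b1] D1(9) in \<open>simp_all add: hom_def arr_simps\<close>)
  obtain eK where eK: "eK \<in> hom C (Dom C a0) (Dom C a1)" "a1 \<cdot> eK = ins G \<cdot> a0" "b1 \<cdot> eK = ins G \<cdot> b0"
    by (rule pullback_lift[OF k1, of "ins G \<cdot> a0" "Dom C a0" "ins G \<cdot> b0"])
      (use ty t[of a0] t[of b0] D0(9) in \<open>simp_all add: hom_def arr_simps\<close>)
  define K where "K = RGraph (Dom C a1) (Dom C a0) sK tK eK"
  have K0: "Dom C a0 \<in> Obj C" "Dom C a1 \<in> Obj C" using ty Dom_Obj by auto
  note ty' = ty sK(1) tK(1) eK(1) K0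
  have sg: "src G \<cdot> (ins G \<cdot> x) = x" "tgt G \<cdot> (ins G \<cdot> x) = x" if "x \<in> Arr C" "Cod C x = X0 G" for x
    using g(12,13)[THEN reassoc, of x] ty that by (simp_all add: arr_simps)
  have j0: "x = y" if "x \<in> hom C Z (Dom C a0)" "y \<in> hom C Z (Dom C a0)" "a0 \<cdot> x = a0 \<cdot> y" "b0 \<cdot> x = b0 \<cdot> y" for x y Z
    using jointly_monicD[OF pullback_jointly_monic[OF k0] that] .
  have "sK \<cdot> eK = Ide C (Dom C a0)"
    by (rule j0[of _ "Dom C a0"])
      (use ty' sg[of a0] sg[of b0] sK(2,3)[THEN reassoc, of eK] eK(2,3) in \<open>simp_all add: hom_def arr_simps\<close>)
  moreover have "tK \<cdot> eK = Ide C (Dom C a0)"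
    by (rule j0[of _ "Dom C a0"])
      (use ty' sg[of a0] sg[of b0] tK(2,3)[THEN reassoc, of eK] eK(2,3) in \<open>simp_all add: hom_def arr_simps\<close>)
  ultimately have K: "is_reflexive_graph C K"
    unfolding is_reflexive_graph_def K_def using ty' by simp
  define a b where "a = RGMor K G a0 a1" and "b = RGMor K G b0 b1"
  have ab: "is_rgmor C a" "is_rgmor C b"
    unfolding is_rgmor_def a_def b_def using K M(1) ty' sK tK eK by (simp_all add: K_def hom_def)
  have \<phi>: "\<phi> = RGMor G H f0 f1" by (rule rgmor.expand) (simp add: G_def H_def f0_def f1_def)
  \<comment> \<open>A regular epimorphism coequalises its own kernel pair universally, whichever
    parallel pair it was a coequaliser of.\<close>
  have ext: "\<exists>h \<in> hom C (Cod C f) Y. h \<cdot> f = k"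
    if f: "regular_epi C f" and kp: "is_pullback C f f p q" and k: "k \<in> hom C (Dom C f) Y" "k \<cdot> p = k \<cdot> q" for f p q k Y
  proof -
    note D = pullbackD[OF kp]
    have cong: "k \<cdot> x = k \<cdot> x'" if x: "x \<in> hom C Z (Dom C f)" "x' \<in> hom C Z (Dom C f)" "f \<cdot> x = f \<cdot> x'" for Z x x'
    proof -
      obtain y where y: "y \<in> hom C Z (Dom C p)" "p \<cdot> y = x" "q \<cdot> y = x'" by (rule pullback_lift[OF kp x])
      then show ?thesis
        using k(2)[THEN reassoc, of y] D(3,4,6-8) k(1) assoc[of y q k] by (simp add: hom_def)
    qed
    obtain h where "h \<in> hom C (Cod C f) Y" "h \<cdot> f = k" by (rule regular_epi_extend[OF f k(1) cong])
    then show ?thesis by blast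
  qed
  have "is_coequaliser (RG C) a b \<phi>"
    unfolding is_coequaliser_def
  proof (intro conjI allI ballI impI)
    show "a \<in> Arr (RG C)" "b \<in> hom (RG C) (Dom (RG C) a) (Cod (RG C) a)" "\<phi> \<in> hom (RG C) (Cod (RG C) a) (Cod (RG C) \<phi>)"
      using ab mor by (simp_all add: hom_RG RG_simps) (simp_all add: a_def b_def G_def)
    show "\<phi> \<cdot>\<^bsub>RG C\<^esub> a = \<phi> \<cdot>\<^bsub>RG C\<^esub> b"
      unfolding \<phi> using D0(9) D1(9) by (simp add: RG_simps a_def b_def)
    fix Y k assume k: "k \<in> hom (RG C) (Cod (RG C) a) Y" "k \<cdot>\<^bsub>RG C\<^esub> a = k \<cdot>\<^bsub>RG C\<^esub> b"
    have km: "is_rgmor C k" "mdom k = G" "mcod k = Y" using k(1) by (simp_all add: hom_RG RG_simps a_def)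
    note N = RG_morD[OF km(1), unfolded km] and y = reflexive_graphD[OF RG_morD(2)[OF km(1), unfolded km]]
    have keq: "map0 k \<cdot> a0 = map0 k \<cdot> b0" "map1 k \<cdot> a1 = map1 k \<cdot> b1"
      using k(2) by (simp_all add: RG_simps a_def b_def)
    obtain h0 where h0: "h0 \<in> hom C (X0 H) (X0 Y)" "h0 \<cdot> f0 = map0 k"
      using ext[OF e(1) k0, of "map0 k" "X0 Y"] keq N(3-5) M(4,5) by (auto simp: hom_def)
    obtain h1 where h1: "h1 \<in> hom C (X1 H) (X1 Y)" "h1 \<cdot> f1 = map1 k"
      using ext[OF e(2) k1, of "map1 k" "X1 Y"] keq N(6-8) M(7,8) by (auto simp: hom_def)
    note tyh = ty h0(1) h1(1) y(1-11)
    \<comment> \<open>The levelwise extensions form a graph morphism because each required square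
      commutes after a regular epimorphism, which is then cancelled.\<close>
    have "src Y \<cdot> h1 \<cdot> f1 = h0 \<cdot> src H \<cdot> f1"
      using tyh N(9) h1(2) M(9) h0(2)[THEN reassoc, of "src G"] by (simp add: hom_def arr_simps)
    then have c1: "src Y \<cdot> h1 = h0 \<cdot> src H"
      by - (rule regular_epi_cancel[OF e(2)]; use tyh in \<open>simp add: hom_def arr_simps\<close>)
    have "tgt Y \<cdot> h1 \<cdot> f1 = h0 \<cdot> tgt H \<cdot> f1"
      using tyh N(10) h1(2) M(10) h0(2)[THEN reassoc, of "tgt G"] by (simp add: hom_def arr_simps)
    then have c2: "tgt Y \<cdot> h1 = h0 \<cdot> tgt H"
      by - (rule regular_epi_cancel[OF e(2)]; use tyh in \<open>simp add: hom_def arr_simps\<close>)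
    have "h1 \<cdot> ins H \<cdot> f0 = ins Y \<cdot> h0 \<cdot> f0"
      using tyh N(11) h0(2) M(11)[symmetric] h1(2)[THEN reassoc, of "ins G"] by (simp add: hom_def arr_simps)
    then have c3: "h1 \<cdot> ins H = ins Y \<cdot> h0"
      by - (rule regular_epi_cancel[OF e(1)]; use tyh in \<open>simp add: hom_def arr_simps\<close>)
    have hm: "is_rgmor C (RGMor H Y h0 h1)"
      unfolding is_rgmor_def using N(2) M(2) h0(1) h1(1) c1 c2 c3 by simp
    have hk: "RGMor H Y h0 h1 \<cdot>\<^bsub>RG C\<^esub> \<phi> = k"
      by (rule rgmor.expand) (simp add: RG_simps \<phi> h0 h1 km)
    show "\<exists>!h. h \<in> hom (RG C) (Cod (RG C) \<phi>) Y \<and> h \<cdot>\<^bsub>RG C\<^esub> \<phi> = k"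
    proof (rule ex1I[of _ "RGMor H Y h0 h1"])
      show "RGMor H Y h0 h1 \<in> hom (RG C) (Cod (RG C) \<phi>) Y \<and> RGMor H Y h0 h1 \<cdot>\<^bsub>RG C\<^esub> \<phi> = k"
        using hm hk by (simp add: hom_RG RG_simps H_def)
      fix l assume l: "l \<in> hom (RG C) (Cod (RG C) \<phi>) Y \<and> l \<cdot>\<^bsub>RG C\<^esub> \<phi> = k"
      then have lm: "is_rgmor C l" "mdom l = H" "mcod l = Y" by (simp_all add: hom_RG RG_simps H_def)
      note L = RG_morD(3-8)[OF lm(1), unfolded lm]
      have "map0 l \<cdot> f0 = map0 k" "map1 l \<cdot> f1 = map1 k" using l by (auto simp: RG_simps \<phi>)
      then have "map0 l = h0" "map1 l = h1"
        using regular_epi_cancel[OF e(1), of "map0 l" h0] regular_epi_cancel[OF e(2), of "map1 l" h1] L h0 h1 M(5,8)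
        by (simp_all add: hom_def)
      then show "l = RGMor H Y h0 h1" using lm by (intro rgmor.expand) simp
    qed
  qed
  then show ?thesis by (auto simp: regular_epi_def)
qed

lemma goursat_closed:
  assumes goursat: "goursat_category C"
  shows "closed_under_quotients (RG C) (Grpd C) \<and> closed_under_quotients (RG C) (Cat C)"
proof -
  \<comment> \<open>The pullback and the multiplication on the quotient are fixed before an inverse
    is considered, so the groupoid case extends the very category structure that was
    constructed.\<close>
  have key: "\<exists>p1' p2' m'. is_internal_category C (mcod \<phi>) p1' p2' m' \<and>
      (\<forall>i. is_internal_groupoid C (mdom \<phi>) p1 p2 m i \<longrightarrow> (\<exists>i'. is_internal_groupoid C (mcod \<phi>) p1' p2' m' i'))"
    if reg: "regular_epi (RG C) \<phi>" and cat: "is_internal_category C (mdom \<phi>) p1 p2 m" for \<phi> p1 p2 m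
  proof -
    note r = regular_epi_RG_components[OF reg]
    note M = RG_morD[OF r(1)]
    interpret graph_quotient C "mdom \<phi>" "mcod \<phi>" "map0 \<phi>" "map1 \<phi>" p1 p2 m
      by unfold_locales (use goursat cat r M in \<open>simp_all add: hom_def\<close>)
    obtain p1' p2' where pb': "is_pullback C (tgt (mcod \<phi>)) (src (mcod \<phi>)) p1' p2'"
      using pullback_exists ty by metis
    obtain \<phi>' where "\<phi>' \<in> hom C (Dom C p1) (Dom C p1')" "p1' \<cdot> \<phi>' = map1 \<phi> \<cdot> p1" "p2' \<cdot> \<phi>' = map1 \<phi> \<cdot> p2"
    proof (rule pullback_lift[OF pb', of "map1 \<phi> \<cdot> p1" "Dom C p1" "map1 \<phi> \<cdot> p2"])
      show "tgt (mcod \<phi>) \<cdot> (map1 \<phi> \<cdot> p1) = src (mcod \<phi>) \<cdot> (map1 \<phi> \<cdot> p2)"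
        using pullbackD(9)[OF pb] ty by (simp add: map_elt)
    qed (use ty in \<open>simp_all add: hom_def arr_simps\<close>)
    then interpret quotient_pairs C "mdom \<phi>" "mcod \<phi>" "map0 \<phi>" "map1 \<phi>" p1 p2 m p1' p2' \<phi>'
      by unfold_locales (use pb' in simp_all)
    obtain m' where "m' \<in> hom C (Dom C p1') (X1 (mcod \<phi>))" "m' \<cdot> \<phi>' = map1 \<phi> \<cdot> m"
      by (rule quotient_mult_exists)
    then interpret quotient_mult C "mdom \<phi>" "mcod \<phi>" "map0 \<phi>" "map1 \<phi>" p1 p2 m p1' p2' \<phi>' m'
      by unfold_locales simp_all
    show ?thesis using quotient_category quotient_groupoid by blast
  qed
  show ?thesis
    unfolding closed_under_quotients_def Grpd_def Cat_def RG_simps mem_Collect_eq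
    using key unfolding is_internal_groupoid_def by meson
qed

end

section \<open>Composites of equivalence relations as quotients of groupoids\<close>

context regular_cat
begin

lemma equivalence_memD:
  assumes eq: "equivalence_rel C X (r1, r2)"
  shows "x \<in> hom C Z X \<Longrightarrow> mem r1 r2 x x"
    and "x \<in> hom C Z X \<Longrightarrow> mem r1 r2 x y \<Longrightarrow> mem r1 r2 y x"
    and "x \<in> hom C Z X \<Longrightarrow> y \<in> hom C Z X \<Longrightarrow> mem r1 r2 x y \<Longrightarrow> mem r1 r2 y z \<Longrightarrow> mem r1 r2 x z"
proof -
  have rel: "is_relation C X X (r1, r2)" and refl: "reflexive_rel C X (r1, r2)"
    and sym: "symmetric_rel C (r1, r2)" and tr: "transitive_rel C (r1, r2)"
    using eq by (simp_all add: equivalence_rel_def)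
  note R = relationD[OF rel]
  have X: "X \<in> Obj C" using is_relation_objD[OF rel] by simp
  show "mem r1 r2 x x" if x: "x \<in> hom C Z X"
  proof -
    obtain k where k: "k \<in> hom C X (Dom C r1)" "r1 \<cdot> k = Ide C X" "r2 \<cdot> k = Ide C X"
      using refl by (auto simp: reflexive_rel_def)
    show ?thesis
      by (rule memI[of "k \<cdot> x" Z])
        (use k(1) x R(1-5) X k(2,3)[THEN reassoc, of x] in \<open>simp_all add: hom_def arr_simps\<close>)
  qed
  show "mem r1 r2 y x" if x: "x \<in> hom C Z X" and m: "mem r1 r2 x y"
  proof -
    obtain k where k: "k \<in> hom C (Dom C r1) (Dom C r1)" "r1 \<cdot> k = r2" "r2 \<cdot> k = r1"
      using sym by (auto simp: symmetric_rel_def)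
    obtain l where l: "l \<in> hom C Z (Dom C r1)" "r1 \<cdot> l = x" "r2 \<cdot> l = y" using memE[OF m x] .
    show ?thesis
      by (rule memI[of "k \<cdot> l" Z])
        (use k(1) l R(1-5) k(2,3)[THEN reassoc, of l] in \<open>simp_all add: hom_def arr_simps\<close>)
  qed
  show "mem r1 r2 x z" if x: "x \<in> hom C Z X" and y: "y \<in> hom C Z X" and m: "mem r1 r2 x y" "mem r1 r2 y z"
  proof -
    obtain p1 p2 k where pb: "is_pullback C r2 r1 p1 p2"
      and k: "k \<in> hom C (Dom C p1) (Dom C r1)" "r1 \<cdot> k = r1 \<cdot> p1" "r2 \<cdot> k = r2 \<cdot> p2"
      using tr by (auto simp: transitive_rel_def)
    note D = pullbackD[OF pb]
    obtain l where l: "l \<in> hom C Z (Dom C r1)" "r1 \<cdot> l = x" "r2 \<cdot> l = y" using memE[OF m(1) x] .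
    obtain l' where l': "l' \<in> hom C Z (Dom C r1)" "r1 \<cdot> l' = y" "r2 \<cdot> l' = z" using memE[OF m(2) y] .
    obtain h where h: "h \<in> hom C Z (Dom C p1)" "p1 \<cdot> h = l" "p2 \<cdot> h = l'"
      by (rule pullback_lift[OF pb, of l Z l']) (use l l' R in simp_all)
    show ?thesis
      by (rule memI[of "k \<cdot> h" Z])
        (use k(1) h l l' R(1-5) D(1-8) k(2,3)[THEN reassoc, of h] in \<open>simp_all add: hom_def arr_simps\<close>)
  qed
qed

text \<open>Unit, inverse and multiplication are the witnesses of the three closure properties at
  generic elements. All laws are automatic: two arrows with the same source and target coincide by
  joint monicity.\<close>

lemma equivalence_groupoid:
  assumes j: "jointly_monic d c" and d: "d \<in> hom C E S" and c: "c \<in> hom C E S"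
    and refl: "\<And>Z x. x \<in> hom C Z S \<Longrightarrow> mem d c x x"
    and sym: "\<And>Z x y. x \<in> hom C Z S \<Longrightarrow> y \<in> hom C Z S \<Longrightarrow> mem d c x y \<Longrightarrow> mem d c y x"
    and tr: "\<And>Z x y z. x \<in> hom C Z S \<Longrightarrow> y \<in> hom C Z S \<Longrightarrow> z \<in> hom C Z S \<Longrightarrow>
      mem d c x y \<Longrightarrow> mem d c y z \<Longrightarrow> mem d c x z"
  obtains e where "RGraph E S d c e \<in> Grpd C"
proof -
  have ob: "S \<in> Obj C" "E \<in> Obj C" using d Dom_Obj Cod_Obj by (auto simp: hom_def)
  have dd: "Dom C d = E" using d by (simp add: hom_def)
  have jm: "x = y" if "x \<in> hom C Z E" "y \<in> hom C Z E" "d \<cdot> x = d \<cdot> y" "c \<cdot> x = c \<cdot> y" for Z x y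
    using jointly_monicD[OF j, of x Z y] that dd by simp
  have memE': "\<exists>k \<in> hom C Z E. d \<cdot> k = x \<and> c \<cdot> k = y" if "mem d c x y" "x \<in> hom C Z S" for Z x y
    using memE[OF that] dd by metis
  have dc_mem: "mem d c (d \<cdot> x) (c \<cdot> x)" if "x \<in> hom C Z E" for Z x
    using memI[of x Z d] that dd d by (simp add: hom_def)
  obtain e where e: "e \<in> hom C S E" "d \<cdot> e = Ide C S" "c \<cdot> e = Ide C S"
    using memE'[OF refl[OF Ide_hom[OF ob(1)]] Ide_hom[OF ob(1)]] by blast
  \<comment> \<open>The legs form the generic related pair; its reversal is witnessed by the
    inverse.\<close>
  have "mem d c d c" using dc_mem[OF Ide_hom[OF ob(2)]] d c by (simp add: hom_def arr_simps)
  then obtain i where i: "i \<in> hom C E E" "d \<cdot> i = c" "c \<cdot> i = d"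
    using memE'[OF sym[OF d c] c] by blast
  obtain p1 p2 where pb: "is_pullback C c d p1 p2" using pullback_exists[of c d] d c by (auto simp: hom_def)
  note D = pullbackD[OF pb]
  note ty = d c e(1) i(1) D(1-8) ob
  have p: "p1 \<in> hom C (Dom C p1) E" "p2 \<in> hom C (Dom C p1) E" using ty by (simp_all add: hom_def)
  have "mem d c (c \<cdot> p1) (c \<cdot> p2)" using dc_mem[OF p(2)] D(9) by simp
  then have "mem d c (d \<cdot> p1) (c \<cdot> p2)"
    using tr[OF Comp_hom[OF p(1) d] Comp_hom[OF p(1) c] Comp_hom[OF p(2) c]] dc_mem[OF p(1)] by simp
  then obtain m where m: "m \<in> hom C (Dom C p1) E" "d \<cdot> m = d \<cdot> p1" "c \<cdot> m = c \<cdot> p2"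
    using memE'[OF _ Comp_hom[OF p(1) d]] by blast
  let ?G = "RGraph E S d c e"
  have G: "is_reflexive_graph C ?G" using ob d c e by (simp add: is_reflexive_graph_def)
  have e_elt: "d \<cdot> (e \<cdot> x) = x" "c \<cdot> (e \<cdot> x) = x" if "x \<in> Arr C" "Cod C x = S" for x
    using e(2,3)[THEN reassoc, of x] ty that by (simp_all add: hom_def arr_simps)
  have i_elt: "d \<cdot> (i \<cdot> x) = c \<cdot> x" "c \<cdot> (i \<cdot> x) = d \<cdot> x" if "x \<in> Arr C" "Cod C x = E" for x
    using assoc[of x i d] assoc[of x i c] i d c that by (simp_all add: hom_def)
  have m_elt: "d \<cdot> (m \<cdot> x) = d \<cdot> (p1 \<cdot> x)" "c \<cdot> (m \<cdot> x) = c \<cdot> (p2 \<cdot> x)" "c \<cdot> (p1 \<cdot> x) = d \<cdot> (p2 \<cdot> x)"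
    if "x \<in> Arr C" "Cod C x = Dom C p1" for x
    using m(2,3)[THEN reassoc, of x] D(9)[THEN reassoc, of x] ty m(1) that by (simp_all add: hom_def arr_simps)
  note tym = ty m(1)
  have "is_internal_category C ?G p1 p2 m"
    unfolding is_internal_category_iff rgraph.sel
  proof (intro conjI allI ballI impI G pb m)
    fix Z y z assume h: "y \<in> hom C Z E" "z \<in> hom C Z (Dom C p1)" "p1 \<cdot> z = e \<cdot> (d \<cdot> y) \<and> p2 \<cdot> z = y"
    show "m \<cdot> z = y"
      by (rule jm[of _ Z]) (use h tym in \<open>simp_all add: hom_def arr_simps m_elt e_elt\<close>)
  next
    fix Z y z assume h: "y \<in> hom C Z E" "z \<in> hom C Z (Dom C p1)" "p1 \<cdot> z = y \<and> p2 \<cdot> z = e \<cdot> (c \<cdot> y)"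
    show "m \<cdot> z = y"
      by (rule jm[of _ Z]) (use h tym in \<open>simp_all add: hom_def arr_simps m_elt e_elt\<close>)
  next
    fix Z u v u' v'
    assume h: "u \<in> hom C Z (Dom C p1)" "v \<in> hom C Z (Dom C p1)" "u' \<in> hom C Z (Dom C p1)" "v' \<in> hom C Z (Dom C p1)"
      "p2 \<cdot> u = p1 \<cdot> v \<and> p1 \<cdot> u' = p1 \<cdot> u \<and> p2 \<cdot> u' = m \<cdot> v \<and> p1 \<cdot> v' = m \<cdot> u \<and> p2 \<cdot> v' = p2 \<cdot> v"
    show "m \<cdot> u' = m \<cdot> v'"
      by (rule jm[of _ Z]) (use h tym in \<open>simp_all add: hom_def arr_simps m_elt\<close>)
  qed
  then have "is_internal_groupoid C ?G p1 p2 m i"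
    unfolding is_internal_groupoid_iff rgraph.sel
  proof (intro conjI allI ballI impI i)
    fix Z y z assume h: "y \<in> hom C Z E" "z \<in> hom C Z (Dom C p1)" "p1 \<cdot> z = i \<cdot> y \<and> p2 \<cdot> z = y"
    show "m \<cdot> z = e \<cdot> (c \<cdot> y)"
      by (rule jm[of _ Z]) (use h tym in \<open>simp_all add: hom_def arr_simps m_elt e_elt i_elt\<close>)
  next
    fix Z y z assume h: "y \<in> hom C Z E" "z \<in> hom C Z (Dom C p1)" "p1 \<cdot> z = y \<and> p2 \<cdot> z = i \<cdot> y"
    show "m \<cdot> z = e \<cdot> (d \<cdot> y)"
      by (rule jm[of _ Z]) (use h tym in \<open>simp_all add: hom_def arr_simps m_elt e_elt i_elt\<close>)
  qed
  then have "?G \<in> Grpd C" by (auto simp: Grpd_def)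
  then show thesis by (rule that)
qed

lemma internal_category_transitive:
  assumes G: "G \<in> Cat C" and x: "x \<in> hom C Z (X0 G)" "y \<in> hom C Z (X0 G)"
    and m: "mem (src G) (tgt G) x y" "mem (src G) (tgt G) y z"
  shows "mem (src G) (tgt G) x z"
proof -
  obtain p1 p2 m where c: "is_internal_category C G p1 p2 m" using G by (auto simp: Cat_def)
  have g: "is_reflexive_graph C G" and pb: "is_pullback C (tgt G) (src G) p1 p2"
    and mm: "m \<in> hom C (Dom C p1) (X1 G)" "src G \<cdot> m = src G \<cdot> p1" "tgt G \<cdot> m = tgt G \<cdot> p2"
    using c by (simp_all add: is_internal_category_def)
  note ty = reflexive_graphD(1-11)[OF g] and D = pullbackD[OF pb]
  obtain k where k: "k \<in> hom C Z (X1 G)" "src G \<cdot> k = x" "tgt G \<cdot> k = y" using memE[OF m(1) x(1)] ty by metis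
  obtain l where l: "l \<in> hom C Z (X1 G)" "src G \<cdot> l = y" "tgt G \<cdot> l = z" using memE[OF m(2) x(2)] ty by metis
  obtain h where h: "h \<in> hom C Z (Dom C p1)" "p1 \<cdot> h = k" "p2 \<cdot> h = l"
    by (rule pullback_lift[OF pb, of k Z l]) (use k l ty in simp_all)
  show ?thesis
    by (rule memI[of "m \<cdot> h" Z])
      (use k l h ty D(1-8) mm(1) mm(2,3)[THEN reassoc, of h] in \<open>simp_all add: hom_def arr_simps\<close>)
qed

text \<open>Let \<open>T\<close> be the image on \<open>X\<close>, with legs \<open>t1\<close>,
  \<open>t2\<close>. It contains \<open>R\<close> and \<open>S\<close>, by reflexivity of
  \<open>S\<close> and of \<open>R\<close>, and lies in \<open>S R S\<close> by construction. Being
  the arrows of an internal category it is transitive, so it contains \<open>R S R\<close>.\<close>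

lemma composite_le_if_quotients:
  assumes closed: "\<And>\<phi>. regular_epi (RG C) \<phi> \<Longrightarrow> mdom \<phi> \<in> Grpd C \<Longrightarrow> mcod \<phi> \<in> Cat C"
    and R: "equivalence_rel C X (r1, r2)" and S: "equivalence_rel C X (s1, s2)"
    and SR: "is_composite C X X X (s1, s2) (r1, r2) (a1, a2)"
    and RSR: "is_composite C X X X (r1, r2) (a1, a2) (b1, b2)"
    and RS: "is_composite C X X X (r1, r2) (s1, s2) (c1, c2)"
    and SRS: "is_composite C X X X (s1, s2) (c1, c2) (d1, d2)"
  shows "rel_le C (b1, b2) (d1, d2)"
proof -
  note Rm = equivalence_memD[OF R] and Sm = equivalence_memD[OF S]
  note tR = relationD[OF is_compositeD(1)[OF SR]] and tS = relationD[OF is_compositeD(2)[OF SR]]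
  note tb = relationD[OF is_compositeD(3)[OF RSR]] and td = relationD[OF is_compositeD(3)[OF SRS]]
  have X: "X \<in> Obj C" using is_relation_objD[OF is_compositeD(1)[OF SR]] by simp
  obtain au ar where A: "is_pullback C s1 r1 au ar" using pullback_exists tR tS by metis
  note DA = pullbackD[OF A]
  \<comment> \<open>An element of this object is a triple \<open>(u, k, v)\<close> with
    \<open>u\<close>, \<open>v\<close> in \<open>S\<close> and \<open>k\<close> in \<open>R\<close>
    leading from \<open>s1 u\<close> to \<open>s1 v\<close>. It is built by two pullbacks;
    \<open>d\<close> and \<open>c\<close> return \<open>u\<close> and \<open>v\<close>.\<close>
  obtain eA c where B: "is_pullback C (r2 \<cdot> ar) s1 eA c"
    using pullback_exists[of "r2 \<cdot> ar" s1] tR tS DA by (auto simp: arr_simps)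
  note DB = pullbackD[OF B]
  define d where "d = au \<cdot> eA"
  note ty = tR(1-5) tS(1-5) DA(1-8) DB(1-8) X
  have dc: "d \<in> hom C (Dom C c) (Dom C s1)" "c \<in> hom C (Dom C c) (Dom C s1)"
    using ty by (simp_all add: d_def hom_def arr_simps)
  have s_elt: "s1 \<cdot> (d \<cdot> k) = r1 \<cdot> (ar \<cdot> (eA \<cdot> k))" "s1 \<cdot> (c \<cdot> k) = r2 \<cdot> (ar \<cdot> (eA \<cdot> k))"
    if "k \<in> Arr C" "Cod C k = Dom C c" for k
    using DA(9)[THEN reassoc, of "eA \<cdot> k"] DB(9)[THEN reassoc, of k] ty that by (simp_all add: d_def arr_simps)
  have j: "jointly_monic d c"
    unfolding jointly_monic_def
  proof (intro conjI allI ballI impI)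
    show "d \<in> Arr C" "c \<in> Arr C" "Dom C d = Dom C c" using dc by (simp_all add: hom_def)
    fix Z u v assume u: "u \<in> hom C Z (Dom C d)" and v: "v \<in> hom C Z (Dom C d)" and eq: "d \<cdot> u = d \<cdot> v \<and> c \<cdot> u = c \<cdot> v"
    have dd: "Dom C d = Dom C c" using dc by (simp add: hom_def)
    have e1: "r1 \<cdot> (ar \<cdot> (eA \<cdot> u)) = r1 \<cdot> (ar \<cdot> (eA \<cdot> v))" "r2 \<cdot> (ar \<cdot> (eA \<cdot> u)) = r2 \<cdot> (ar \<cdot> (eA \<cdot> v))"
      using s_elt[of u] s_elt[of v] eq u v dd by (simp_all add: hom_def)
    \<comment> \<open>The component in \<open>R\<close> is determined by the other two, since the
      legs of \<open>R\<close> are jointly monic.\<close>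
    have "ar \<cdot> (eA \<cdot> u) = ar \<cdot> (eA \<cdot> v)"
      by (rule jointly_monicD[OF tR(6), of _ Z]) (use e1 u v ty dd in \<open>simp_all add: hom_def arr_simps\<close>)
    moreover have "au \<cdot> (eA \<cdot> u) = au \<cdot> (eA \<cdot> v)" using eq u v ty dd by (simp add: d_def hom_def arr_simps)
    moreover have "eA \<cdot> u \<in> hom C Z (Dom C au)" "eA \<cdot> v \<in> hom C Z (Dom C au)"
      using u v ty dd by (simp_all add: hom_def arr_simps)
    ultimately have eA: "eA \<cdot> u = eA \<cdot> v"
      using jointly_monicD[OF pullback_jointly_monic[OF A]] by metis
    show "u = v"
      by (rule jointly_monicD[OF pullback_jointly_monic[OF B], of _ Z]) (use u v eA eq ty dd in \<open>simp_all add: hom_def\<close>)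
  qed
  have E_mem: "mem d c u v \<longleftrightarrow> mem r1 r2 (s1 \<cdot> u) (s1 \<cdot> v)"
    if u: "u \<in> hom C Z (Dom C s1)" and v: "v \<in> hom C Z (Dom C s1)" for Z u v
  proof
    assume "mem d c u v"
    then obtain k where k: "k \<in> hom C Z (Dom C d)" "d \<cdot> k = u" "c \<cdot> k = v" using memE u by metis
    have k': "k \<in> Arr C" "Dom C k = Z" "Cod C k = Dom C c" using k(1) dc by (simp_all add: hom_def)
    show "mem r1 r2 (s1 \<cdot> u) (s1 \<cdot> v)"
      by (rule memI[of "ar \<cdot> (eA \<cdot> k)" Z])
        (use k' k(2,3) s_elt[of k] ty in \<open>simp_all add: hom_def arr_simps\<close>)
  next
    assume m: "mem r1 r2 (s1 \<cdot> u) (s1 \<cdot> v)"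
    have su: "s1 \<cdot> u \<in> hom C Z X" using u ty by (simp add: hom_def arr_simps)
    obtain k where k: "k \<in> hom C Z (Dom C r1)" "r1 \<cdot> k = s1 \<cdot> u" "r2 \<cdot> k = s1 \<cdot> v" using memE[OF m su] .
    obtain h where h: "h \<in> hom C Z (Dom C au)" "au \<cdot> h = u" "ar \<cdot> h = k"
      by (rule pullback_lift[OF A u k(1)]) (use k in simp)
    obtain l where l: "l \<in> hom C Z (Dom C eA)" "eA \<cdot> l = h" "c \<cdot> l = v"
      by (rule pullback_lift[OF B, of h Z v]) (use h k v ty in \<open>simp_all add: hom_def arr_simps\<close>)
    show "mem d c u v"
      by (rule memI[of l Z]) (use l h ty dc in \<open>simp_all add: d_def hom_def arr_simps\<close>)
  qed
  have sX: "s1 \<cdot> u \<in> hom C Z X" "s2 \<cdot> u \<in> hom C Z X" if "u \<in> hom C Z (Dom C s1)" for Z u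
    using that ty by (simp_all add: hom_def arr_simps)
  obtain e where e: "RGraph (Dom C c) (Dom C s1) d c e \<in> Grpd C"
  proof (rule equivalence_groupoid[OF j dc])
    show "mem d c x x" if "x \<in> hom C Z (Dom C s1)" for Z x
      using E_mem[OF that that] Rm(1) sX[OF that] by blast
    show "mem d c y x" if "x \<in> hom C Z (Dom C s1)" "y \<in> hom C Z (Dom C s1)" "mem d c x y" for Z x y
      using E_mem[OF that(1,2)] E_mem[OF that(2,1)] Rm(2) sX[OF that(1)] that(3) by blast
    show "mem d c x z" if "x \<in> hom C Z (Dom C s1)" "y \<in> hom C Z (Dom C s1)" "z \<in> hom C Z (Dom C s1)"
      "mem d c x y" "mem d c y z" for Z x y z
      using E_mem[OF that(1,2)] E_mem[OF that(2,3)] E_mem[OF that(1,3)] Rm(3) sX[OF that(1)] sX[OF that(2)] that(4,5)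
      by blast
  qed
  define G where "G = RGraph (Dom C c) (Dom C s1) d c e"
  have Gg: "is_reflexive_graph C G"
    using e by (auto simp: G_def Grpd_def is_internal_groupoid_def is_internal_category_def)
  have e': "e \<in> hom C (Dom C s1) (Dom C c)" "d \<cdot> e = Ide C (Dom C s1)" "c \<cdot> e = Ide C (Dom C s1)"
    using Gg by (simp_all add: is_reflexive_graph_def G_def)
  \<comment> \<open>The diagonal of \<open>S\<close>, given by reflexivity, is a section of both
    legs. It makes \<open>s2\<close> a regular epimorphism and later embeds \<open>X\<close> into
    \<open>S\<close>.\<close>
  obtain \<sigma> where \<sigma>: "\<sigma> \<in> hom C X (Dom C s1)" "s1 \<cdot> \<sigma> = Ide C X" "s2 \<cdot> \<sigma> = Ide C X"
    using memE[OF Sm(1)[OF Ide_hom[OF X]] Ide_hom[OF X]] by metis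
  have s2: "s2 \<in> hom C (Dom C s1) X" using ty by (simp add: hom_def)
  have s2_reg: "regular_epi C s2" by (rule split_epi_regular[OF s2 \<sigma>(1,3)])
  obtain q1 q2 where pr: "is_product C X X q1 q2" using product_exists X by blast
  have qty: "q1 \<in> Arr C" "q2 \<in> Arr C" "Dom C q2 = Dom C q1" "Cod C q1 = X" "Cod C q2 = X"
    using pr by (auto simp: is_product_def hom_def)
  obtain f where f: "f \<in> hom C (Dom C c) (Dom C q1)" "q1 \<cdot> f = s2 \<cdot> d" "q2 \<cdot> f = s2 \<cdot> c"
    by (rule product_lift[OF pr Comp_hom[OF dc(1) s2] Comp_hom[OF dc(2) s2]])
  have fa: "f \<in> Arr C" using f by (simp add: hom_def)
  \<comment> \<open>The image \<open>T\<close> of the legs \<open>s2 \<cdot> d\<close> and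
    \<open>s2 \<cdot> c\<close> becomes the object of arrows of the quotient; its regular part
    \<open>q\<close> is the component on arrows, beside \<open>s2\<close> on objects.\<close>
  obtain \<mu> q where \<mu>: "mono_arr C \<mu>" "regular_epi C q" "Dom C q = Dom C f" "Cod C \<mu> = Cod C f"
    "Cod C q = Dom C \<mu>" "f = \<mu> \<cdot> q" using image_factorisation[OF fa] .
  have \<mu>a: "\<mu> \<in> Arr C" using \<mu>(1) by (simp add: mono_arr_def)
  define t1 t2 T where "t1 = q1 \<cdot> \<mu>" and "t2 = q2 \<cdot> \<mu>" and "T = Dom C \<mu>"
  have qh: "q \<in> hom C (Dom C c) T" using \<mu> regular_epi_arr[OF \<mu>(2)] f by (simp add: hom_def T_def)
  have \<mu>h: "\<mu> \<in> hom C T (Dom C q1)" using \<mu> \<mu>a f by (simp add: hom_def T_def)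
  have th: "t1 \<in> hom C T X" "t2 \<in> hom C T X" using \<mu>h qty by (simp_all add: t1_def t2_def hom_def arr_simps)
  have tq: "t1 \<cdot> q = s2 \<cdot> d" "t2 \<cdot> q = s2 \<cdot> c"
    using f(2,3) \<mu>h qh qty unfolding \<mu>(6) by (simp_all add: t1_def t2_def hom_def arr_simps)
  have tj: "jointly_monic t1 t2"
    unfolding jointly_monic_def
  proof (intro conjI allI ballI impI)
    show "t1 \<in> Arr C" "t2 \<in> Arr C" "Dom C t1 = Dom C t2" using th by (simp_all add: hom_def)
    fix Z u v assume u: "u \<in> hom C Z (Dom C t1)" and v: "v \<in> hom C Z (Dom C t1)"
      and eq: "t1 \<cdot> u = t1 \<cdot> v \<and> t2 \<cdot> u = t2 \<cdot> v"
    have u': "u \<in> hom C Z (Dom C \<mu>)" "v \<in> hom C Z (Dom C \<mu>)" using u v th(1) by (simp_all add: hom_def T_def)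
    have "\<mu> \<cdot> u = \<mu> \<cdot> v"
      by (rule jointly_monicD[OF product_jointly_monic[OF pr], of _ Z])
        (use u' eq \<mu>h qty in \<open>simp_all add: t1_def t2_def hom_def arr_simps\<close>)
    then show "u = v" using jointly_monicD[OF \<mu>(1)[unfolded mono_arr_iff] u'] by simp
  qed
  \<comment> \<open>The unit is forced: compatibility with the quotient asks for
    \<open>q \<cdot> e = \<tau> \<cdot> s2\<close>, and precomposing with \<open>\<sigma>\<close>
    gives this formula.\<close>
  define \<tau> where "\<tau> = q \<cdot> (e \<cdot> \<sigma>)"
  note tyh = dc e'(1) \<sigma>(1) s2 qh th ty
  have \<tau>: "\<tau> \<in> hom C X T" using tyh by (simp add: \<tau>_def hom_def arr_simps)
  have tqe: "t1 \<cdot> (q \<cdot> (e \<cdot> x)) = s2 \<cdot> x" "t2 \<cdot> (q \<cdot> (e \<cdot> x)) = s2 \<cdot> x" if "x \<in> Arr C" "Cod C x = Dom C s1" for x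
    using tq[THEN reassoc, of "e \<cdot> x"] e'(2,3)[THEN reassoc, of x] tyh Dom_Obj[OF tS(1)] that
    by (simp_all add: hom_def arr_simps)
  have \<tau>t: "t1 \<cdot> \<tau> = Ide C X" "t2 \<cdot> \<tau> = Ide C X"
    using tqe[of \<sigma>] \<sigma> by (simp_all add: \<tau>_def hom_def)
  define H where "H = RGraph T X t1 t2 \<tau>"
  have T: "T \<in> Obj C" using \<mu>a Dom_Obj by (simp add: T_def)
  have Hg: "is_reflexive_graph C H"
    unfolding is_reflexive_graph_def H_def using T X th \<tau> \<tau>t by simp
  have qe: "q \<cdot> e = \<tau> \<cdot> s2"
  proof (rule jointly_monicD[OF tj, of _ "Dom C s1"])
    show "q \<cdot> e \<in> hom C (Dom C s1) (Dom C t1)" "\<tau> \<cdot> s2 \<in> hom C (Dom C s1) (Dom C t1)"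
      using tyh \<tau> by (simp_all add: hom_def arr_simps)
    show "t1 \<cdot> (q \<cdot> e) = t1 \<cdot> (\<tau> \<cdot> s2)" "t2 \<cdot> (q \<cdot> e) = t2 \<cdot> (\<tau> \<cdot> s2)"
      using tqe[of "Ide C (Dom C s1)"] \<tau>t[THEN reassoc, of s2] tyh \<tau> Dom_Obj[OF tS(1)]
      by (simp_all add: hom_def arr_simps)
  qed
  define \<phi> where "\<phi> = RGMor G H s2 q"
  have \<phi>: "is_rgmor C \<phi>"
    unfolding is_rgmor_def \<phi>_def using Gg Hg s2 qh tq qe by (simp add: G_def H_def)
  have "regular_epi (RG C) \<phi>"
    using regular_epi_RG_if_components[OF \<phi>] s2_reg \<mu>(2) by (simp add: \<phi>_def)
  then have HC: "H \<in> Cat C" using closed[of \<phi>] e by (simp add: \<phi>_def G_def)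
  have tr: "mem t1 t2 x z"
    if "x \<in> hom C Z X" "y \<in> hom C Z X" "mem t1 t2 x y" "mem t1 t2 y z" for Z x y z
    using internal_category_transitive[OF HC, of x Z y z] that by (simp add: H_def)
  have T_memI: "mem t1 t2 (s2 \<cdot> u) (s2 \<cdot> v)"
    if u: "u \<in> hom C Z (Dom C s1)" and v: "v \<in> hom C Z (Dom C s1)" and m: "mem r1 r2 (s1 \<cdot> u) (s1 \<cdot> v)" for Z u v
  proof -
    have "mem d c u v" using E_mem[OF u v] m by simp
    then obtain k where k: "k \<in> hom C Z (Dom C d)" "d \<cdot> k = u" "c \<cdot> k = v" using memE u by metis
    show ?thesis
      by (rule memI[of "q \<cdot> k" Z])
        (use k tyh tq[THEN reassoc, of k] in \<open>simp_all add: hom_def arr_simps\<close>)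
  qed
  have \<sigma>_elt: "s1 \<cdot> (\<sigma> \<cdot> x) = x" "s2 \<cdot> (\<sigma> \<cdot> x) = x" "\<sigma> \<cdot> x \<in> hom C Z (Dom C s1)" if "x \<in> hom C Z X" for x Z
    using \<sigma>(2,3)[THEN reassoc, of x] tyh that by (simp_all add: hom_def arr_simps)
  \<comment> \<open>Both points are represented in \<open>S\<close> by the diagonal, so that the two
    legs return the same point.\<close>
  have R_le: "mem t1 t2 x y" if x: "x \<in> hom C Z X" and y: "y \<in> hom C Z X" and m: "mem r1 r2 x y" for Z x y
    using T_memI[OF \<sigma>_elt(3)[OF x] \<sigma>_elt(3)[OF y]] \<sigma>_elt[OF x] \<sigma>_elt[OF y] m by simp
  \<comment> \<open>Here \<open>x\<close> is represented by the diagonal and \<open>y\<close> by the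
    witness \<open>k\<close> of the given pair. Both have first leg \<open>x\<close>, so reflexivity
    of \<open>R\<close> relates them.\<close>
  have S_le: "mem t1 t2 x y" if x: "x \<in> hom C Z X" and m: "mem s1 s2 x y" for Z x y
  proof -
    obtain k where k: "k \<in> hom C Z (Dom C s1)" "s1 \<cdot> k = x" "s2 \<cdot> k = y" using memE[OF m x] .
    then show ?thesis using T_memI[OF \<sigma>_elt(3)[OF x] k(1)] \<sigma>_elt[OF x] Rm(1)[OF x] by simp
  qed
  \<comment> \<open>Locally an element of \<open>T\<close> comes from \<open>u\<close>,
    \<open>v\<close> in \<open>S\<close> whose first legs are related by \<open>R\<close>. This is
    the path \<open>s2 u\<close>, \<open>s1 u\<close>, \<open>s1 v\<close>, \<open>s2 v\<close> of
    type \<open>S\<close>, \<open>R\<close>, \<open>S\<close>; its first step uses symmetry of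
    \<open>S\<close>.\<close>
  have T_le: "mem d1 d2 x y" if x: "x \<in> hom C Z X" and y: "y \<in> hom C Z X" and m: "mem t1 t2 x y" for Z x y
  proof -
    obtain k where k: "k \<in> hom C Z T" "t1 \<cdot> k = x" "t2 \<cdot> k = y" using memE[OF m x] th(1) by (auto simp: hom_def)
    obtain W w l where w: "regular_epi C w" "w \<in> hom C W Z" and l: "l \<in> hom C W (Dom C c)" "q \<cdot> l = k \<cdot> w"
      using regular_epi_lift[OF \<mu>(2), of k Z] k(1) qh by (auto simp: hom_def)
    define u v where "u = d \<cdot> l" and "v = c \<cdot> l"
    have uv: "u \<in> hom C W (Dom C s1)" "v \<in> hom C W (Dom C s1)"
      unfolding u_def v_def using Comp_hom[OF l(1)] dc by auto
    have "mem d c u v" unfolding u_def v_def by (rule memI[of l W]) (use l dc in \<open>simp_all add: hom_def\<close>)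
    then have m: "mem r1 r2 (s1 \<cdot> u) (s1 \<cdot> v)" using E_mem[OF uv] by simp
    have "s2 \<cdot> u = t1 \<cdot> (k \<cdot> w)" "s2 \<cdot> v = t2 \<cdot> (k \<cdot> w)"
      using tq[THEN reassoc, of l] l tyh by (simp_all add: u_def v_def hom_def arr_simps)
    then have xy: "s2 \<cdot> u = x \<cdot> w" "s2 \<cdot> v = y \<cdot> w"
      using k w(2) th k(2,3)[THEN reassoc, of w] by (simp_all add: hom_def)
    have s: "mem s1 s2 (s1 \<cdot> u) (s2 \<cdot> u)" "mem s1 s2 (s1 \<cdot> v) (s2 \<cdot> v)"
      using memI[of u W s1] memI[of v W s1] uv ty by auto
    have "mem c1 c2 (s2 \<cdot> u) (s1 \<cdot> v)"
      by (rule composite_memI[OF RS Sm(2)[OF sX(1)[OF uv(1)] s(1)] m sX(2)[OF uv(1)] sX(1)[OF uv(1)]])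
    then have "mem d1 d2 (s2 \<cdot> u) (s2 \<cdot> v)"
      by (rule composite_memI[OF SRS _ s(2) sX(2)[OF uv(1)] sX(1)[OF uv(2)]])
    then show ?thesis using mem_local[OF _ td(6) w x y] xy by simp
  qed
  have b: "b1 \<in> hom C (Dom C b1) X" "b2 \<in> hom C (Dom C b1) X" using tb by (simp_all add: hom_def)
  \<comment> \<open>It suffices to treat the generic element of \<open>R S R\<close>. Unfolding the
    two images replaces it by a path through \<open>y\<close> and \<open>z\<close> over a cover,
    whose steps are all in \<open>T\<close>.\<close>
  have "mem b1 b2 b1 b2"
    by (rule memI[of "Ide C (Dom C b1)" "Dom C b1"]) (use tb Dom_Obj[OF tb(1)] in \<open>simp_all add: hom_def arr_simps\<close>)
  then obtain V v y where v: "regular_epi C v" "v \<in> hom C V (Dom C b1)" "y \<in> hom C V X"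
    "mem a1 a2 (b1 \<cdot> v) y" "mem r1 r2 y (b2 \<cdot> v)" using composite_memE[OF RSR _ b(1)] by metis
  have bv: "b1 \<cdot> v \<in> hom C V X" "b2 \<cdot> v \<in> hom C V X" using Comp_hom v(2) b by auto
  obtain W w z where w: "regular_epi C w" "w \<in> hom C W V" "z \<in> hom C W X"
    "mem r1 r2 ((b1 \<cdot> v) \<cdot> w) z" "mem s1 s2 z (y \<cdot> w)"
    using composite_memE[OF SR v(4) bv(1)] by metis
  have h: "(b1 \<cdot> v) \<cdot> w \<in> hom C W X" "y \<cdot> w \<in> hom C W X" "(b2 \<cdot> v) \<cdot> w \<in> hom C W X"
    using Comp_hom[OF w(2)] bv v(3) by auto
  have "mem r1 r2 (y \<cdot> w) ((b2 \<cdot> v) \<cdot> w)" by (rule mem_restrict[OF v(5,3) w(2)]) (use tR in simp_all)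
  then have "mem t1 t2 ((b1 \<cdot> v) \<cdot> w) ((b2 \<cdot> v) \<cdot> w)"
    using tr[OF h(1) w(3) R_le[OF h(1) w(3,4)] tr[OF w(3) h(2) S_le[OF w(3,5)] R_le[OF h(2,3)]]] by simp
  then have "mem d1 d2 ((b1 \<cdot> v) \<cdot> w) ((b2 \<cdot> v) \<cdot> w)" by (rule T_le[OF h(1,3)])
  then have "mem d1 d2 (b1 \<cdot> v) (b2 \<cdot> v)" by (rule mem_local[OF _ td(6) w(1,2) bv])
  then have "mem d1 d2 b1 b2" by (rule mem_local[OF _ td(6) v(1,2) b])
  then show ?thesis by (simp add: rel_le_mem)
qed

text \<open>The hypothesis is implied by each of the two closure conditions. Equality follows from
  one inclusion, as the roles of \<open>R\<close> and \<open>S\<close> can be exchanged.\<close>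

lemma goursat_if_quotients:
  assumes closed: "\<And>\<phi>. regular_epi (RG C) \<phi> \<Longrightarrow> mdom \<phi> \<in> Grpd C \<Longrightarrow> mcod \<phi> \<in> Cat C"
  shows "goursat_category C"
  unfolding goursat_category_def rel_eq_def
proof (intro conjI allI impI regular; elim conjE)
  fix X R S SR RSR RS SRS
  assume h: "equivalence_rel C X R" "equivalence_rel C X S"
    "is_composite C X X X S R SR" "is_composite C X X X R SR RSR"
    "is_composite C X X X R S RS" "is_composite C X X X S RS SRS"
  show "rel_le C RSR SRS"
    using composite_le_if_quotients[OF closed, of X "fst R" "snd R" "fst S" "snd S" "fst SR" "snd SR"
        "fst RSR" "snd RSR" "fst RS" "snd RS" "fst SRS" "snd SRS"] h by simp
  show "rel_le C SRS RSR"
    using composite_le_if_quotients[OF closed, of X "fst S" "snd S" "fst R" "snd R" "fst RS" "snd RS"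
        "fst SRS" "snd SRS" "fst SR" "snd SR" "fst RSR" "snd RSR"] h by simp
qed

end

theorem theorem3p11:
  fixes C :: "('o, 'a) cat"
  assumes "regular_category C"
  shows "(goursat_category C \<longleftrightarrow> closed_under_quotients (RG C) (Grpd C)) \<and>
         (closed_under_quotients (RG C) (Grpd C) \<longleftrightarrow> closed_under_quotients (RG C) (Cat C))"
proof -
  interpret regular_cat C by unfold_locales fact
  \<comment> \<open>Through this inclusion, closure of groupoids weakens its conclusion and closure
    of categories restricts its premise to the same statement.\<close>
  have "Grpd C \<subseteq> Cat C" by (auto simp: Grpd_def Cat_def is_internal_groupoid_def)
  then have "goursat_category C"
    if "closed_under_quotients (RG C) (Grpd C) \<or> closed_under_quotients (RG C) (Cat C)"
    using that by (intro goursat_if_quotients) (auto simp: closed_under_quotients_def RG_simps)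
  with goursat_closed show ?thesis by blast
qed

end
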